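(* Let $b\ge2$ be an integer and let $\mathbf V=(V_1,\dots,V_b)$ be a random vector with $0\le V_i<1$ a.s. for $i=1,\dots,b$ and $\sum_{i=1}^bV_i=1$. Assume that the measure $\mu(\cdot)=\sum_{i=1}^b\mathbb{P}(-\log V_i\in\cdot\,,\,V_i>0)$ on $(0,\infty)$ is not concentrated on any lattice $h\mathbb{Z}$, $h>0$. Let $c>0$ be fixed and $p_n\in(0,1)$ with $1-p_n\sim\frac{c}{\ln n}$ as $n\to\infty$. Perform Bernoulli bond percolation with parameter $p_n$ on the fragmentation tree $T_n^{\mathrm f}$ of size $n$ with dislocation law $\mathbf V$, and let $C_n$ be the number of vertices of the percolation cluster containing the root. Then $$\lim_{n\to\infty}n^{-1}C_n=e^{-c/\beta}\quad\text{in probability},\qquad \beta:=\sum_{i=1}^b\mathbb{E}[V_i\log(1/V_i)]$$ (with $0\log(1/0)=0$).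
   Context: Fragmentation tree: start with a root of mass $x_0>0$. Every vertex of mass $x>0$ has $b$ children of masses $xV_1',\dots,xV_b'$, where $(V_1',\dots,V_b')$ is an independent copy of $\mathbf V$, independent over the vertices (children of mass $0$ are discarded). Regarding a vertex of mass $x$ as born at time $\log(x_0/x)$, this is the family tree of a Crump-Mode-Jagers process in which each individual has children at ages $\xi_i=-\log V_i$ (a child with $V_i=0$ is not born). For $t\ge0$, $T(t)$ is the tree consisting of the vertices born up to time $t$, i.e. of mass at least $x_0e^{-t}$, and $T_n^{\mathrm f}=T(\tau_n)$, where $\tau_n$ is the first time $t$ at which $T(t)$ has at least $n$ vertices. Thus $T_n^{\mathrm f}$ consists of all vertices whose mass is at least that of the $n$-th largest fragment. Bernoulli bond percolation with parameter $p_n$: each edge is kept with probability $p_n$ and removed with probability $1-p_n$, independently of the other edges and of the tree; clusters are the resulting connected components. $a_n\sim b_n$ means $a_n/b_n\to1$. *)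

theory Defs
  imports "HOL-Probability.Probability" "HOL-Library.Landau_Symbols"
begin

section \<open>Dislocation laws\<close>

text \<open>The number of children is \<open>CARD('b)\<close>; \<open>V\<close> is a random vector on the probability space \<open>\<Omega>\<close>.\<close>

text \<open>The measure \<open>\<mu>(A) = \<Sum>\<^sub>i P(- log V\<^sub>i \<in> A, V\<^sub>i > 0)\<close>, as a function of Borel sets \<open>A\<close>.\<close>

definition age_intensity :: "'o measure \<Rightarrow> ('o \<Rightarrow> real ^ 'b) \<Rightarrow> real set \<Rightarrow> real" where
  "age_intensity \<Omega> V A =
     (\<Sum>i\<in>UNIV. measure \<Omega> {\<omega> \<in> space \<Omega>. - ln (V \<omega> $ i) \<in> A \<and> V \<omega> $ i > 0})"

definition concentrated_on_lattice :: "(real set \<Rightarrow> real) \<Rightarrow> real \<Rightarrow> bool" where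
  "concentrated_on_lattice \<mu> h \<longleftrightarrow> \<mu> ({0<..} - (\<lambda>x. h * x) ` \<int>) = 0"

text \<open>The convention \<open>0 log (1/0) = 0\<close> holds because \<open>1 / 0 = 0\<close>.\<close>

definition mean_age :: "'o measure \<Rightarrow> ('o \<Rightarrow> real ^ 'b) \<Rightarrow> real" where
  "mean_age \<Omega> V = (\<Sum>i\<in>UNIV. integral\<^sup>L \<Omega> (\<lambda>\<omega>. V \<omega> $ i * ln (1 / V \<omega> $ i)))"


section \<open>Fragmentation trees\<close>

text \<open>
  Potential vertices are words over \<open>'b\<close>, most recent generation first: the root is \<open>[]\<close> and the
  \<open>i\<close>-th child of \<open>v\<close> is \<open>i # v\<close>.  All definitions here are for one realization: \<open>d v\<close> is the
  vector according to which the vertex \<open>v\<close> splits, and \<open>x\<^sub>0\<close> is the mass of the root.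
\<close>

primrec mass :: "real \<Rightarrow> ('b list \<Rightarrow> real ^ 'b) \<Rightarrow> 'b list \<Rightarrow> real" where
  "mass x\<^sub>0 d [] = x\<^sub>0"
| "mass x\<^sub>0 d (i # v) = mass x\<^sub>0 d v * d v $ i"

definition birth_time :: "real \<Rightarrow> ('b list \<Rightarrow> real ^ 'b) \<Rightarrow> 'b list \<Rightarrow> real" where
  "birth_time x\<^sub>0 d v = ln (x\<^sub>0 / mass x\<^sub>0 d v)"

text \<open>The vertex set of the tree \<open>T(t)\<close>. Vertices of mass 0, and so all their descendants, are discarded.\<close>

definition tree_at :: "real \<Rightarrow> ('b list \<Rightarrow> real ^ 'b) \<Rightarrow> real \<Rightarrow> 'b list set" where
  "tree_at x\<^sub>0 d t = {v. mass x\<^sub>0 d v > 0 \<and> birth_time x\<^sub>0 d v \<le> t}"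

text \<open>
  The first time at which \<open>T(t)\<close> has at least \<open>n\<close> vertices; almost surely the infimum is attained.
  The first disjunct is there because \<open>card\<close> is 0 on infinite sets.
\<close>

definition hitting_time :: "real \<Rightarrow> ('b list \<Rightarrow> real ^ 'b) \<Rightarrow> nat \<Rightarrow> real" where
  "hitting_time x\<^sub>0 d n =
     Inf {t. 0 \<le> t \<and> (infinite (tree_at x\<^sub>0 d t) \<or> n \<le> card (tree_at x\<^sub>0 d t))}"

definition frag_tree :: "real \<Rightarrow> ('b list \<Rightarrow> real ^ 'b) \<Rightarrow> nat \<Rightarrow> 'b list set" where
  "frag_tree x\<^sub>0 d n = tree_at x\<^sub>0 d (hitting_time x\<^sub>0 d n)"


section \<open>Percolation\<close>

text \<open>
  An edge is identified with its endpoint farther from the root: \<open>k (i # v)\<close> says whether the edge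
  between \<open>v\<close> and \<open>i # v\<close> is kept.
\<close>

definition kept_edges :: "'b list set \<Rightarrow> ('b list \<Rightarrow> bool) \<Rightarrow> ('b list \<times> 'b list) set" where
  "kept_edges S k = {(v, i # v) | v i. v \<in> S \<and> i # v \<in> S \<and> k (i # v)}"

definition cluster :: "'b list set \<Rightarrow> ('b list \<Rightarrow> bool) \<Rightarrow> 'b list \<Rightarrow> 'b list set" where
  "cluster S k u = {v \<in> S. (u, v) \<in> (kept_edges S k \<union> (kept_edges S k)\<inverse>)\<^sup>*}"


section \<open>Independence and convergence in probability\<close>

text \<open>
  Independence of two random variables, as in \<open>indep_var\<close>, which however requires both to have
  values in the same type.
\<close>

definition indep_rvs ::
    "'a measure \<Rightarrow> 's measure \<Rightarrow> ('a \<Rightarrow> 's) \<Rightarrow> 't measure \<Rightarrow> ('a \<Rightarrow> 't) \<Rightarrow> bool" where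
  "indep_rvs M S Y T Z \<longleftrightarrow>
     Y \<in> measurable M S \<and> Z \<in> measurable M T \<and>
     prob_space.indep_set M
       {Y -` A \<inter> space M | A. A \<in> sets S} {Z -` A \<inter> space M | A. A \<in> sets T}"

text \<open>
  Measurability is part of the notion: without it the events below could be non-measurable, and
  \<open>measure\<close> would then be 0 on them.
\<close>

definition tendsto_in_probability ::
    "'a measure \<Rightarrow> (nat \<Rightarrow> 'a \<Rightarrow> real) \<Rightarrow> real \<Rightarrow> bool" where
  "tendsto_in_probability M Y l \<longleftrightarrow>
     (\<forall>n. Y n \<in> borel_measurable M) \<and>
     (\<forall>\<epsilon>>0. (\<lambda>n. measure M {\<omega> \<in> space M. \<bar>Y n \<omega> - l\<bar> > \<epsilon>}) \<longlonglongrightarrow> 0)"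

end

theory Submission
  imports Defs "HOL-Library.Sublist"
begin

text \<open>
  Write \<open>m v\<close> for the mass of \<open>v\<close> when the root has mass 1, so that \<open>T(t) = {v. m v \<ge> e\<^sup>-\<^sup>t}\<close>.
  As mass is conserved, the vertices just outside a finite \<open>T(t)\<close> have total mass 1 and mass
  less than \<open>e\<^sup>-\<^sup>t\<close> each, hence \<open>b |T(t)| \<ge> e\<^sup>t\<close>. The tree with \<open>n\<close> vertices is therefore
  contained in \<open>T(ln (b n))\<close>, and moment estimates at this deterministic time suffice.

  (1) Heights. By \<open>E \<Sum>\<^bsub>|v| = k\<^esub> m(v)\<^sup>s = \<phi>(s)\<^sup>k\<close> with \<open>\<phi>(1) = 1\<close> and \<open>\<phi>'(1) = - \<beta>\<close>, a Chernoff bound on both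
  sides of \<open>s = 1\<close> shows that all but \<open>o(n)\<close> vertices have height \<open>(1/\<beta> + o(1)) ln n\<close>, so that they
  are connected to the root with probability close to \<open>e\<^sup>-\<^sup>c\<^sup>/\<^sup>\<beta>\<close>.

  (2) Variance. Given the tree, the variance of the cluster size is at most \<open>1 - p\<close> times the number
  of pairs of vertices, weighted by the height of their last common ancestor. Splitting the pairs according
  to this ancestor shows that the weighted number has expectation \<open>O(n\<^sup>2)\<close>.

  (3) Ties. The tree has more than \<open>n\<close> vertices only if several vertices have the smallest mass. The square
  of their number is bounded by the number of pairs of equal mass, whose expectation is \<open>o(n\<^sup>2)\<close>
  as soon as the atoms of the renewal measure vanish at infinity. This is the only use of the
  nonlattice condition: if atoms of asymptotic size \<open>A > 0\<close> persisted, there would also be atoms of nearly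
  this size at all shifts by elements of the semigroup generated by the atoms of \<open>\<mu>\<close>, and so
  unboundedly many of them in a bounded window.
\<close>

section \<open>Moments of the dislocation law\<close>

text \<open>No growth constant of \<open>T(t)\<close> has to be known: the cluster is compared with
  \<open>n\<close> itself. Bounds of the right order suffice, since every error has a small factor
  left: \<open>1 - p\<close> for the variance, an arbitrarily small constant for ties, a negative
  power of \<open>n\<close> for atypical heights. For the same reason the renewal theorem is
  avoided; an explicit superharmonic function shows that a root of mass \<open>z\<close> has on
  average \<open>O(z/y)\<close> descendants of mass at least \<open>y\<close>. All expectations are
  expressed by the one-step mean operator \<open>offspring\<close>. For pairs, one vertex is held
  fixed as a spectator while the subtree of the other is averaged; this is why the many-to-one
  formulas carry two masses. The sum over last common ancestors \<open>w\<close> converges because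
  the weights are of order \<open>mass powr (3/2)\<close>, and moments with an exponent above 1 are
  less than 1. Pairs range over words of length below some \<open>L\<close>, to keep the sums
  finite; the bounds do not involve \<open>L\<close>.\<close>

lemma measurable_component [measurable (raw)]:
  fixes f :: "'a \<Rightarrow> real ^ 'n"
  assumes "f \<in> borel_measurable N"
  shows "(\<lambda>x. f x $ i) \<in> borel_measurable N"
  using measurable_compose[OF assms borel_measurable_nth] .

locale dislocation = prob_space \<nu> for \<nu> :: "(real ^ 'b) measure" +
  assumes sets_eq_borel [measurable_cong]: "sets \<nu> = sets borel"
    and AE_range: "AE d in \<nu>. \<forall>i. 0 \<le> d $ i \<and> d $ i < 1"
    and AE_sum: "AE d in \<nu>. (\<Sum>i\<in>UNIV. d $ i) = 1"
begin

lemma space_eq_UNIV: "space \<nu> = UNIV"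
  using sets_eq_imp_space_eq[OF sets_eq_borel] by simp

text \<open>Children of mass 0 contribute \<open>f 0\<close>, so a constant has mean
  \<open>CARD('b)\<close> times its value. If \<open>f 0 = 0\<close>, this is the integral of
  \<open>f (exp (- t))\<close> against the measure \<mu>.\<close>

definition child_mean :: "(real \<Rightarrow> real) \<Rightarrow> real" where
  "child_mean f = (\<integral>d. (\<Sum>i\<in>UNIV. f (d $ i)) \<partial>\<nu>)"

lemma integrable_children:
  fixes f :: "real \<Rightarrow> real"
  assumes [measurable]: "f \<in> borel_measurable borel" and B: "\<And>x::real. 0 \<le> x \<Longrightarrow> x < 1 \<Longrightarrow> \<bar>f x\<bar> \<le> B"
  shows "integrable \<nu> (\<lambda>d. \<Sum>i\<in>UNIV. f (d $ i))"
proof (rule integrable_const_bound[where B = "real CARD('b) * B"])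
  show "AE d in \<nu>. norm (\<Sum>i\<in>UNIV. f (d $ i)) \<le> real CARD('b) * B"
    using AE_range
  proof eventually_elim
    case (elim d)
    have "norm (\<Sum>i\<in>UNIV. f (d $ i)) \<le> (\<Sum>i\<in>(UNIV::'b set). B)"
      using elim B by (intro sum_norm_le) auto
    then show ?case by simp
  qed
qed measurable

lemma child_mean_mono:
  assumes [measurable]: "f \<in> borel_measurable borel" "g \<in> borel_measurable borel"
    and "\<And>x. 0 \<le> x \<Longrightarrow> x < 1 \<Longrightarrow> \<bar>f x\<bar> \<le> B" "\<And>x. 0 \<le> x \<Longrightarrow> x < 1 \<Longrightarrow> \<bar>g x\<bar> \<le> C"
    and le: "\<And>x. 0 \<le> x \<Longrightarrow> x < 1 \<Longrightarrow> f x \<le> g x"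
  shows "child_mean f \<le> child_mean g"
  unfolding child_mean_def
proof (rule integral_mono_AE)
  show "AE d in \<nu>. (\<Sum>i\<in>UNIV. f (d $ i)) \<le> (\<Sum>i\<in>UNIV. g (d $ i))"
    using AE_range by eventually_elim (auto intro!: sum_mono le)
qed (use assms in \<open>auto intro!: integrable_children\<close>)

text \<open>The components sum to 1, so at least one of them is positive and makes the sum strictly
  larger; at 0 a weak inequality is then enough.\<close>

lemma child_mean_strict_mono:
  assumes [measurable]: "f \<in> borel_measurable borel" "g \<in> borel_measurable borel"
    and "\<And>x. 0 \<le> x \<Longrightarrow> x < 1 \<Longrightarrow> \<bar>f x\<bar> \<le> B" "\<And>x. 0 \<le> x \<Longrightarrow> x < 1 \<Longrightarrow> \<bar>g x\<bar> \<le> C"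
    and le: "f 0 \<le> g 0" and less: "\<And>x. 0 < x \<Longrightarrow> x < 1 \<Longrightarrow> f x < g x"
  shows "child_mean f < child_mean g"
  unfolding child_mean_def
proof (rule integral_less_AE_space)
  show "AE d in \<nu>. (\<Sum>i\<in>UNIV. f (d $ i)) < (\<Sum>i\<in>UNIV. g (d $ i))"
    using AE_range AE_sum
  proof eventually_elim
    case (elim d)
    have "\<exists>i. d $ i > 0"
    proof (rule ccontr)
      assume "\<not> ?thesis"
      then have "\<forall>i. d $ i = 0" using elim(1) by (meson linorder_not_less order_antisym)
      then show False using elim(2) by simp
    qed
    then obtain i where "d $ i > 0" by auto
    moreover have "f (d $ j) \<le> g (d $ j)" for j
      using le less[of "d $ j"] elim(1) by (cases "d $ j = 0") (auto simp: less_le)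
    ultimately show ?case using elim(1) less by (intro sum_strict_mono_ex1) auto
  qed
qed (use assms in \<open>auto intro!: integrable_children simp: emeasure_space_1\<close>)

lemma child_mean_id: "child_mean (\<lambda>x. x) = 1"
proof -
  have "child_mean (\<lambda>x. x) = (\<integral>d. 1 \<partial>\<nu>)"
    unfolding child_mean_def using AE_sum by (intro integral_cong_AE) auto
  then show ?thesis by (simp add: prob_space)
qed

lemma child_mean_diff:
  assumes [measurable]: "f \<in> borel_measurable borel" "g \<in> borel_measurable borel"
    and "\<And>x. 0 \<le> x \<Longrightarrow> x < 1 \<Longrightarrow> \<bar>f x\<bar> \<le> B" "\<And>x. 0 \<le> x \<Longrightarrow> x < 1 \<Longrightarrow> \<bar>g x\<bar> \<le> C"
  shows "child_mean (\<lambda>x. f x - g x) = child_mean f - child_mean g"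
  unfolding child_mean_def sum_subtractf
  using assms by (intro Bochner_Integration.integral_diff integrable_children) auto

lemma child_mean_add:
  assumes [measurable]: "f \<in> borel_measurable borel" "g \<in> borel_measurable borel"
    and "\<And>x. 0 \<le> x \<Longrightarrow> x < 1 \<Longrightarrow> \<bar>f x\<bar> \<le> B" "\<And>x. 0 \<le> x \<Longrightarrow> x < 1 \<Longrightarrow> \<bar>g x\<bar> \<le> C"
  shows "child_mean (\<lambda>x. f x + g x) = child_mean f + child_mean g"
  unfolding child_mean_def sum.distrib
  using assms by (intro Bochner_Integration.integral_add integrable_children) auto

lemma child_mean_cmult: "child_mean (\<lambda>x. c * f x) = c * child_mean f"
  unfolding child_mean_def sum_distrib_left[symmetric] by simp

lemma child_mean_cong:
  assumes [measurable]: "f \<in> borel_measurable borel" "g \<in> borel_measurable borel"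
    and eq: "\<And>x. 0 \<le> x \<Longrightarrow> x < 1 \<Longrightarrow> f x = g x"
  shows "child_mean f = child_mean g"
  unfolding child_mean_def
proof (rule integral_cong_AE)
  show "AE d in \<nu>. (\<Sum>i\<in>UNIV. f (d $ i)) = (\<Sum>i\<in>UNIV. g (d $ i))"
    using AE_range by eventually_elim (auto intro!: sum.cong eq)
qed measurable

text \<open>The function \<phi> of the overview. As \<open>0 powr s = 0\<close>, children of mass 0
  do not count, whatever \<open>s\<close> is.\<close>

definition moment :: "real \<Rightarrow> real" where
  "moment s = child_mean (\<lambda>x. x powr s)"

definition mean_log :: real where
  "mean_log = child_mean (\<lambda>x. x * ln (1 / x))"

lemma moment_nonneg: "0 \<le> moment s"
  unfolding moment_def child_mean_def by (intro integral_nonneg_AE AE_I2 sum_nonneg) auto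

lemma moment_less_one:
  assumes "s > 1" shows "moment s < 1"
proof -
  have "moment s < child_mean (\<lambda>x. x)"
    unfolding moment_def
  proof (rule child_mean_strict_mono)
    show "x powr s < x" if "0 < x" "x < 1" for x
      using powr_less_mono'[of x 1 s] that assms by simp
    show "\<bar>x powr s\<bar> \<le> 1" if "0 \<le> x" "x < 1" for x
      using that assms by (simp add: powr_le1)
    show "\<bar>x\<bar> \<le> 1" if "0 \<le> x" "x < 1" for x :: real
      using that by simp
  qed auto
  then show ?thesis by (simp add: child_mean_id)
qed

text \<open>Controls the quadratic term when \<open>x powr (1 + h)\<close> is expanded at
  \<open>h = 0\<close>: half a power of \<open>x\<close> is reserved to absorb the squared
  logarithm.\<close>

lemma sqrt_ln_square_le:
  fixes x :: real assumes "0 < x" "x < 1"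
  shows "x powr (1/2) * (ln x)\<^sup>2 \<le> 16"
proof -
  define y where "y = - ln x"
  have y: "y > 0" "x = exp (- y)" using assms by (auto simp: y_def)
  have "y/4 \<le> exp (y/4)" using exp_ge_add_one_self[of "y/4"] by linarith
  then have "(y/4)\<^sup>2 \<le> (exp (y/4))\<^sup>2" using y by (intro power_mono) auto
  also have "\<dots> = exp (y/2)" by (simp add: power2_eq_square exp_add[symmetric])
  finally have "y\<^sup>2 \<le> 16 * exp (y/2)" by (simp add: power2_eq_square)
  then have "exp (- y/2) * y\<^sup>2 \<le> exp (-y/2) * (16 * exp (y/2))" by (intro mult_left_mono) auto
  also have "\<dots> = 16" by (simp add: exp_add[symmetric])
  finally show ?thesis using y by (simp add: powr_def)
qed

lemma x_ln_inverse_bounded: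
  fixes x :: real assumes "0 \<le> x" "x < 1"
  shows "0 \<le> x * ln (1 / x)" "x * ln (1 / x) \<le> 1"
proof -
  show "0 \<le> x * ln (1 / x)" using assms by (cases "x = 0") (auto intro!: mult_nonneg_nonneg)
  have "x * ln (1/x) \<le> x * (1/x - 1)" if "x > 0"
    using that assms ln_le_minus_one[of "1/x"] by (intro mult_left_mono) auto
  also have "\<dots> \<le> 1" using assms by (auto simp: field_simps)
  finally show "x * ln (1 / x) \<le> 1" using assms by (cases "x = 0") auto
qed

lemma mean_log_pos: "0 < mean_log"
proof -
  have "child_mean (\<lambda>x. 0) < child_mean (\<lambda>x. x * ln (1 / x))"
  proof (rule child_mean_strict_mono)
    show "0 < x * ln (1 / x)" if "0 < x" "x < 1" for x :: real
      using that by simp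
    show "\<bar>x * ln (1 / x)\<bar> \<le> 1" if "0 \<le> x" "x < 1" for x :: real
      using x_ln_inverse_bounded[of x] that by simp
  qed auto
  then show ?thesis by (simp add: mean_log_def child_mean_def)
qed

lemma exp_le_quadratic:
  fixes u :: real shows "exp u \<le> 1 + u + u\<^sup>2 / 2 * exp \<bar>u\<bar>"
proof (cases "u = 0")
  case False
  then obtain t where t: "\<bar>t\<bar> \<le> \<bar>u\<bar>" "exp u = (\<Sum>m<2. u ^ m / fact m) + exp t / fact 2 * u ^ 2"
    using Maclaurin_exp_le[of u 2] by (auto simp: field_simps)
  have "exp t \<le> exp \<bar>u\<bar>" using t by simp
  then have "exp t / 2 * u\<^sup>2 \<le> exp \<bar>u\<bar> / 2 * u\<^sup>2" by (intro mult_right_mono divide_right_mono) auto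
  then show ?thesis using t by (simp add: numeral_2_eq_2 field_simps)
qed simp

text \<open>Second-order expansion at exponent 1, where the derivative is \<open>- mean_log\<close>.
  The constant 8 is half of the bound 16 on the quadratic term, and \<open>CARD('b)\<close> arises
  because this error is constant in the mass of the child.\<close>

lemma moment_le_exp:
  fixes h :: real assumes h: "\<bar>h\<bar> \<le> 1/2"
  shows "moment (1 + h) \<le> exp (- h * mean_log + 8 * CARD('b) * h\<^sup>2)"
proof -
  have pt: "x powr (1 + h) \<le> x - h * (x * ln (1/x)) + 8 * h\<^sup>2" if x: "0 \<le> x" "x < 1" for x
  proof (cases "x = 0")
    case False
    then have x: "0 < x" "x < 1" using x by auto
    have "x powr (1 + h) = x * exp (h * ln x)"
      using x by (simp add: powr_def exp_add distrib_right)
    also have "\<dots> \<le> x * (1 + h * ln x + (h * ln x)\<^sup>2 / 2 * exp \<bar>h * ln x\<bar>)"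
      using x by (intro mult_left_mono exp_le_quadratic) auto
    also have "\<dots> = x - h * (x * ln (1/x)) + h\<^sup>2 / 2 * ((x * exp \<bar>h * ln x\<bar>) * (ln x)\<^sup>2)"
      using x by (simp add: ln_div algebra_simps power2_eq_square)
    \<comment> \<open>The exponential costs at most \<open>x powr (-1/2)\<close>, because
      \<bar>h\<bar> is at most 1/2.\<close>
    also have "(x * exp \<bar>h * ln x\<bar>) \<le> x powr (1/2)"
    proof -
      have "\<bar>h * ln x\<bar> \<le> 1/2 * (- ln x)"
        using x h by (simp add: abs_mult mult_right_mono)
      then have "exp \<bar>h * ln x\<bar> \<le> x powr (-1/2)" using x by (simp add: powr_def)
      then have "x * exp \<bar>h * ln x\<bar> \<le> x * x powr (-1/2)" using x by (intro mult_left_mono) auto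
      also have "\<dots> = x powr (1/2)" using x powr_add[of x 1 "-1/2"] by simp
      finally show ?thesis .
    qed
    also have "x powr (1/2) * (ln x)\<^sup>2 \<le> 16" using x by (rule sqrt_ln_square_le)
    finally show ?thesis using h by (auto simp: mult_right_mono mult_left_mono)
  qed auto
  have b1: "\<bar>x powr (1 + h)\<bar> \<le> 1" if "0 \<le> x" "x < 1" for x
    using that h by (auto intro!: powr_le1)
  have b2: "\<bar>x * ln (1 / x)\<bar> \<le> 1" if "0 \<le> x" "x < 1" for x :: real
    using x_ln_inverse_bounded[of x] that by simp
  have b3: "\<bar>h * (x * ln (1 / x))\<bar> \<le> \<bar>h\<bar>" if "0 \<le> x" "x < 1" for x :: real
    using b2[OF that] by (simp add: abs_mult mult_left_le)
  have b4: "\<bar>x - h * (x * ln (1/x))\<bar> \<le> 1 + \<bar>h\<bar>" if "0 \<le> x" "x < 1" for x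
    using b3[OF that] that by linarith
  have "moment (1 + h) \<le> child_mean (\<lambda>x. (x - h * (x * ln (1/x))) + 8 * h\<^sup>2)"
    unfolding moment_def
    by (rule child_mean_mono[where B = 1 and C = "1 + \<bar>h\<bar> + 8 * h\<^sup>2"])
      (use pt b1 b4 in \<open>auto intro: order_trans[OF abs_triangle_ineq]\<close>)
  also have "\<dots> = child_mean (\<lambda>x. x - h * (x * ln (1/x))) + child_mean (\<lambda>x. 8 * h\<^sup>2)"
    by (rule child_mean_add) (use b4 in auto)
  also have "child_mean (\<lambda>x. x - h * (x * ln (1/x))) = 1 - h * mean_log"
    using child_mean_diff[of "\<lambda>x. x" "\<lambda>x. h * (x * ln (1/x))" 1 "\<bar>h\<bar>"] b3
    by (simp add: mean_log_def child_mean_cmult child_mean_id)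
  also have "child_mean (\<lambda>x. 8 * h\<^sup>2) = 8 * CARD('b) * h\<^sup>2"
    unfolding child_mean_def by (simp add: prob_space)
  also have "1 - h * mean_log + real (8 * CARD('b)) * h\<^sup>2 \<le> exp (- h * mean_log + real (8 * CARD('b)) * h\<^sup>2)"
    using exp_ge_add_one_self[of "- h * mean_log + real (8 * CARD('b)) * h\<^sup>2"] by (simp add: algebra_simps)
  finally show ?thesis .
qed

end

section \<open>The mean offspring operator\<close>

context dislocation begin

text \<open>The iterates are the mean generation sums, see
  \<open>nn_integral_generation_root\<close>. Values in \<open>ennreal\<close> avoid questions of
  integrability and summability.\<close>

definition offspring :: "(real \<Rightarrow> ennreal) \<Rightarrow> real \<Rightarrow> ennreal" where
  "offspring f z = (\<integral>\<^sup>+d. (\<Sum>i\<in>UNIV. f (z * d $ i)) \<partial>\<nu>)"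

lemma measurable_offspring2:
  assumes [measurable]: "case_prod f \<in> borel_measurable (N \<Otimes>\<^sub>M borel)" "g \<in> borel_measurable N"
  shows "(\<lambda>x. offspring (f x) (g x)) \<in> borel_measurable N"
  unfolding offspring_def by measurable

lemma measurable_offspring [measurable]:
  assumes [measurable]: "f \<in> borel_measurable borel"
  shows "offspring f \<in> borel_measurable borel"
  unfolding offspring_def by measurable

lemma measurable_offspring_funpow [measurable]:
  assumes [measurable]: "f \<in> borel_measurable borel"
  shows "(offspring ^^ k) f \<in> borel_measurable borel"
proof (induction k)
  case (Suc k)
  note [measurable] = this
  show ?case by simp
qed simp

lemma offspring_mono:
  assumes "\<And>x. x \<ge> 0 \<Longrightarrow> f x \<le> g x" "z \<ge> 0"
  shows "offspring f z \<le> offspring g z"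
  unfolding offspring_def
proof (rule nn_integral_mono_AE)
  show "AE d in \<nu>. (\<Sum>i\<in>UNIV. f (z * d $ i)) \<le> (\<Sum>i\<in>UNIV. g (z * d $ i))"
    using AE_range by eventually_elim (use assms in \<open>auto intro!: sum_mono mult_nonneg_nonneg\<close>)
qed

lemma offspring_cong:
  assumes "\<And>x. x \<ge> 0 \<Longrightarrow> f x = g x" "z \<ge> 0"
  shows "offspring f z = offspring g z"
  using assms by (intro antisym offspring_mono) auto

lemma offspring_funpow_mono:
  assumes "\<And>x. x \<ge> 0 \<Longrightarrow> f x \<le> g x" "z \<ge> 0"
  shows "(offspring ^^ k) f z \<le> (offspring ^^ k) g z"
  using assms(2)
proof (induction k arbitrary: z)
  case (Suc k)
  then show ?case unfolding funpow.simps o_apply by (intro offspring_mono) auto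
qed (simp add: assms)

text \<open>Self-similarity of the fragmentation; it allows any mass level to be normalised to
  1.\<close>

lemma offspring_funpow_scale: "(offspring ^^ k) (\<lambda>x. f (a * x)) z = (offspring ^^ k) f (a * z)"
  by (induction k arbitrary: z) (simp_all add: offspring_def mult.assoc)

lemma offspring_sum:
  assumes [measurable]: "\<And>k. k \<in> K \<Longrightarrow> f k \<in> borel_measurable borel"
  shows "offspring (\<lambda>x. \<Sum>k\<in>K. f k x) z = (\<Sum>k\<in>K. offspring (f k) z)"
proof -
  have "offspring (\<lambda>x. \<Sum>k\<in>K. f k x) z = (\<integral>\<^sup>+d. (\<Sum>k\<in>K. \<Sum>i\<in>UNIV. f k (z * d $ i)) \<partial>\<nu>)"
    unfolding offspring_def by (intro nn_integral_cong sum.swap)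
  also have "\<dots> = (\<Sum>k\<in>K. offspring (f k) z)"
    unfolding offspring_def by (rule nn_integral_sum) measurable
  finally show ?thesis .
qed

lemma offspring_ennreal:
  fixes f :: "real \<Rightarrow> real"
  assumes [measurable]: "f \<in> borel_measurable borel"
    and f: "\<And>x. 0 \<le> x \<Longrightarrow> x \<le> z \<Longrightarrow> 0 \<le> f x \<and> f x \<le> B" and "z \<ge> 0"
  shows "offspring (\<lambda>x. ennreal (f x)) z = ennreal (child_mean (\<lambda>x. f (z * x)))"
proof -
  have fz: "0 \<le> f (z * x)" "f (z * x) \<le> B" if x: "0 \<le> x" "x < 1" for x
  proof -
    have "0 \<le> z * x" "z * x \<le> z"
      using x \<open>z \<ge> 0\<close> by (auto intro!: mult_left_le)
    then show "0 \<le> f (z * x)" "f (z * x) \<le> B" using f by blast+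
  qed
  have "offspring (\<lambda>x. ennreal (f x)) z = (\<integral>\<^sup>+d. ennreal (\<Sum>i\<in>UNIV. f (z * d $ i)) \<partial>\<nu>)"
    unfolding offspring_def
  proof (rule nn_integral_cong_AE)
    show "AE d in \<nu>. (\<Sum>i\<in>UNIV. ennreal (f (z * d $ i))) = ennreal (\<Sum>i\<in>UNIV. f (z * d $ i))"
      using AE_range by eventually_elim (intro sum_ennreal, simp add: fz)
  qed
  also have "\<dots> = ennreal (child_mean (\<lambda>x. f (z * x)))"
    unfolding child_mean_def
  proof (rule nn_integral_eq_integral)
    show "AE d in \<nu>. 0 \<le> (\<Sum>i\<in>UNIV. f (z * d $ i))"
      using AE_range by eventually_elim (intro sum_nonneg, simp add: fz)
    show "integrable \<nu> (\<lambda>d. \<Sum>i\<in>UNIV. f (z * d $ i))"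
      by (rule integrable_children[where f = "\<lambda>x. f (z * x)" and B = B]) (simp_all add: fz)
  qed
  finally show ?thesis .
qed

lemma offspring_cmult:
  assumes [measurable]: "f \<in> borel_measurable borel"
  shows "offspring (\<lambda>x. c * f x) z = c * offspring f z"
  unfolding offspring_def sum_distrib_left[symmetric] by (rule nn_integral_cmult) measurable

lemma offspring_powr:
  assumes "s > 0" "z \<ge> 0"
  shows "offspring (\<lambda>x. ennreal (x powr s)) z = ennreal (moment s * z powr s)"
proof -
  have "offspring (\<lambda>x. ennreal (x powr s)) z = ennreal (child_mean (\<lambda>x. (z * x) powr s))"
    using assms by (intro offspring_ennreal[where B = "z powr s"]) (auto intro: powr_mono2)
  also have "child_mean (\<lambda>x. (z * x) powr s) = child_mean (\<lambda>x. z powr s * x powr s)"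
    using assms by (intro child_mean_cong) (auto simp: powr_mult mult.commute)
  finally show ?thesis unfolding child_mean_cmult moment_def by (simp add: mult.commute)
qed

lemma offspring_funpow_powr:
  assumes "s > 0" "z \<ge> 0"
  shows "(offspring ^^ k) (\<lambda>x. ennreal (x powr s)) z = ennreal (moment s ^ k * z powr s)"
  using assms(2)
proof (induction k arbitrary: z)
  case (Suc k)
  have "(offspring ^^ Suc k) (\<lambda>x. ennreal (x powr s)) z
      = offspring (\<lambda>x. ennreal (moment s ^ k) * ennreal (x powr s)) z"
    using Suc by (auto intro!: offspring_cong simp: ennreal_mult moment_nonneg)
  also have "\<dots> = ennreal (moment s ^ k) * ennreal (moment s * z powr s)"
    using Suc.prems assms by (subst offspring_cmult) (auto simp: offspring_powr)
  finally show ?case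
    by (simp add: moment_nonneg ennreal_mult[symmetric] mult.assoc mult.left_commute)
qed simp

text \<open>The potential (Green) operator of the branching mechanism, cut off at generation
  \<open>L\<close>; the vertex itself is included as generation 0.\<close>

definition progeny :: "nat \<Rightarrow> (real \<Rightarrow> ennreal) \<Rightarrow> real \<Rightarrow> ennreal" where
  "progeny L f z = (\<Sum>k<L. (offspring ^^ k) f z)"

lemma measurable_progeny [measurable]:
  assumes [measurable]: "f \<in> borel_measurable borel"
  shows "progeny L f \<in> borel_measurable borel"
  unfolding progeny_def by measurable

lemma progeny_Suc:
  assumes [measurable]: "f \<in> borel_measurable borel"
  shows "progeny (Suc L) f z = f z + offspring (progeny L f) z"
proof -
  have "offspring (progeny L f) z = (\<Sum>k<L. (offspring ^^ Suc k) f z)"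
    unfolding progeny_def by (subst offspring_sum) auto
  then show ?thesis
    unfolding progeny_def by (subst sum.lessThan_Suc_shift) simp
qed

text \<open>Discrete maximum principle, by induction over the number of generations through the
  recursion \<open>progeny_Suc\<close>.\<close>

lemma progeny_le_superharmonic:
  assumes [measurable]: "f \<in> borel_measurable borel"
    and sup: "\<And>z. z \<ge> 0 \<Longrightarrow> f z + offspring H z \<le> H z" and "z \<ge> 0"
  shows "progeny L f z \<le> H z"
  using \<open>z \<ge> 0\<close>
proof (induction L arbitrary: z)
  case (Suc L)
  have "progeny (Suc L) f z \<le> f z + offspring H z"
    using Suc by (auto simp: progeny_Suc intro!: add_left_mono offspring_mono)
  also have "\<dots> \<le> H z" using Suc sup by simp
  finally show ?case .
qed (simp add: progeny_def)

text \<open>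
  The function \<open>z \<mapsto> D max (0, 2 z - \<surd>z)\<close> is superharmonic for the branching mechanism, strictly
  so above mass 1. Hence the expected number of vertices of mass at least 1 is
  at most linear in the mass of the root.
\<close>

lemma progeny_count_le:
  obtains B where "B > 0"
    "\<And>L y z. y > 0 \<Longrightarrow> z \<ge> 0 \<Longrightarrow> progeny L (indicator {y..}) z \<le> ennreal (B * z / y)"
proof -
  \<comment> \<open>One split multiplies the correction term \<open>sqrt z\<close> by at least this
    mean when \<open>z\<close> is at least 1. It exceeds 1 because the integrand lies above
    \<open>x\<close> on the open unit interval, and \<open>x\<close> has mean 1.\<close>
  define \<psi> where "\<psi> = child_mean (\<lambda>x. min (sqrt x) (2 * x))"
  have "child_mean (\<lambda>x. x) < \<psi>"
    unfolding \<psi>_def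
  proof (rule child_mean_strict_mono)
    show "x < min (sqrt x) (2 * x)" if "0 < x" "x < 1" for x :: real
    proof -
      have "x * x < 1 * x" using that by (intro mult_strict_right_mono) auto
      then show ?thesis using that by (auto intro!: real_less_rsqrt simp: power2_eq_square)
    qed
    show "\<bar>min (sqrt x) (2 * x)\<bar> \<le> 2" if "0 \<le> x" "x < 1" for x using that by auto
    show "\<bar>x\<bar> \<le> 1" if "0 \<le> x" "x < 1" for x :: real using that by auto
  qed auto
  then have \<psi>: "\<psi> > 1" by (simp add: child_mean_id)
  \<comment> \<open>Makes the gain \<open>D * (\<psi> - 1) * sqrt z\<close> at least 1 for
    \<open>z \<ge> 1\<close>, which pays for the root itself.\<close>
  define D where "D = 1 / (\<psi> - 1)"
  have D: "D > 0" using \<psi> by (simp add: D_def)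
  define H where "H z = D * max 0 (2 * z - sqrt z)" for z
  have [measurable]: "H \<in> borel_measurable borel" unfolding H_def by measurable
  have H_bound: "0 \<le> H x \<and> H x \<le> D * (2 * z)" if "0 \<le> x" "x \<le> z" for x z
  proof -
    have "0 \<le> sqrt x" using that by simp
    then have "max 0 (2 * x - sqrt x) \<le> 2 * z" using that by linarith
    then show ?thesis using that D by (auto simp: H_def intro!: mult_left_mono mult_nonneg_nonneg)
  qed
  have H_nonneg: "0 \<le> H x" if "0 \<le> x" for x using H_bound[of x x] that by simp
  have harm: "child_mean (\<lambda>x. H (z * x)) + indicator {1..} z \<le> H z" if z: "z \<ge> 0" for z
  proof (cases "z \<ge> 1")
    \<comment> \<open>Below mass 1 the root is not counted. There
      \<open>H (z * x) \<le> H z * x\<close> since \<open>x \<le> sqrt x\<close>, and the child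
      masses add up to that of the parent.\<close>
    case False
    have le: "H (z * x) \<le> H z * x" if "0 \<le> x" "x < 1" for x
    proof -
      have "x * x \<le> 1 * x" using that by (intro mult_right_mono) auto
      then have "x \<le> sqrt x" by (intro real_le_rsqrt) (auto simp: power2_eq_square)
      then have "sqrt z * x \<le> sqrt z * sqrt x" using z by (intro mult_left_mono) auto
      then have "2 * (z * x) - sqrt (z * x) \<le> (2 * z - sqrt z) * x"
        by (simp add: real_sqrt_mult algebra_simps)
      also have "\<dots> \<le> max 0 (2 * z - sqrt z) * x" using that by (intro mult_right_mono) auto
      finally have "max 0 (2 * (z * x) - sqrt (z * x)) \<le> max 0 (2 * z - sqrt z) * x"
        using that by auto
      then show ?thesis using D unfolding H_def mult.assoc by (intro mult_left_mono) auto
    qed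
    have "child_mean (\<lambda>x. H (z * x)) \<le> child_mean (\<lambda>x. H z * x)"
    proof (rule child_mean_mono)
      show "\<bar>H (z * x)\<bar> \<le> D * (2 * z)" if "0 \<le> x" "x < 1" for x
        using H_bound[of "z * x" z] that z by (simp add: mult_left_le)
      show "\<bar>H z * x\<bar> \<le> \<bar>H z\<bar>" if "0 \<le> x" "x < 1" for x
        using that by (simp add: abs_mult mult_left_le)
    qed (use le in auto)
    then show ?thesis using False by (simp add: child_mean_cmult child_mean_id)
  next
    case True
    define G where "G x = min (sqrt x) (2 * x)" for x :: real
    \<comment> \<open>The truncation at 0 in \<open>H\<close> replaces \<open>sqrt (z * x)\<close>
      by its minimum with \<open>2 * (z * x)\<close>; for \<open>z \<ge> 1\<close> this minimum is
      at least \<open>sqrt z * G x\<close>.\<close>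
    have le: "H (z * x) \<le> D * (2 * z * x - sqrt z * G x)" if "0 \<le> x" "x < 1" for x
    proof -
      have "z \<ge> sqrt z" using True by (intro real_le_lsqrt) (auto simp: power2_eq_square)
      then have "sqrt z * (2 * x) \<le> z * (2 * x)" using that by (intro mult_right_mono) auto
      then have "max 0 (2 * (z * x) - sqrt (z * x)) = 2 * (z * x) - min (sqrt z * sqrt x) (2 * (z * x))"
        by (auto simp: real_sqrt_mult)
      also have "\<dots> \<le> 2 * z * x - sqrt z * G x"
      proof -
        have "sqrt z * G x \<le> sqrt z * sqrt x" "sqrt z * G x \<le> sqrt z * (2 * x)"
          using z by (auto simp: G_def intro!: mult_left_mono)
        then show ?thesis using \<open>sqrt z * (2 * x) \<le> z * (2 * x)\<close> by auto
      qed
      finally show ?thesis using D unfolding H_def by (intro mult_left_mono) auto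
    qed
    have G: "\<bar>sqrt z * G x\<bar> \<le> sqrt z * 2" if "0 \<le> x" "x < 1" for x
      using that z by (auto simp: abs_mult G_def intro!: mult_left_mono)
    have zx: "\<bar>2 * z * x\<bar> \<le> 2 * z" if "0 \<le> x" "x < 1" for x
      using that z by (simp add: abs_mult mult_left_le)
    have "child_mean (\<lambda>x. H (z * x)) \<le> child_mean (\<lambda>x. D * (2 * z * x - sqrt z * G x))"
    proof (rule child_mean_mono)
      show "\<bar>H (z * x)\<bar> \<le> D * (2 * z)" if "0 \<le> x" "x < 1" for x
        using H_bound[of "z * x" z] that z by (simp add: mult_left_le)
      show "\<bar>D * (2 * z * x - sqrt z * G x)\<bar> \<le> D * (2 * z + sqrt z * 2)" if "0 \<le> x" "x < 1" for x
        unfolding abs_mult using D zx[OF that] G[OF that]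
        by (auto intro!: mult_left_mono order_trans[OF abs_triangle_ineq4])
    qed (use le in \<open>auto simp: G_def\<close>)
    also have "\<dots> = D * (2 * z * child_mean (\<lambda>x. x) - sqrt z * \<psi>)"
      unfolding \<psi>_def G_def[symmetric] child_mean_cmult[symmetric] 
      by (subst child_mean_diff[symmetric, where B = "2 * z" and C = "sqrt z * 2"])
        (use zx G in \<open>auto simp: G_def child_mean_cmult\<close>)
    also have "\<dots> + 1 \<le> D * (2 * z - sqrt z)"
    proof -
      have "1 \<le> sqrt z" using True by simp
      then have "D * (\<psi> - 1) \<le> D * (\<psi> - 1) * sqrt z" using D \<psi> by (simp add: mult_left_le)
      moreover have "D * (\<psi> - 1) = 1" using \<psi> by (simp add: D_def)
      ultimately show ?thesis by (simp add: child_mean_id algebra_simps)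
    qed
    also have "\<dots> \<le> H z" using D by (auto simp: H_def)
    finally show ?thesis using True by simp
  qed
  have prog: "progeny L (indicator {1..}) z \<le> ennreal (H z)" if "z \<ge> 0" for L z
  proof (rule progeny_le_superharmonic)
    fix z :: real assume z: "z \<ge> 0"
    have nn: "0 \<le> child_mean (\<lambda>x. H (z * x))"
      unfolding child_mean_def
    proof (rule integral_nonneg_AE)
      show "AE d in \<nu>. 0 \<le> (\<Sum>i\<in>UNIV. H (z * d $ i))"
        using AE_range by eventually_elim (use H_nonneg z in \<open>auto intro!: sum_nonneg mult_nonneg_nonneg\<close>)
    qed
    have "indicator {1..} z + offspring (\<lambda>x. ennreal (H x)) z
        = ennreal (indicator {1..} z) + ennreal (child_mean (\<lambda>x. H (z * x)))"
    proof (rule arg_cong2[where f = "(+)"])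
      show "offspring (\<lambda>x. ennreal (H x)) z = ennreal (child_mean (\<lambda>x. H (z * x)))"
        by (rule offspring_ennreal[where B = "D * (2 * z)"]) (use H_bound z in auto)
    qed (simp split: split_indicator)
    also have "\<dots> = ennreal (child_mean (\<lambda>x. H (z * x)) + indicator {1..} z)"
      using nn by (subst ennreal_plus[symmetric]) (auto simp: add.commute)
    also have "\<dots> \<le> ennreal (H z)" using harm z by (intro ennreal_leI) auto
    finally show "indicator {1..} z + offspring (\<lambda>x. ennreal (H x)) z \<le> ennreal (H z)" .
  qed (use that in auto)
  show ?thesis
  proof (rule that[of "2 * D"])
    fix L and y z :: real assume yz: "y > 0" "z \<ge> 0"
    have "indicator {y..} = (\<lambda>x. indicator {1..} (1 / y * x) :: ennreal)"
      using yz by (auto simp: fun_eq_iff field_simps split: split_indicator)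
    then have "progeny L (indicator {y..}) z = progeny L (indicator {1..}) (1 / y * z)"
      by (simp only: progeny_def offspring_funpow_scale)
    also have "\<dots> \<le> ennreal (H (1 / y * z))" using yz by (intro prog) auto
    also have "\<dots> \<le> ennreal (2 * D * z / y)"
    proof (rule ennreal_leI)
      have "H (1 / y * z) \<le> D * (2 * (1 / y * z))"
        using H_bound[of "1 / y * z" "1 / y * z"] yz by simp
      then show "H (1 / y * z) \<le> 2 * D * z / y" by (simp add: mult.commute mult.left_commute)
    qed
    finally show "progeny L (indicator {y..}) z \<le> ennreal (2 * D * z / y)" .
  qed (use D in auto)
qed

end

section \<open>Splitting vectors as a product space\<close>

text \<open>Words list the most recent generation first, so proper ancestors are strict suffixes,
  and only their vectors enter the mass of \<open>v\<close>; the vector at \<open>v\<close> itself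
  does not.\<close>

lemma mass_fun_upd:
  assumes "\<not> strict_suffix u v"
  shows "mass x (d(u := y)) v = mass x d v"
  using assms
proof (induction v)
  case (Cons i v)
  have "\<not> suffix u v" using Cons.prems by (auto simp: strict_suffix_def suffix_def)
  then have "u \<noteq> v" "\<not> strict_suffix u v" by (auto simp: strict_suffix_def)
  then show ?case using Cons.IH by simp
qed simp

lemma mass_scale: "mass x d v = x * mass 1 d v"
  by (induction v) auto

text \<open>The almost sure properties of the dislocation law at all words simultaneously, including
  those below vertices of mass 0. This is the hypothesis of the pathwise arguments.\<close>

definition conservative :: "('b list \<Rightarrow> real ^ 'b) \<Rightarrow> bool" where
  "conservative d \<longleftrightarrow> (\<forall>v. (\<forall>i. 0 \<le> d v $ i \<and> d v $ i < 1) \<and> (\<Sum>i\<in>UNIV. d v $ i) = 1)"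

lemma mass_nonneg:
  assumes "conservative d"
  shows "0 \<le> mass 1 d v"
  using assms by (induction v) (auto simp: conservative_def)

lemma mass_append_le:
  assumes "conservative d"
  shows "mass 1 d (u @ w) \<le> mass 1 d w"
proof (induction u)
  case (Cons i u)
  have "mass 1 d (u @ w) * d (u @ w) $ i \<le> mass 1 d (u @ w)"
    using assms mass_nonneg[OF assms] by (intro mult_left_le) (auto simp: conservative_def less_imp_le)
  then show ?case using Cons by simp
qed simp

lemma mass_le_1:
  assumes "conservative d"
  shows "mass 1 d v \<le> 1"
  using mass_append_le[OF assms, of v "[]"] by simp

definition generation :: "nat \<Rightarrow> 'b::finite list set" where
  "generation k = {u. length u = k}"

definition words :: "nat \<Rightarrow> 'b::finite list set" where
  "words L = {u. length u < L}"

lemma finite_generation [simp]: "finite (generation k :: 'b::finite list set)"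
  using finite_lists_length_eq[of "UNIV :: 'b set" k] by (simp add: generation_def)

lemma words_eq: "words L = (\<Union>k<L. generation k)"
  by (auto simp: words_def generation_def)

lemma finite_words [simp]: "finite (words L :: 'b::finite list set)"
  unfolding words_eq by (intro finite_UN_I finite_generation finite_lessThan)

lemma sum_words: "(\<Sum>u\<in>words L. f u) = (\<Sum>k<L. \<Sum>u\<in>generation k. f u)"
  unfolding words_eq by (rule sum.UNION_disjoint) (simp, simp, auto simp: generation_def)

lemma sum_generation_0: "(\<Sum>u\<in>generation 0. f u) = f []"
  by (simp add: generation_def)

lemma sum_generation_Suc: "(\<Sum>u\<in>generation (Suc k). f u) = (\<Sum>u\<in>generation k. \<Sum>i\<in>UNIV. f (i # u))"
proof -
  have "(\<Sum>u\<in>generation k. \<Sum>i\<in>UNIV. f (i # u)) = (\<Sum>(u, i)\<in>generation k \<times> UNIV. f (i # u))"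
    by (rule sum.cartesian_product)
  also have "\<dots> = (\<Sum>u\<in>generation (Suc k). f u)"
    by (rule sum.reindex_bij_witness[where i = "\<lambda>u. (tl u, hd u)" and j = "\<lambda>(u, i). i # u"])
      (auto simp: generation_def length_Suc_conv)
  finally show ?thesis by simp
qed

context dislocation begin

definition splits :: "('b list \<Rightarrow> real ^ 'b) measure" where
  "splits = (\<Pi>\<^sub>M v\<in>UNIV. \<nu>)"

lemma prob_space_splits: "prob_space splits"
  unfolding splits_def by (intro prob_space_PiM) unfold_locales

lemma sets_splits [measurable_cong]: "sets splits = sets (\<Pi>\<^sub>M v\<in>UNIV. borel)"
  unfolding splits_def by (intro sets_PiM_cong refl sets_eq_borel)

lemma space_splits: "space splits = UNIV"
  by (simp add: splits_def space_PiM space_eq_UNIV)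

lemma measurable_split: "(\<lambda>d. d v) \<in> borel_measurable splits"
  by measurable

lemma measurable_mass [measurable]: "(\<lambda>d. mass x d v) \<in> borel_measurable splits"
proof (induction v)
  case (Cons i v)
  note [measurable] = this measurable_split
  show ?case unfolding mass.simps by measurable
qed simp

lemma AE_conservative: "AE d in splits. conservative d"
proof -
  have "AE y in \<nu>. (\<forall>i. 0 \<le> y $ i \<and> y $ i < 1) \<and> (\<Sum>i\<in>UNIV. y $ i) = 1"
    using AE_range AE_sum by eventually_elim auto
  then have "AE d in splits. (\<forall>i. 0 \<le> d v $ i \<and> d v $ i < 1) \<and> (\<Sum>i\<in>UNIV. d v $ i) = 1" for v
    unfolding splits_def by (intro AE_PiM_component) (unfold_locales, auto)
  then show ?thesis unfolding conservative_def by (subst AE_all_countable) auto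
qed

text \<open>A product law does not change when one coordinate is replaced by an independent copy.
  The vector at \<open>u\<close> is thus integrated out while all that does not look at it keeps its
  value.\<close>

lemma nn_integral_resample:
  assumes [measurable]: "F \<in> borel_measurable splits"
  shows "(\<integral>\<^sup>+d. F d \<partial>splits) = (\<integral>\<^sup>+d. \<integral>\<^sup>+y. F (d(u := y)) \<partial>\<nu> \<partial>splits)"
proof -
  interpret splits: prob_space splits by (rule prob_space_splits)
  interpret pair_sigma_finite \<nu> splits ..
  have upd [measurable]: "(\<lambda>(y, d). d(u := y)) \<in> measurable (\<nu> \<Otimes>\<^sub>M splits) splits"
    unfolding splits_def split_beta by (rule measurable_fun_upd[where J = UNIV]) auto
  have "distr (\<nu> \<Otimes>\<^sub>M splits) splits (\<lambda>(y, d). d(u := y)) = splits"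
    using distr_pair_PiM_eq_PiM[of UNIV "\<lambda>_. \<nu>" u] prob_space_axioms by (simp add: splits_def)
  then have "(\<integral>\<^sup>+d. F d \<partial>splits) = (\<integral>\<^sup>+d. F d \<partial>distr (\<nu> \<Otimes>\<^sub>M splits) splits (\<lambda>(y, d). d(u := y)))"
    by simp
  also have "\<dots> = (\<integral>\<^sup>+x. F ((snd x)(u := fst x)) \<partial>(\<nu> \<Otimes>\<^sub>M splits))"
    by (subst nn_integral_distr) (auto simp: split_beta)
  also have "\<dots> = (\<integral>\<^sup>+d. \<integral>\<^sup>+y. F (d(u := y)) \<partial>\<nu> \<partial>splits)"
    using upd by (subst nn_integral_snd[symmetric]) (auto simp: split_beta)
  finally show ?thesis .
qed

text \<open>The branching property at one vertex, with a spectator \<open>v\<close>: since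
  \<open>u\<close> is no proper ancestor of \<open>v\<close>, resampling the vector at
  \<open>u\<close> alters the masses of the children of \<open>u\<close> but neither that of
  \<open>v\<close> nor that of \<open>u\<close>.\<close>

lemma nn_integral_children:
  assumes [measurable]: "case_prod f \<in> borel_measurable (borel \<Otimes>\<^sub>M borel)"
    and u: "\<not> strict_suffix u v"
  shows "(\<integral>\<^sup>+d. (\<Sum>i\<in>UNIV. f (mass 1 d v) (mass 1 d (i # u))) \<partial>splits)
    = (\<integral>\<^sup>+d. offspring (f (mass 1 d v)) (mass 1 d u) \<partial>splits)"
proof -
  have "(\<integral>\<^sup>+d. (\<Sum>i\<in>UNIV. f (mass 1 d v) (mass 1 d (i # u))) \<partial>splits)
     = (\<integral>\<^sup>+d. \<integral>\<^sup>+y. (\<Sum>i\<in>UNIV. f (mass 1 (d(u := y)) v) (mass 1 (d(u := y)) (i # u))) \<partial>\<nu> \<partial>splits)"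
    using measurable_split by (intro nn_integral_resample) (unfold mass.simps, measurable)
  then show ?thesis
    using u by (simp add: mass_fun_upd offspring_def)
qed

lemma measurable_offspring_funpow2:
  assumes [measurable]: "case_prod f \<in> borel_measurable (borel \<Otimes>\<^sub>M borel)"
  shows "(\<lambda>(y, z). (offspring ^^ k) (f y) z) \<in> borel_measurable (borel \<Otimes>\<^sub>M borel)"
proof (induction k)
  case (Suc k)
  have "(\<lambda>x. offspring ((\<lambda>x. (offspring ^^ k) (f (fst x))) x) (snd x)) \<in> borel_measurable (borel \<Otimes>\<^sub>M borel)"
  proof (rule measurable_offspring2)
    have "(\<lambda>x. (\<lambda>(y, z). (offspring ^^ k) (f y) z) (fst (fst x), snd x)) \<in> borel_measurable ((borel \<Otimes>\<^sub>M borel) \<Otimes>\<^sub>M borel)"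
      by (rule measurable_compose[OF _ Suc]) measurable
    then show "(\<lambda>(x, y). (offspring ^^ k) (f (fst x)) y) \<in> borel_measurable ((borel \<Otimes>\<^sub>M borel) \<Otimes>\<^sub>M borel)"
      by (simp add: case_prod_unfold)
  qed measurable
  then show ?case by (simp add: split_beta)
qed simp

text \<open>Many-to-one formula below \<open>w\<close> with a spectator \<open>v\<close>. The last
  generation is averaged first, which replaces \<open>f\<close> by its \<open>offspring\<close>. The
  spectator remains unaffected, because if some \<open>u @ w\<close> were a proper ancestor of
  \<open>v\<close>, then so would be \<open>w\<close>.\<close>

lemma nn_integral_generation:
  assumes [measurable]: "case_prod f \<in> borel_measurable (borel \<Otimes>\<^sub>M borel)"
    and w: "\<not> strict_suffix w v"
  shows "(\<integral>\<^sup>+d. (\<Sum>u\<in>generation k. f (mass 1 d v) (mass 1 d (u @ w))) \<partial>splits)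
    = (\<integral>\<^sup>+d. (offspring ^^ k) (f (mass 1 d v)) (mass 1 d w) \<partial>splits)"
  using assms(1)
proof (induction k arbitrary: f)
  case (Suc k)
  note [measurable] = Suc.prems
  have meas: "(\<lambda>(y, z). offspring (f y) z) \<in> borel_measurable (borel \<Otimes>\<^sub>M borel)"
    using measurable_offspring_funpow2[OF Suc.prems, of 1] by simp
  note [measurable] = measurable_Pair_compose_split[OF meas]
  have f [measurable]: "(\<lambda>d. f (mass 1 d v) (mass 1 d u)) \<in> borel_measurable splits" for u
    by measurable
  have "(\<integral>\<^sup>+d. (\<Sum>u\<in>generation (Suc k). f (mass 1 d v) (mass 1 d (u @ w))) \<partial>splits)
      = (\<Sum>u\<in>generation k. \<integral>\<^sup>+d. (\<Sum>i\<in>UNIV. f (mass 1 d v) (mass 1 d (i # (u @ w)))) \<partial>splits)"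
    unfolding sum_generation_Suc append_Cons
    by (intro nn_integral_sum borel_measurable_sum f)
  also have "\<dots> = (\<Sum>u\<in>generation k. \<integral>\<^sup>+d. offspring (f (mass 1 d v)) (mass 1 d (u @ w)) \<partial>splits)"
  proof (intro sum.cong refl nn_integral_children Suc.prems)
    fix u show "\<not> strict_suffix (u @ w) v"
      using w by (auto simp: strict_suffix_def suffix_def)
  qed
  also have "\<dots> = (\<integral>\<^sup>+d. (\<Sum>u\<in>generation k. offspring (f (mass 1 d v)) (mass 1 d (u @ w))) \<partial>splits)"
    by (rule nn_integral_sum[symmetric]) measurable
  also have "\<dots> = (\<integral>\<^sup>+d. (offspring ^^ k) (offspring (f (mass 1 d v))) (mass 1 d w) \<partial>splits)"
    by (rule Suc.IH[OF meas])
  finally show ?case by (simp add: funpow_swap1)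
qed (simp add: sum_generation_0)

lemma nn_integral_words:
  assumes [measurable]: "case_prod f \<in> borel_measurable (borel \<Otimes>\<^sub>M borel)"
    and w: "\<not> strict_suffix w v"
  shows "(\<integral>\<^sup>+d. (\<Sum>u\<in>words L. f (mass 1 d v) (mass 1 d (u @ w))) \<partial>splits)
    = (\<integral>\<^sup>+d. progeny L (f (mass 1 d v)) (mass 1 d w) \<partial>splits)"
proof -
  note m = measurable_offspring_funpow2[OF assms(1)]
  note [measurable] = measurable_Pair_compose_split[OF m]
  have f [measurable]: "(\<lambda>d. f (mass 1 d v) (mass 1 d u)) \<in> borel_measurable splits" for u
    by measurable
  have "(\<integral>\<^sup>+d. (\<Sum>u\<in>words L. f (mass 1 d v) (mass 1 d (u @ w))) \<partial>splits)
    = (\<Sum>k<L. \<integral>\<^sup>+d. (\<Sum>u\<in>generation k. f (mass 1 d v) (mass 1 d (u @ w))) \<partial>splits)"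
    unfolding sum_words by (intro nn_integral_sum borel_measurable_sum f)
  also have "\<dots> = (\<Sum>k<L. \<integral>\<^sup>+d. (offspring ^^ k) (f (mass 1 d v)) (mass 1 d w) \<partial>splits)"
    using assms by (simp add: nn_integral_generation)
  also have "\<dots> = (\<integral>\<^sup>+d. progeny L (f (mass 1 d v)) (mass 1 d w) \<partial>splits)"
    unfolding progeny_def by (rule nn_integral_sum[symmetric]) measurable
  finally show ?thesis .
qed

lemma nn_integral_generation_root:
  assumes [measurable]: "f \<in> borel_measurable borel"
  shows "(\<integral>\<^sup>+d. (\<Sum>u\<in>generation k. f (mass 1 d u)) \<partial>splits) = (offspring ^^ k) f 1"
proof -
  have "case_prod (\<lambda>_. f) \<in> borel_measurable (borel \<Otimes>\<^sub>M borel)" by measurable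
  from nn_integral_generation[OF this, of "[]" "[]" k] show ?thesis
    by (simp add: strict_suffix_def prob_space.emeasure_space_1[OF prob_space_splits])
qed

end

section \<open>Atoms of the renewal measure\<close>

text \<open>Division with remainder: \<open>h\<close> is the least positive element, which exists
  because a single window is finite, and a remainder is a nonnegative element below
  \<open>h\<close>, hence 0.\<close>

lemma additive_subgroup_discrete:
  fixes G :: "real set"
  assumes diff: "\<And>x y. x \<in> G \<Longrightarrow> y \<in> G \<Longrightarrow> x - y \<in> G"
    and a: "a \<in> G" "a > 0" and fin: "finite (G \<inter> {0..a})"
  obtains h where "h > 0" "G \<subseteq> (\<lambda>x. h * x) ` \<int>"
proof -
  define h where "h = Min (G \<inter> {0<..a})"
  have fin': "finite (G \<inter> {0<..a})" by (rule finite_subset[OF _ fin]) auto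
  have "h \<in> G \<inter> {0<..a}" unfolding h_def using a by (intro Min_in fin') auto
  then have h: "h \<in> G" "h > 0" "h \<le> a" by auto
  have minus: "- x \<in> G" if "x \<in> G" for x using diff[of 0 x] diff[of x x] that by simp
  have add: "x + y \<in> G" if "x \<in> G" "y \<in> G" for x y using diff[of x "- y"] minus that by simp
  have nat: "of_nat n * h \<in> G" for n
    using diff[of h h] h by (induction n) (auto simp: distrib_right intro!: add)
  have int: "of_int k * h \<in> G" for k
    using nat[of "nat k"] nat[of "nat (- k)"] minus[of "of_nat (nat (- k)) * h"]
    by (cases "k \<ge> 0") auto
  have "g \<in> (\<lambda>x. h * x) ` \<int>" if "g \<in> G" for g
  proof -
    define q where "q = of_int \<lfloor>g / h\<rfloor> * h"
    have q: "q \<le> g" "g < q + h"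
    proof -
      have "of_int \<lfloor>g / h\<rfloor> * h \<le> g / h * h" using h by (intro mult_right_mono) auto
      moreover have "g / h * h < (of_int \<lfloor>g / h\<rfloor> + 1) * h"
        using h by (intro mult_strict_right_mono) linarith+
      ultimately show "q \<le> g" "g < q + h" using h by (simp_all add: q_def distrib_right)
    qed
    have "g - q \<in> G" unfolding q_def using that int by (intro diff) auto
    moreover have "h \<le> x" if "x \<in> G" "0 < x" "x \<le> a" for x
      unfolding h_def using that by (intro Min_le fin') auto
    ultimately have "g = q" using q h by force
    then show ?thesis by (auto simp: q_def image_iff mult.commute intro!: bexI[of _ "of_int \<lfloor>g / h\<rfloor>"])
  qed
  then show ?thesis using that h by blast
qed

section \<open>Renewal equation for atoms and their decay at infinity\<close>

context dislocation begin

lemma offspring_suminf: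
  assumes [measurable]: "\<And>k. f k \<in> borel_measurable borel"
  shows "offspring (\<lambda>x. \<Sum>k. f k x) z = (\<Sum>k. offspring (f k) z)"
proof -
  have m: "(\<lambda>d. f k (z * d $ i)) \<in> borel_measurable \<nu>" for k i
    by (rule measurable_compose[of "\<lambda>d. z * d $ i" _ borel, OF _ assms]) measurable
  have "offspring (\<lambda>x. \<Sum>k. f k x) z = (\<integral>\<^sup>+d. (\<Sum>k. \<Sum>i\<in>UNIV. f k (z * d $ i)) \<partial>\<nu>)"
    unfolding offspring_def by (intro nn_integral_cong suminf_sum[symmetric] summableI)
  also have "\<dots> = (\<Sum>k. offspring (f k) z)"
    unfolding offspring_def by (intro nn_integral_suminf borel_measurable_sum m)
  finally show ?thesis .
qed

text \<open>The expected number of vertices whose mass is exactly 1, when the root has mass \<open>z\<close>.\<close>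

definition atom_mean :: "real \<Rightarrow> real" where
  "atom_mean z = enn2real (\<Sum>k. (offspring ^^ k) (indicator {1}) z)"

lemma atom_mean_nonneg: "0 \<le> atom_mean z"
  by (simp add: atom_mean_def)

lemma suminf_le_progeny:
  assumes "\<And>L. progeny L f z \<le> c"
  shows "(\<Sum>k. (offspring ^^ k) f z) \<le> c"
  using assms unfolding suminf_eq_SUP progeny_def by (intro SUP_least) auto

text \<open>By scaling, \<open>atom_mean (z * r)\<close> counts vertices of mass exactly
  \<open>1 / r\<close> below a root of mass \<open>z\<close>. Distinct \<open>r\<close> count
  distinct vertices, all of mass at least \<open>1 / c\<close>, so that
  \<open>progeny_count_le\<close> applies. The other two conclusions show that the
  \<open>enn2real\<close> in \<open>atom_mean\<close> loses nothing.\<close>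

lemma sum_atom_mean_le:
  obtains B where "B > 0"
    "\<And>F a c z. finite F \<Longrightarrow> F \<subseteq> {a..c} \<Longrightarrow> 0 < a \<Longrightarrow> 0 < c \<Longrightarrow> 0 < z \<Longrightarrow> (\<Sum>r\<in>F. atom_mean (z * r)) \<le> B * z * c"
    "\<And>z. 0 \<le> z \<Longrightarrow> (\<Sum>k. (offspring ^^ k) (indicator {1}) z) = ennreal (atom_mean z)"
    "\<And>z. 0 \<le> z \<Longrightarrow> atom_mean z \<le> B * z"
proof -
  from progeny_count_le obtain B where B: "B > 0"
    "\<And>L y z. y > 0 \<Longrightarrow> z \<ge> 0 \<Longrightarrow> progeny L (indicator {y..}) z \<le> ennreal (B * z / y)" by blast
  have le: "(\<Sum>k. (offspring ^^ k) (indicator {1}) z) \<le> ennreal (B * z)" if z: "0 \<le> z" for z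
  proof (rule suminf_le_progeny)
    fix L
    have "progeny L (indicator {1}) z \<le> progeny L (indicator {1..}) z"
      unfolding progeny_def
      by (intro sum_mono offspring_funpow_mono z) (auto split: split_indicator)
    also have "\<dots> \<le> ennreal (B * z)" using B(2)[of 1 z L] z by simp
    finally show "progeny L (indicator {1}) z \<le> ennreal (B * z)" .
  qed
  have eq: "(\<Sum>k. (offspring ^^ k) (indicator {1}) z) = ennreal (atom_mean z)" if z: "0 \<le> z" for z
    using le[OF z] unfolding atom_mean_def
    by (intro ennreal_enn2real[symmetric]) (auto simp: less_top[symmetric] top_unique)
  show ?thesis
  proof (rule that[OF B(1) _ eq])
    show "atom_mean z \<le> B * z" if z: "0 \<le> z" for z
      using le[OF z] B z unfolding eq[OF z] by simp
    fix F :: "real set" and a c z :: real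
    assume F: "finite F" "F \<subseteq> {a..c}" and az: "0 < a" "0 < c" "0 < z"
    show "(\<Sum>r\<in>F. atom_mean (z * r)) \<le> B * z * c"
    proof (cases "F = {}")
      case False
      have c: "c > 0" by fact
      have pos: "0 < r" "r \<le> c" if "r \<in> F" for r using F az that by force+
      have scale: "(offspring ^^ k) (indicator {1}) (z * r) = (offspring ^^ k) (indicator {1 / r}) z"
        if r: "r \<in> F" for k r
      proof -
        have "(indicator {1 / r} :: real \<Rightarrow> ennreal) = (\<lambda>x. indicator {1} (r * x))"
          using pos[OF r] by (auto simp: fun_eq_iff field_simps split: split_indicator)
        then show ?thesis by (simp only: offspring_funpow_scale mult.commute[of z])
      qed
      have disj: "(\<Sum>r\<in>F. indicator {1 / r} x) \<le> (indicator {1 / c..} x :: ennreal)" for x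
      proof (cases "\<exists>r\<in>F. x = 1 / r")
        case True
        then obtain r where r: "r \<in> F" "x = 1 / r" by auto
        have "(\<Sum>r'\<in>F. indicator {1 / r'} x :: ennreal) = (\<Sum>r'\<in>F. if r' = r then 1 else 0)"
          using r pos by (intro sum.cong refl) (force split: split_indicator)
        also have "\<dots> = 1" using r F by simp
        finally show ?thesis using r pos[OF r(1)] by (simp add: frac_le)
      next
        case False
        then have "(\<Sum>r\<in>F. indicator {1 / r} x :: ennreal) = 0" by (intro sum.neutral) auto
        then show ?thesis by simp
      qed
      have pow: "(\<Sum>r\<in>F. (offspring ^^ k) (f r) y) = (offspring ^^ k) (\<lambda>x. \<Sum>r\<in>F. f r x) y"
        if f: "\<And>r. r \<in> F \<Longrightarrow> f r \<in> borel_measurable borel" for k y and f :: "real \<Rightarrow> real \<Rightarrow> ennreal"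
        using f
      proof (induction k arbitrary: f)
        case (Suc k)
        have "(\<Sum>r\<in>F. (offspring ^^ k) (offspring (f r)) y) = (offspring ^^ k) (\<lambda>x. \<Sum>r\<in>F. offspring (f r) x) y"
          using Suc.prems by (intro Suc.IH) measurable
        also have "(\<lambda>x. \<Sum>r\<in>F. offspring (f r) x) = offspring (\<lambda>x. \<Sum>r\<in>F. f r x)"
          using Suc.prems by (intro ext offspring_sum[symmetric])
        finally show ?case by (simp add: funpow_swap1)
      qed simp
      have "ennreal (\<Sum>r\<in>F. atom_mean (z * r)) = (\<Sum>r\<in>F. \<Sum>k. (offspring ^^ k) (indicator {1}) (z * r))"
        using az pos by (subst sum_ennreal[symmetric]) (auto simp: eq less_imp_le atom_mean_nonneg)
      also have "\<dots> = (\<Sum>k. \<Sum>r\<in>F. (offspring ^^ k) (indicator {1 / r}) z)"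
        using scale by (subst suminf_sum[symmetric]) (auto intro!: suminf_cong)
      also have "\<dots> = (\<Sum>k. (offspring ^^ k) (\<lambda>x. \<Sum>r\<in>F. indicator {1 / r} x) z)"
        by (intro suminf_cong pow) measurable
      also have "\<dots> \<le> (\<Sum>k. (offspring ^^ k) (indicator {1 / c..}) z)"
        using az by (intro suminf_le offspring_funpow_mono disj summableI) auto
      also have "\<dots> \<le> ennreal (B * z * c)"
        using B(2)[of "1 / c" z] c az by (intro suminf_le_progeny) simp
      finally show ?thesis using B az c by simp
    qed (use B az in simp)
  qed
qed

text \<open>The atoms of \<mu> on the mass scale: the mass \<open>r\<close> stands for the age
  \<open>- ln r\<close>.\<close>

definition child_atoms :: "real set" where
  "child_atoms = {r. 0 < r \<and> child_mean (indicator {r}) > 0}"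

lemma countable_child_atoms: "countable child_atoms"
proof -
  have eq: "child_mean (indicator {r}) = (\<Sum>i\<in>UNIV. measure (distr \<nu> borel (\<lambda>d. d $ i)) {r})" for r
  proof -
    have "child_mean (indicator {r}) = (\<Sum>i\<in>UNIV. \<integral>d. indicator {r} (d $ i) \<partial>\<nu>)"
      unfolding child_mean_def
      by (intro Bochner_Integration.integral_sum integrable_const_bound[where B = 1])
        (auto split: split_indicator)
    also have "\<dots> = (\<Sum>i\<in>UNIV. measure (distr \<nu> borel (\<lambda>d. d $ i)) {r})"
    proof (rule sum.cong[OF refl])
      fix i
      have "(\<integral>d. indicator {r} (d $ i) \<partial>\<nu>) = (\<integral>d. indicator {d\<in>space \<nu>. d $ i = r} d \<partial>\<nu>)"
        by (intro Bochner_Integration.integral_cong refl) (auto split: split_indicator simp: space_eq_UNIV)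
      also have "\<dots> = measure \<nu> {d\<in>space \<nu>. d $ i = r}" by simp
      also have "\<dots> = measure (distr \<nu> borel (\<lambda>d. d $ i)) {r}"
        by (subst measure_distr) (auto intro!: arg_cong[where f = "measure \<nu>"] simp: space_eq_UNIV)
      finally show "(\<integral>d. indicator {r} (d $ i) \<partial>\<nu>) = measure (distr \<nu> borel (\<lambda>d. d $ i)) {r}" .
    qed
    finally show ?thesis .
  qed
  have "child_atoms \<subseteq> (\<Union>i. {r. measure (distr \<nu> borel (\<lambda>d. d $ i)) {r} \<noteq> 0})"
  proof
    fix r assume "r \<in> child_atoms"
    then have "(\<Sum>i\<in>UNIV. measure (distr \<nu> borel (\<lambda>d. d $ i)) {r}) \<noteq> 0"
      by (simp add: child_atoms_def eq)
    then show "r \<in> (\<Union>i. {r. measure (distr \<nu> borel (\<lambda>d. d $ i)) {r} \<noteq> 0})"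
      by (auto dest: sum.not_neutral_contains_not_neutral)
  qed
  moreover have "countable {r. measure (distr \<nu> borel (\<lambda>d. d $ i)) {r} \<noteq> 0}" for i
    by (intro finite_measure.countable_support prob_space.finite_measure prob_space_distr) measurable
  ultimately show ?thesis by (elim countable_subset) auto
qed

text \<open>A positive value that is no atom is taken with probability 0, and \<open>S\<close>
  contains only countably many such values.\<close>

lemma AE_countable_child_atoms:
  assumes "countable S"
  shows "AE d in \<nu>. \<forall>i. d $ i \<in> S \<longrightarrow> d $ i > 0 \<longrightarrow> d $ i \<in> child_atoms"
proof -
  have "AE d in \<nu>. \<forall>i. d $ i = r \<longrightarrow> d $ i > 0 \<longrightarrow> d $ i \<in> child_atoms" for r
  proof (cases "r \<in> child_atoms \<or> r \<le> 0")
    case False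
    have nn: "AE d in \<nu>. 0 \<le> (\<Sum>i\<in>UNIV. indicator {r} (d $ i) :: real)"
      by (intro AE_I2 sum_nonneg) auto
    have "child_mean (indicator {r}) \<ge> 0"
      unfolding child_mean_def by (rule integral_nonneg_AE[OF nn])
    then have "child_mean (indicator {r}) = 0" using False by (auto simp: child_atoms_def)
    then have "AE d in \<nu>. (\<Sum>i\<in>UNIV. indicator {r} (d $ i) :: real) = 0"
      unfolding child_mean_def
      by (subst (asm) integral_nonneg_eq_0_iff_AE[OF integrable_children[where B = 1] nn])
        (auto split: split_indicator)
    then show ?thesis
      by eventually_elim (auto simp: sum_nonneg_eq_0_iff split: split_indicator_asm)
  qed auto
  then have "AE d in \<nu>. \<forall>r\<in>S. \<forall>i. d $ i = r \<longrightarrow> d $ i > 0 \<longrightarrow> d $ i \<in> child_atoms"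
    using assms by (subst AE_ball_countable) auto
  then show ?thesis by eventually_elim auto
qed

lemma measurable_atom_mean [measurable]: "atom_mean \<in> borel_measurable borel"
  unfolding atom_mean_def by measurable

text \<open>Conditioning on the first split. For \<open>z = 1\<close> the root itself would
  contribute a further 1.\<close>

lemma atom_mean_renewal:
  assumes z: "z \<ge> 0" "z \<noteq> 1"
  shows "atom_mean z = child_mean (\<lambda>x. atom_mean (z * x))"
proof -
  obtain B where B: "B > 0"
    "\<And>z. 0 \<le> z \<Longrightarrow> (\<Sum>k. (offspring ^^ k) (indicator {1}) z) = ennreal (atom_mean z)"
    "\<And>z. 0 \<le> z \<Longrightarrow> atom_mean z \<le> B * z"
    using sum_atom_mean_le by metis
  have "ennreal (atom_mean z) = (\<Sum>k. (offspring ^^ k) (indicator {1}) z)"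
    using B z by simp
  also have "\<dots> = (\<Sum>k. (offspring ^^ (k + 1)) (indicator {1}) z) + (\<Sum>k<1. (offspring ^^ k) (indicator {1}) z)"
    by (rule suminf_offset) (rule summableI)
  also have "\<dots> = offspring (\<lambda>x. \<Sum>k. (offspring ^^ k) (indicator {1}) x) z"
    using z by (subst offspring_suminf) (auto split: split_indicator)
  also have "\<dots> = offspring (\<lambda>x. ennreal (atom_mean x)) z"
    using B z by (intro offspring_cong) auto
  also have "\<dots> = ennreal (child_mean (\<lambda>x. atom_mean (z * x)))"
  proof (rule offspring_ennreal[where B = "B * z"])
    fix x assume "0 \<le> x" "x \<le> z"
    then show "0 \<le> atom_mean x \<and> atom_mean x \<le> B * z"
      using B(3)[of x] B(1) by (auto simp: atom_mean_nonneg intro: order_trans[OF _ mult_left_mono])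
  qed (use z in auto)
  finally show ?thesis
    by (subst (asm) ennreal_inj)
      (auto simp: atom_mean_nonneg child_mean_def intro!: integral_nonneg_AE AE_I2 sum_nonneg)
qed

text \<open>Induction over generations: mass 1 can be hit after \<open>k + 1\<close> steps only if
  some child atom carries \<open>z\<close> into the countable set belonging to \<open>k\<close>
  steps. With \<open>AE_countable_child_atoms\<close> this shows that children outside
  \<open>child_atoms\<close> contribute nothing to the renewal equation.\<close>

lemma atom_mean_support:
  obtains S where "countable S" "\<And>z. z \<ge> 0 \<Longrightarrow> atom_mean z \<noteq> 0 \<Longrightarrow> z \<in> S"
proof -
  obtain B where B: "B > 0"
    "\<And>z. 0 \<le> z \<Longrightarrow> (\<Sum>k. (offspring ^^ k) (indicator {1}) z) = ennreal (atom_mean z)"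
    "\<And>z. 0 \<le> z \<Longrightarrow> atom_mean z \<le> B * z"
    using sum_atom_mean_le by metis
  have "\<exists>S. countable S \<and> (\<forall>z\<ge>0. (offspring ^^ k) (indicator {1}) z \<noteq> 0 \<longrightarrow> z \<in> S)" for k
  proof (induction k)
    case 0
    show ?case by (intro exI[of _ "{1}"]) (auto split: split_indicator)
  next
    case (Suc k)
    then obtain S where S: "countable S" "\<And>z. z \<ge> 0 \<Longrightarrow> (offspring ^^ k) (indicator {1}) z \<noteq> 0 \<Longrightarrow> z \<in> S"
      by blast
    \<comment> \<open>The quotients are the masses that an atom can carry into \<open>S\<close>;
      with 0 added, any \<open>z\<close> outside \<open>T\<close> is positive and can be divided
      by.\<close>
    define T where "T = insert 0 ((\<lambda>(s, r). s / r) ` (S \<times> child_atoms))"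
    have "countable T" unfolding T_def using S countable_child_atoms by auto
    moreover have "z \<in> T" if z: "z \<ge> 0" "(offspring ^^ Suc k) (indicator {1}) z \<noteq> 0" for z
    proof (rule ccontr)
      assume notT: "z \<notin> T"
      then have "z > 0" using z by (auto simp: T_def less_le)
      have zero: "(offspring ^^ k) (indicator {1}) 0 = 0"
      proof -
        have "(\<Sum>k. (offspring ^^ k) (indicator {1}) 0) = (0 :: ennreal)"
          using B(2)[of 0] B(3)[of 0] atom_mean_nonneg[of 0] by simp
        then show ?thesis by (subst (asm) suminf_eq_zero_iff) auto
      qed
      have "countable ((\<lambda>s. s / z) ` S)" using S by auto
      from AE_countable_child_atoms[OF this]
      have "AE d in \<nu>. (\<Sum>i\<in>UNIV. (offspring ^^ k) (indicator {1}) (z * d $ i)) = 0"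
        using AE_range
      proof eventually_elim
        case (elim d)
        have "(offspring ^^ k) (indicator {1}) (z * d $ i) = 0" for i
        proof (rule ccontr)
          assume ne: "(offspring ^^ k) (indicator {1}) (z * d $ i) \<noteq> 0"
          then have "d $ i \<noteq> 0" using zero by auto
          then have pos: "d $ i > 0" using elim(2) by (simp add: less_le)
          then have zS: "z * d $ i \<in> S" using ne \<open>z > 0\<close> by (intro S) auto
          then have "d $ i \<in> (\<lambda>s. s / z) ` S" using \<open>z > 0\<close> by (auto intro!: image_eqI[of _ _ "z * d $ i"])
          then have "d $ i \<in> child_atoms" using elim(1) pos by auto
          then have "z \<in> T" using zS pos unfolding T_def
            by (intro insertI2 image_eqI[of _ _ "(z * d $ i, d $ i)"]) auto
          then show False using notT by contradiction
        qed
        then show ?case by simp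
      qed
      then have "(offspring ^^ Suc k) (indicator {1}) z = 0"
        by (simp add: offspring_def nn_integral_0_iff_AE cong: nn_integral_cong_AE)
      then show False using z by simp
    qed
    ultimately show ?case by blast
  qed
  then obtain S where S: "\<And>k. countable (S k)"
    "\<And>k z. z \<ge> 0 \<Longrightarrow> (offspring ^^ k) (indicator {1}) z \<noteq> 0 \<Longrightarrow> z \<in> S k"
    by metis
  show ?thesis
  proof (rule that[of "\<Union>k. S k"])
    fix z :: real assume z: "z \<ge> 0" "atom_mean z \<noteq> 0"
    then have "(\<Sum>k. (offspring ^^ k) (indicator {1}) z) \<noteq> 0"
      using B(2)[OF z(1)] atom_mean_nonneg[of z] by simp
    then obtain k where "(offspring ^^ k) (indicator {1}) z \<noteq> 0" by fastforce
    then show "z \<in> (\<Union>k. S k)" using S z by auto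
  qed (use S in auto)
qed

text \<open>
  Along a sequence on which \<open>atom_mean z / z\<close> approaches its upper limit \<open>A\<close>, the
  renewal equation forces the contribution of any set of children to be asymptotically
  \<open>A\<close> times its mass: the complementary set cannot contribute more than its share.
\<close>

lemma atom_mean_extremal_share:
  fixes zs :: "nat \<Rightarrow> real"
  assumes zs: "filterlim zs at_top sequentially"
    and lim: "(\<lambda>n. atom_mean (zs n) / zs n) \<longlonglongrightarrow> A"
    and upper: "\<And>e. e > 0 \<Longrightarrow> \<exists>L>0. \<forall>z\<ge>L. atom_mean z \<le> (A + e) * z"
    and R [measurable]: "R \<in> sets borel" and \<epsilon>: "\<epsilon> > 0"
  shows "\<forall>\<^sub>F n in sequentially. (A * child_mean (\<lambda>x. x * indicator R x) - \<epsilon>) * zs n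
      \<le> child_mean (\<lambda>x. indicator R x * atom_mean (zs n * x))"
proof -
  define w where "w = child_mean (\<lambda>x. x * indicator R x)"
  obtain B where B: "B > 0" "\<And>z. 0 \<le> z \<Longrightarrow> atom_mean z \<le> B * z"
    using sum_atom_mean_le by metis
  \<comment> \<open>Three errors of size \<open>e * z\<close> arise: in the lower bound for
    \<open>atom_mean z\<close>, in the upper bound for the complementary children, and from children
    that are too small for the upper bound.\<close>
  define e where "e = \<epsilon> / 3"
  have e: "e > 0" using \<epsilon> by (simp add: e_def)
  from upper[OF e] obtain L where L: "L > 0" "\<And>z. z \<ge> L \<Longrightarrow> atom_mean z \<le> (A + e) * z" by blast
  have w: "0 \<le> w" unfolding w_def child_mean_def
  proof (rule integral_nonneg_AE)
    show "AE d in \<nu>. 0 \<le> (\<Sum>i\<in>UNIV. d $ i * indicator R (d $ i))"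
      using AE_range by eventually_elim (auto intro!: sum_nonneg mult_nonneg_nonneg)
  qed
  have share: "(A * w - \<epsilon>) * z \<le> child_mean (\<lambda>x. indicator R x * atom_mean (z * x))"
    if z: "z > 1" "z \<ge> CARD('b) * (B * L) / e" "atom_mean z / z > A - e" for z
  proof -
    have J: "0 \<le> atom_mean (z * x)" "atom_mean (z * x) \<le> B * z" if "0 \<le> x" "x < 1" for x
    proof -
      have "atom_mean (z * x) \<le> B * (z * x)" using that z by (intro B) auto
      also have "\<dots> \<le> B * z" using that z B by (intro mult_left_mono mult_left_le) auto
      finally show "atom_mean (z * x) \<le> B * z" .
    qed (rule atom_mean_nonneg)
    have bnd: "\<bar>indicator T x * atom_mean (z * x)\<bar> \<le> B * z" if "0 \<le> x" "x < 1" for T x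
      using J[OF that] z B by (auto split: split_indicator)
    \<comment> \<open>If \<open>z * x\<close> is below \<open>L\<close>, only the crude linear bound
      is available; it gives the constant \<open>B * L\<close>, which is negligible compared with
      \<open>z\<close>.\<close>
    have pt: "indicator (- R) x * atom_mean (z * x) \<le> (A + e) * z * (x * indicator (- R) x) + B * L"
      if x: "0 \<le> x" "x < 1" for x
    proof (cases "x \<in> R")
      case False
      show ?thesis
      proof (cases "z * x \<ge> L")
        case True
        then show ?thesis using L(2)[OF True] B L False by (auto simp: mult.assoc intro: add_increasing2)
      next
        case F: False
        have "L > 0" by fact
        have "0 \<le> z * x" using x z by simp
        have "A + e \<ge> 0"
        proof -
          have "0 \<le> (A + e) * L" using L(2)[of L] atom_mean_nonneg[of L] by simp
          then show ?thesis using L(1) by (simp add: zero_le_mult_iff)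
        qed
        then have "0 \<le> (A + e) * z * x" using x z by simp
        moreover have "atom_mean (z * x) \<le> B * L"
        proof -
          have "atom_mean (z * x) \<le> B * (z * x)" using \<open>0 \<le> z * x\<close> by (rule B)
          also have "\<dots> \<le> B * L" using F B by (intro mult_left_mono) auto
          finally show ?thesis .
        qed
        ultimately show ?thesis using False by simp
      qed
    qed (use B L in auto)
    have x1: "\<bar>(A + e) * z * (x * indicator (- R) x)\<bar> \<le> \<bar>(A + e) * z\<bar>" if "0 \<le> x" "x < 1" for x
      using that by (auto simp: abs_mult mult_left_le split: split_indicator)
    have x2: "\<bar>x * indicator T x\<bar> \<le> 1" if "0 \<le> x" "x < 1" for x :: real and T
      using that by (auto split: split_indicator)
    have "child_mean (\<lambda>x. indicator (- R) x * atom_mean (z * x))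
        \<le> child_mean (\<lambda>x. (A + e) * z * (x * indicator (- R) x) + B * L)"
    proof (rule child_mean_mono[where B = "B * z" and C = "\<bar>(A + e) * z\<bar> + B * L"])
      show "\<bar>(A + e) * z * (x * indicator (- R) x) + B * L\<bar> \<le> \<bar>(A + e) * z\<bar> + B * L"
        if "0 \<le> x" "x < 1" for x
        using x1[OF that] B L by (intro order_trans[OF abs_triangle_ineq]) auto
    qed (use bnd pt in auto)
    also have "\<dots> = (A + e) * z * child_mean (\<lambda>x. x * indicator (- R) x) + CARD('b) * (B * L)"
      by (subst child_mean_add[where B = "\<bar>(A + e) * z\<bar>" and C = "B * L"])
        (use x1 B L in \<open>auto simp: child_mean_cmult\<close>, simp add: child_mean_def prob_space)
    also have "child_mean (\<lambda>x. x * indicator (- R) x) = child_mean (\<lambda>x. x - x * indicator R x)"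
      by (rule child_mean_cong) (auto split: split_indicator)
    also have "\<dots> = 1 - w"
      unfolding w_def child_mean_id[symmetric]
      by (rule child_mean_diff[where B = 1 and C = 1]) (use x2 in auto)
    finally have 1: "child_mean (\<lambda>x. indicator (- R) x * atom_mean (z * x))
        \<le> (A + e) * z * (1 - w) + CARD('b) * (B * L)" .
    have "CARD('b) * (B * L) \<le> e * z" using z e by (simp add: field_simps)
    moreover have "(A - e) * z \<le> atom_mean z" using z by (simp add: field_simps)
    moreover have "atom_mean z = child_mean (\<lambda>x. indicator R x * atom_mean (z * x) + indicator (- R) x * atom_mean (z * x))"
      using z by (subst atom_mean_renewal) (auto intro!: child_mean_cong split: split_indicator)
    moreover have "\<dots> = child_mean (\<lambda>x. indicator R x * atom_mean (z * x))
        + child_mean (\<lambda>x. indicator (- R) x * atom_mean (z * x))"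
      by (rule child_mean_add) (use bnd in auto)
    ultimately have "(A - e) * z - (A + e) * z * (1 - w) - e * z
        \<le> child_mean (\<lambda>x. indicator R x * atom_mean (z * x))" using 1 by linarith
    moreover have "(A * w - \<epsilon>) * z = (A - e) * z - (A + e) * z * (1 - w) - e * z - e * z * w"
    proof -
      have "\<epsilon> = 3 * e" by (simp add: e_def)
      then show ?thesis by (simp add: algebra_simps)
    qed
    moreover have "0 \<le> e * z * w" using e z w by simp
    ultimately show ?thesis by linarith
  qed
  have "\<forall>\<^sub>F n in sequentially. zs n > 1" using zs by (simp add: filterlim_at_top_dense)
  moreover have "\<forall>\<^sub>F n in sequentially. zs n \<ge> CARD('b) * (B * L) / e" using zs by (simp add: filterlim_at_top)
  moreover have "\<forall>\<^sub>F n in sequentially. atom_mean (zs n) / zs n > A - e"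
    using lim e by (intro order_tendstoD) auto
  ultimately show ?thesis by eventually_elim (use share in \<open>simp add: w_def\<close>)
qed

text \<open>Suppose that the upper limit \<open>A\<close> of \<open>atom_mean z / z\<close> is
  positive, and let \<open>zs\<close> realise it. By the extremal share property, children that are
  not atoms would waste their share, so almost all positive child masses are atoms; moreover the
  limit \<open>A\<close> persists when \<open>zs\<close> is shifted by the age of an atom. These
  shifts generate a group that meets each bounded window in finitely many points, hence is contained
  in a lattice that contains the ages.\<close>

lemma atom_mean_sublinear:
  assumes nonlattice: "\<And>h. h > 0 \<Longrightarrow> \<not> (AE d in \<nu>. \<forall>i. d $ i > 0 \<longrightarrow> - ln (d $ i) \<in> (\<lambda>x. h * x) ` \<int>)"
    and \<epsilon>: "\<epsilon> > 0"
  shows "\<exists>L>0. \<forall>z\<ge>L. atom_mean z \<le> \<epsilon> * z"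
proof (rule ccontr)
  obtain B where B: "B > 0" 
    "\<And>F a c z. finite F \<Longrightarrow> F \<subseteq> {a..c} \<Longrightarrow> 0 < a \<Longrightarrow> 0 < c \<Longrightarrow> 0 < z \<Longrightarrow> (\<Sum>r\<in>F. atom_mean (z * r)) \<le> B * z * c"
    "\<And>z. 0 \<le> z \<Longrightarrow> atom_mean z \<le> B * z"
    using sum_atom_mean_le by metis
  \<comment> \<open>\<open>up a\<close> says that \<open>a\<close> is an eventual upper slope; the
    infimum of such slopes is the upper limit of \<open>atom_mean z / z\<close>.\<close>
  define up where "up a \<longleftrightarrow> (\<exists>L>0. \<forall>z\<ge>L. atom_mean z \<le> a * z)" for a
  assume "\<not> ?thesis"
  then have not_up: "\<not> up \<epsilon>" by (simp add: up_def)
  have up_mono: "up a'" if "up a" "a \<le> a'" for a a'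
  proof -
    from that obtain L where L: "L > 0" "\<And>z. z \<ge> L \<Longrightarrow> atom_mean z \<le> a * z" by (auto simp: up_def)
    have "atom_mean z \<le> a' * z" if "z \<ge> L" for z
      using L(2)[OF that] that L(1) \<open>a \<le> a'\<close> by (intro order_trans[OF _ mult_right_mono[of a a' z]]) auto
    then show ?thesis using L by (auto simp: up_def)
  qed
  have "up B" unfolding up_def using B(3) by (intro exI[of _ 1]) auto
  have up_lower: "\<epsilon> \<le> a" if "up a" for a
    using up_mono[OF that, of \<epsilon>] not_up by linarith
  then have bdd: "bdd_below {a. up a}" by (intro bdd_belowI[of _ \<epsilon>]) auto
  define A where "A = Inf {a. up a}"
  have A: "A \<ge> \<epsilon>" unfolding A_def using \<open>up B\<close> up_lower by (intro cInf_greatest) auto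
  have upper: "\<exists>L>0. \<forall>z\<ge>L. atom_mean z \<le> (A + e) * z" if "e > 0" for e
  proof -
    have "Inf {a. up a} < A + e" using that by (simp add: A_def)
    then obtain a where "up a" "a < A + e" using cInf_lessD[of "{a. up a}" "A + e"] \<open>up B\<close> by auto
    then have "up (A + e)" using up_mono by force
    then show ?thesis by (simp add: up_def)
  qed
  have "\<exists>z\<ge>real (Suc n). atom_mean z > (A - 1 / Suc n) * z" for n
  proof -
    have "\<not> up (A - 1 / Suc n)" using cInf_lower[OF _ bdd, of "A - 1 / Suc n"] by (auto simp: A_def[symmetric])
    then have "\<forall>L>0. \<exists>z\<ge>L. \<not> atom_mean z \<le> (A - 1 / Suc n) * z" unfolding up_def by blast
    from this[rule_format, of "Suc n"] show ?thesis by (simp add: not_le)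
  qed
  then obtain zs where zs: "\<And>n. zs n \<ge> real (Suc n)" "\<And>n. atom_mean (zs n) > (A - 1 / Suc n) * zs n"
    by metis
  have zs_pos: "zs n > 0" for n using zs(1)[of n] by linarith
  have zs_top: "filterlim zs at_top sequentially"
    by (rule filterlim_at_top_mono[OF filterlim_real_sequentially]) (rule always_eventually, rule allI, rule order_trans[OF _ zs(1)], simp)
  have scaled_top: "filterlim (\<lambda>n. zs n * exp (- s)) at_top sequentially" for s
    by (rule filterlim_at_top_mult_tendsto_pos[OF tendsto_const _ zs_top, of "exp (- s)"]) simp
  \<comment> \<open>The sequence shifted by \<open>s\<close> on the time scale, where masses are
    multiplied by \<open>exp (- s)\<close>.\<close>
  define lim where "lim s \<longleftrightarrow> (\<lambda>n. atom_mean (zs n * exp (- s)) / (zs n * exp (- s))) \<longlonglongrightarrow> A" for s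
  \<comment> \<open>Only lower bounds need to be checked, as \<open>A\<close> is an upper limit
    along any sequence tending to infinity.\<close>
  have limI: "lim s"
    if low: "\<And>e. e > 0 \<Longrightarrow> \<forall>\<^sub>F n in sequentially. A - e \<le> atom_mean (zs n * exp (- s)) / (zs n * exp (- s))" for s
    unfolding lim_def
  proof (rule tendstoI)
    fix e :: real assume e: "e > 0"
    obtain L where L: "L > 0" "\<And>z. z \<ge> L \<Longrightarrow> atom_mean z \<le> (A + e / 2) * z" using upper[of "e / 2"] e by auto
    have "\<forall>\<^sub>F n in sequentially. zs n * exp (- s) \<ge> L" using scaled_top by (simp add: filterlim_at_top)
    moreover have "\<forall>\<^sub>F n in sequentially. A - e / 2 \<le> atom_mean (zs n * exp (- s)) / (zs n * exp (- s))"
      using e by (intro low) auto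
    ultimately show "\<forall>\<^sub>F n in sequentially. dist (atom_mean (zs n * exp (- s)) / (zs n * exp (- s))) A < e"
    proof eventually_elim
      case (elim n)
      have "zs n * exp (- s) > 0" using zs_pos by simp
      then have "atom_mean (zs n * exp (- s)) / (zs n * exp (- s)) \<le> A + e / 2"
        using L(2)[OF elim(1)] by (subst pos_divide_le_eq)
      then show ?case using elim(2) e by (auto simp: dist_real_def abs_if)
    qed
  qed
  have lim_0: "lim 0"
  proof (rule limI)
    fix e :: real assume e: "e > 0"
    have "\<forall>\<^sub>F n in sequentially. 1 / real (Suc n) < e"
      by (rule order_tendstoD(2)[OF LIMSEQ_Suc[OF lim_inverse_n'] e])
    then show "\<forall>\<^sub>F n in sequentially. A - e \<le> atom_mean (zs n * exp (- 0)) / (zs n * exp (- 0))"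
    proof eventually_elim
      case (elim n)
      have "(A - e) * zs n \<le> (A - 1 / Suc n) * zs n" using elim zs_pos[of n] by (intro mult_right_mono) auto
      also have "\<dots> \<le> atom_mean (zs n)" using zs(2)[of n] by simp
      finally show ?case using zs_pos[of n] by (simp add: pos_le_divide_eq)
    qed
  qed
  \<comment> \<open>The share of \<open>R = {r}\<close> is \<open>A\<close> times
    \<open>r * N\<close>, while its contribution is exactly \<open>N * atom_mean (z * r)\<close>.
    The tolerance is multiplied by \<open>r * N\<close>, so that \<open>e\<close> remains after
    division.\<close>
  have lim_step: "lim (s - ln r)" if s: "lim s" and r: "r \<in> child_atoms" for s r
  proof (rule limI)
    fix e :: real assume e: "e > 0"
    define N where "N = child_mean (indicator {r})"
    have N: "N > 0" "r > 0" using r by (auto simp: N_def child_atoms_def)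
    have w: "child_mean (\<lambda>x. x * indicator {r} x) = r * N"
      unfolding N_def child_mean_cmult[symmetric]
      by (intro arg_cong[where f = child_mean] ext) (auto split: split_indicator)
    have "\<forall>\<^sub>F n in sequentially. (A * child_mean (\<lambda>x. x * indicator {r} x) - e * (r * N)) * (zs n * exp (- s))
      \<le> child_mean (\<lambda>x. indicator {r} x * atom_mean (zs n * exp (- s) * x))"
      using s e N by (intro atom_mean_extremal_share scaled_top upper) (auto simp: lim_def)
    then show "\<forall>\<^sub>F n in sequentially. A - e \<le> atom_mean (zs n * exp (- (s - ln r))) / (zs n * exp (- (s - ln r)))"
    proof eventually_elim
      case (elim n)
      define z where "z = zs n * exp (- s)"
      have z: "z > 0" using zs_pos by (simp add: z_def)
      have zr: "zs n * exp (- (s - ln r)) = z * r" using N by (simp add: z_def exp_diff exp_minus field_simps)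
      have "child_mean (\<lambda>x. indicator {r} x * atom_mean (z * x)) = child_mean (\<lambda>x. atom_mean (z * r) * indicator {r} x)"
        by (intro arg_cong[where f = child_mean] ext) (auto split: split_indicator)
      also have "\<dots> = atom_mean (z * r) * N" by (simp add: child_mean_cmult N_def)
      finally have "(A * (r * N) - e * (r * N)) * z \<le> atom_mean (z * r) * N"
        using elim by (simp add: z_def[symmetric] w)
      then have "((A - e) * (z * r)) * N \<le> atom_mean (z * r) * N" by (simp add: algebra_simps)
      then have "(A - e) * (z * r) \<le> atom_mean (z * r)" using N by simp
      then show ?case unfolding zr using z N by (simp add: pos_le_divide_eq)
    qed
  qed
  define semi where "semi = {\<Sum>r\<leftarrow>rs. - ln r | rs. set rs \<subseteq> child_atoms}"
  have lim_semi: "lim s" if "s \<in> semi" for s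
  proof -
    have "lim (\<Sum>r\<leftarrow>rs. - ln r)" if "set rs \<subseteq> child_atoms" for rs
      using that
    proof (induction rs)
      case (Cons r rs)
      then show ?case using lim_step[of "\<Sum>r\<leftarrow>rs. - ln r" r] by (simp add: algebra_simps)
    qed (simp add: lim_0)
    then show ?thesis using that by (auto simp: semi_def)
  qed
  have semi_add: "s + t \<in> semi" if st: "s \<in> semi" "t \<in> semi" for s t
  proof -
    from st obtain rs rs' where "set rs \<subseteq> child_atoms" "s = (\<Sum>r\<leftarrow>rs. - ln r)"
      "set rs' \<subseteq> child_atoms" "t = (\<Sum>r\<leftarrow>rs'. - ln r)" by (auto simp: semi_def)
    then show ?thesis unfolding semi_def by (intro CollectI exI[of _ "rs @ rs'"]) auto
  qed
  have semi_0: "0 \<in> semi" unfolding semi_def by (intro CollectI exI[of _ "[]"]) auto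
  have semi_atom: "- ln r \<in> semi" if "r \<in> child_atoms" for r
    unfolding semi_def using that by (intro CollectI exI[of _ "[r]"]) auto
  have semi_sum: "(\<Sum>x\<in>F. t x) \<in> semi" if "finite F" "\<And>x. x \<in> F \<Longrightarrow> t x \<in> semi" for F and t :: "real \<Rightarrow> real"
    using that by (induction F rule: finite_induct) (auto simp: semi_0 semi_add)
  define G where "G = {s - t | s t. s \<in> semi \<and> t \<in> semi}"
  have G_diff: "x - y \<in> G" if xy: "x \<in> G" "y \<in> G" for x y
  proof -
    from xy obtain s t s' t' where *: "x = s - t" "y = s' - t'" "s \<in> semi" "t \<in> semi" "s' \<in> semi" "t' \<in> semi"
      by (auto simp: G_def)
    show ?thesis unfolding G_def
      by (intro CollectI exI[of _ "s + t'"] exI[of _ "t + s'"]) (use * semi_add in auto)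
  qed
  have atoms_lt_1: "r < 1" if "r \<in> child_atoms" for r
  proof (rule ccontr)
    assume "\<not> r < 1"
    then have "child_mean (indicator {r}) = child_mean (\<lambda>_. 0)"
      by (intro child_mean_cong) (auto split: split_indicator)
    then show False using that by (simp add: child_atoms_def child_mean_def)
  qed
  \<comment> \<open>A finite part \<open>F\<close> of the window satisfies
    \<open>card F * A \<le> B * exp a\<close>, which bounds its cardinality independently of
    \<open>F\<close>.\<close>
  have finG: "finite (G \<inter> {0..a})" for a
  proof -
    have "card F \<le> nat \<lfloor>B * exp a / A\<rfloor>" if F: "F \<subseteq> G \<inter> {0..a}" "finite F" for F
    proof -
      have "\<exists>t. t \<in> semi \<and> f + t \<in> semi" if "f \<in> G" for f
      proof -
        from that obtain s t where "f = s - t" "s \<in> semi" "t \<in> semi" by (auto simp: G_def)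
        then show ?thesis by (intro exI[of _ t]) simp
      qed
      then have "\<forall>f\<in>F. \<exists>t. t \<in> semi \<and> f + t \<in> semi" using F by blast
      then obtain t where t: "\<And>f. f \<in> F \<Longrightarrow> t f \<in> semi" "\<And>f. f \<in> F \<Longrightarrow> f + t f \<in> semi" by metis
      define T where "T = (\<Sum>f\<in>F. t f)"
      have fT: "lim (f + T)" if f: "f \<in> F" for f
      proof -
        have "T = t f + (\<Sum>f\<in>F - {f}. t f)" unfolding T_def using F f by (intro sum.remove) auto
        then have "f + T = (f + t f) + (\<Sum>f\<in>F - {f}. t f)" by simp
        also have "\<dots> \<in> semi" using F t(1) by (intro semi_add[OF t(2)[OF f]] semi_sum) auto
        finally show ?thesis by (rule lim_semi)
      qed
      have "(\<lambda>n. \<Sum>f\<in>F. atom_mean (zs n * exp (- (f + T))) / (zs n * exp (- (f + T)))) \<longlonglongrightarrow> (\<Sum>f\<in>F. A)"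
        using fT by (intro tendsto_sum) (auto simp: lim_def)
      \<comment> \<open>All shifts lie between \<open>T\<close> and \<open>a + T\<close>, so one
        denominator serves every term and the numerators are atoms in a single window; the shift
        \<open>T\<close> cancels.\<close>
      moreover have "(\<Sum>f\<in>F. atom_mean (zs n * exp (- (f + T))) / (zs n * exp (- (f + T)))) \<le> B * exp a" for n
      proof -
        have inj: "inj_on (\<lambda>f. exp (- (f + T))) F" by (auto simp: inj_on_def)
        have "(\<Sum>f\<in>F. atom_mean (zs n * exp (- (f + T))) / (zs n * exp (- (f + T))))
            \<le> (\<Sum>f\<in>F. atom_mean (zs n * exp (- (f + T))) / (zs n * exp (- (a + T))))"
          using F zs_pos by (intro sum_mono divide_left_mono mult_left_mono)
            (auto intro: atom_mean_nonneg less_imp_le)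
        also have "\<dots> = (\<Sum>r\<in>(\<lambda>f. exp (- (f + T))) ` F. atom_mean (zs n * r)) / (zs n * exp (- (a + T)))"
          by (subst sum.reindex[OF inj]) (simp only: o_def sum_divide_distrib)
        also have "\<dots> \<le> B * zs n * exp (- T) / (zs n * exp (- (a + T)))"
        proof (intro divide_right_mono)
          show "(\<Sum>r\<in>(\<lambda>f. exp (- (f + T))) ` F. atom_mean (zs n * r)) \<le> B * zs n * exp (- T)"
            by (rule B(2)[of _ "exp (- (a + T))"]) (use F zs_pos in auto)
        qed (use zs_pos[of n] in auto)
        also have "exp (- T) = exp (- (a + T)) * exp a" by (simp add: mult_exp_exp)
        also have "B * zs n * (exp (- (a + T)) * exp a) / (zs n * exp (- (a + T))) = B * exp a"
          using zs_pos[of n] by simp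
        finally show ?thesis .
      qed
      ultimately have "(\<Sum>f\<in>F. A) \<le> B * exp a" by (intro LIMSEQ_le_const2) auto
      then have "card F \<le> B * exp a / A" using A \<epsilon> by (simp add: field_simps)
      then show ?thesis by (simp add: le_nat_floor)
    qed
    then show ?thesis using finite_if_finite_subsets_card_bdd by blast
  qed
  have [measurable]: "child_atoms \<in> sets borel"
    by (rule sets.countable[OF _ countable_child_atoms]) simp
  \<comment> \<open>The set \<open>- child_atoms\<close> contributes 0 to \<open>atom_mean\<close>,
    but asymptotically it must contribute \<open>A * w\<close> times the mass of the root; hence its
    mean mass \<open>w\<close> vanishes.\<close>
  have "AE d in \<nu>. \<forall>i. d $ i > 0 \<longrightarrow> d $ i \<in> child_atoms"
  proof -
    obtain S where S: "countable S" "\<And>z. z \<ge> 0 \<Longrightarrow> atom_mean z \<noteq> 0 \<Longrightarrow> z \<in> S"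
      using atom_mean_support by metis
    have zero: "child_mean (\<lambda>x. indicator (- child_atoms) x * atom_mean (z * x)) = 0" if z: "z > 0" for z
    proof -
      have "countable ((\<lambda>s. s / z) ` S)" using S by auto
      from AE_countable_child_atoms[OF this]
      have "AE d in \<nu>. (\<Sum>i\<in>UNIV. indicator (- child_atoms) (d $ i) * atom_mean (z * d $ i)) = 0"
        using AE_range
      proof eventually_elim
        case (elim d)
        have "indicator (- child_atoms) (d $ i) * atom_mean (z * d $ i) = 0" for i
        proof (rule ccontr)
          assume ne: "\<not> ?thesis"
          have "atom_mean 0 = 0" using B(3)[of 0] atom_mean_nonneg[of 0] by simp
          then have "d $ i \<noteq> 0" using ne by auto
          then have pos: "d $ i > 0" using elim(2) by (simp add: less_le)
          have "z * d $ i \<in> S" using ne pos z by (intro S) auto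
          then have "d $ i \<in> (\<lambda>s. s / z) ` S" using z by (auto intro!: image_eqI[of _ _ "z * d $ i"])
          then show False using elim(1) pos ne by auto
        qed
        then show ?case by (intro sum.neutral) blast
      qed
      then show ?thesis unfolding child_mean_def by (rule integral_eq_zero_AE)
    qed
    define w where "w = child_mean (\<lambda>x. x * indicator (- child_atoms) x)"
    have "A * w \<le> 0"
    proof (rule field_le_epsilon)
      fix e :: real assume e: "e > 0"
      have "\<forall>\<^sub>F n in sequentially. (A * w - e) * zs n \<le> child_mean (\<lambda>x. indicator (- child_atoms) x * atom_mean (zs n * x))"
        unfolding w_def using lim_0 e by (intro atom_mean_extremal_share zs_top upper) (auto simp: lim_def)
      then have "\<forall>\<^sub>F n in sequentially. (A * w - e) * zs n \<le> 0" by (simp add: zero zs_pos)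
      then obtain n where "(A * w - e) * zs n \<le> 0" using eventually_happens'[OF sequentially_bot] by blast
      then show "A * w \<le> 0 + e" using zs_pos[of n] by (simp add: mult_le_0_iff)
    qed
    then have "w \<le> 0" using A \<epsilon> by (simp add: mult_le_0_iff)
    have nn: "AE d in \<nu>. 0 \<le> (\<Sum>i\<in>UNIV. d $ i * indicator (- child_atoms) (d $ i))"
      using AE_range by eventually_elim (auto intro!: sum_nonneg mult_nonneg_nonneg)
    have "w = 0" using \<open>w \<le> 0\<close> integral_nonneg_AE[OF nn] by (simp add: w_def child_mean_def)
    then have "AE d in \<nu>. (\<Sum>i\<in>UNIV. d $ i * indicator (- child_atoms) (d $ i)) = 0"
      unfolding w_def child_mean_def
      by (subst (asm) integral_nonneg_eq_0_iff_AE[OF integrable_children[where B = 1] nn])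
        (auto split: split_indicator)
    then show ?thesis using AE_range
      by eventually_elim (auto simp: sum_nonneg_eq_0_iff split: split_indicator_asm)
  qed
  note atomic = this
  \<comment> \<open>Otherwise all components would be 0, against their sum 1. An atom provides the
    positive group element needed for discreteness.\<close>
  have "child_atoms \<noteq> {}"
  proof
    assume "child_atoms = {}"
    have "AE d in \<nu>. d \<noteq> d"
      using atomic AE_range AE_sum
    proof eventually_elim
      case (elim d)
      have "d $ i = 0" for i
        using elim(1,2)[THEN spec, of i] \<open>child_atoms = {}\<close> by auto
      then show ?case using elim(3) by simp
    qed
    then show False by simp
  qed
  then obtain r where r: "r \<in> child_atoms" by auto
  have atom_G: "- ln r \<in> G" if "r \<in> child_atoms" for r
    unfolding G_def using semi_atom[OF that] semi_0 by (intro CollectI exI[of _ "- ln r"] exI[of _ 0]) auto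
  have "- ln r > 0" using atoms_lt_1[OF r] r by (simp add: child_atoms_def)
  from additive_subgroup_discrete[OF G_diff atom_G[OF r] this finG]
  obtain h where h: "h > 0" "G \<subseteq> (\<lambda>x. h * x) ` \<int>" by metis
  have "AE d in \<nu>. \<forall>i. d $ i > 0 \<longrightarrow> - ln (d $ i) \<in> (\<lambda>x. h * x) ` \<int>"
    using atomic by eventually_elim (use atom_G h in blast)
  then show False using nonlattice[OF h(1)] by contradiction
qed

end

section \<open>Pairs of vertices\<close>

text \<open>The edges shared by the paths from the root to \<open>u\<close> and to \<open>v\<close>,
  an edge being named by its lower end. Hence the root is left out, whereas a nonempty
  \<open>u\<close> that is an ancestor of \<open>v\<close> belongs to the set.\<close>

definition common_ancestors :: "'b list \<Rightarrow> 'b list \<Rightarrow> 'b list set" where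
  "common_ancestors u v = {s. s \<noteq> [] \<and> suffix s u \<and> suffix s v}"

text \<open>Pairs sorted by their last common ancestor \<open>w\<close>, which they leave through
  different children. The words below these children run over all of \<open>words L\<close>, which
  overcounts but decouples the sums.\<close>

abbreviation branching_pairs ::
    "nat \<Rightarrow> (real \<Rightarrow> real \<Rightarrow> ennreal) \<Rightarrow> ('b::finite list \<Rightarrow> real ^ 'b) \<Rightarrow> ennreal" where
  "branching_pairs L F d \<equiv> \<Sum>(w, i, j)\<in>words L \<times> UNIV \<times> UNIV. if i = j then 0 else
     of_nat (Suc (length w)) * (\<Sum>v\<in>words L. \<Sum>u\<in>words L. F (mass 1 d (v @ j # w)) (mass 1 d (u @ i # w)))"

text \<open>The weight is increased by 1 so that one estimate covers both the variance, weighted by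
  shared edges, and the ties, with weight 1.\<close>

abbreviation weighted_pairs ::
    "nat \<Rightarrow> (real \<Rightarrow> real \<Rightarrow> ennreal) \<Rightarrow> ('b::finite list \<Rightarrow> real ^ 'b) \<Rightarrow> ennreal" where
  "weighted_pairs L F d \<equiv> \<Sum>u\<in>words L. \<Sum>v\<in>words L.
     of_nat (Suc (card (common_ancestors u v))) * F (mass 1 d v) (mass 1 d u)"

abbreviation common_ancestor_pairs :: "nat \<Rightarrow> real \<Rightarrow> ('b::finite list \<Rightarrow> real ^ 'b) \<Rightarrow> ennreal" where
  "common_ancestor_pairs L y d \<equiv> \<Sum>u\<in>words L. \<Sum>v\<in>words L.
     of_nat (card (common_ancestors u v)) * (indicator {y..} (mass 1 d u) * indicator {y..} (mass 1 d v))"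

text \<open>Ordered pairs, the diagonal included: \<open>J\<close> vertices of a common mass
  contribute the square of \<open>J\<close>.\<close>

abbreviation tied_pairs :: "nat \<Rightarrow> real \<Rightarrow> ('b::finite list \<Rightarrow> real ^ 'b) \<Rightarrow> ennreal" where
  "tied_pairs L y d \<equiv> \<Sum>u\<in>words L. \<Sum>v\<in>words L.
     indicator {(a, x). a = x \<and> y \<le> a} (mass 1 d v, mass 1 d u)"

lemma finite_common_ancestors [simp]: "finite (common_ancestors u v)"
  by (rule finite_subset[of _ "set (suffixes u)"]) (auto simp: common_ancestors_def)

text \<open>Suffixes of the same word are determined by their lengths, and these are at least
  1.\<close>

lemma card_common_ancestors_le:
  assumes "\<And>s. s \<in> common_ancestors u v \<Longrightarrow> length s \<le> n"
  shows "card (common_ancestors u v) \<le> n"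
proof -
  have "inj_on length (common_ancestors u v)"
    by (rule inj_onI) (auto simp: common_ancestors_def suffix_def dest: append_eq_append_conv)
  then have "card (common_ancestors u v) \<le> card {1..n}"
    by (rule card_inj_on_le) (use assms in \<open>auto simp: common_ancestors_def Suc_le_eq\<close>)
  then show ?thesis by simp
qed

text \<open>A common suffix longer than \<open>w\<close> would end in both \<open>i # w\<close> and
  \<open>j # w\<close>.\<close>

lemma card_common_ancestors_branching:
  assumes "i \<noteq> j"
  shows "card (common_ancestors (u @ i # w) (v @ j # w)) \<le> length w"
proof (rule card_common_ancestors_le)
  fix s assume "s \<in> common_ancestors (u @ i # w) (v @ j # w)"
  then have s: "suffix s (u @ i # w)" "suffix s (v @ j # w)" by (auto simp: common_ancestors_def)
  show "length s \<le> length w"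
  proof (rule ccontr)
    assume "\<not> ?thesis"
    then have len: "length (i # w) \<le> length s" "length (j # w) \<le> length s" by auto
    have "suffix (i # w) (u @ i # w)" "suffix (j # w) (v @ j # w)" by (auto simp: suffix_def)
    then have "suffix (i # w) s" "suffix (j # w) s"
      using s len by (meson suffix_length_suffix)+
    then have "suffix (i # w) (j # w)" by (rule suffix_length_suffix) simp
    then show False using assms by (auto simp: suffix_def)
  qed
qed

lemma parallel_suffix_decomp:
  assumes "\<not> suffix u v" "\<not> suffix v u"
  obtains i j w u' v' where "i \<noteq> j" "u = u' @ i # w" "v = v' @ j # w"
proof -
  have "rev u \<parallel> rev v" using assms by (auto simp: suffix_to_prefix)
  then obtain as b bs c cs where "b \<noteq> c" "rev u = as @ b # bs" "rev v = as @ c # cs"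
    using parallel_decomp by metis
  then have "u = rev bs @ b # rev as" "v = rev cs @ c # rev as"
    by (metis append.assoc append_Cons append_Nil rev.simps(2) rev_append rev_rev_ident)+
  then show ?thesis using that \<open>b \<noteq> c\<close> by blast
qed

text \<open>Incomparable pairs are coded by the point where they branch and the two remaining words.
  Comparable pairs are listed by the descendant \<open>v\<close> and its suffixes \<open>u\<close>,
  in both orders, with weight at most \<open>Suc (length v)\<close>.\<close>

lemma sum_pairs_le:
  fixes F :: "'b::finite list \<Rightarrow> 'b list \<Rightarrow> ennreal"
  shows "(\<Sum>u\<in>words L. \<Sum>v\<in>words L. of_nat (Suc (card (common_ancestors u v))) * F u v)
    \<le> (\<Sum>(w, i, j)\<in>words L \<times> UNIV \<times> UNIV. if i = j then 0 else
          of_nat (Suc (length w)) * (\<Sum>v\<in>words L. \<Sum>u\<in>words L. F (u @ i # w) (v @ j # w)))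
      + (\<Sum>v\<in>words L. \<Sum>u\<in>set (suffixes v). of_nat (Suc (length v)) * (F u v + F v u))"
proof -
  define g where "g = (\<lambda>(u, v). of_nat (Suc (card (common_ancestors u v))) * F u v)"
  define W where "W = (words L :: 'b list set)"
  have fW [simp]: "finite W" by (simp add: W_def)
  define P where "P = {(u, v)\<in>W \<times> W. \<not> suffix u v \<and> \<not> suffix v u}"
  define P1 where "P1 = {(u, v)\<in>W \<times> W. suffix u v \<or> suffix v u}"
  have fin: "finite P" "finite P1" unfolding P_def P1_def by (auto intro: finite_subset[of _ "W \<times> W"])
  have "(\<Sum>u\<in>W. \<Sum>v\<in>W. of_nat (Suc (card (common_ancestors u v))) * F u v) = (\<Sum>p\<in>W \<times> W. g p)"
    unfolding g_def by (rule sum.cartesian_product)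
  also have "W \<times> W = P \<union> P1" by (auto simp: P_def P1_def)
  also have "(\<Sum>p\<in>P \<union> P1. g p) = (\<Sum>p\<in>P. g p) + (\<Sum>p\<in>P1. g p)"
    by (rule sum.union_disjoint[OF fin]) (auto simp: P_def P1_def)
  also have "(\<Sum>p\<in>P. g p) \<le> (\<Sum>(w, i, j)\<in>W \<times> UNIV \<times> UNIV. \<Sum>(v, u)\<in>W \<times> W. if i = j then 0 else
          of_nat (Suc (length w)) * F (u @ i # w) (v @ j # w))"
    unfolding sum.cartesian_product split_beta
  \<comment> \<open>Each pair needs only one code whose term dominates; the codes that leave
    \<open>words L\<close> merely enlarge the right-hand side.\<close>
  proof (rule sum_le_included[where i = "\<lambda>x. case x of ((w, i, j), v, u) \<Rightarrow> (u @ i # w, v @ j # w)"])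
    show "\<forall>p\<in>P. \<exists>x\<in>(W \<times> UNIV \<times> UNIV) \<times> W \<times> W. (case x of ((w, i, j), v, u) \<Rightarrow> (u @ i # w, v @ j # w)) = p
        \<and> g p \<le> (if fst (snd (fst x)) = snd (snd (fst x)) then 0 else of_nat (Suc (length (fst (fst x))))
            * F (snd (snd x) @ fst (snd (fst x)) # fst (fst x)) (fst (snd x) @ snd (snd (fst x)) # fst (fst x)))"
    proof
      fix p assume p: "p \<in> P"
      then obtain u v where uv: "p = (u, v)" "u \<in> W" "v \<in> W" "\<not> suffix u v" "\<not> suffix v u"
        by (auto simp: P_def)
      then obtain i j w u' v' where *: "i \<noteq> j" "u = u' @ i # w" "v = v' @ j # w"
        using parallel_suffix_decomp by metis
      have "card (common_ancestors u v) \<le> length w" using * card_common_ancestors_branching by metis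
      then have le: "g p \<le> of_nat (Suc (length w)) * F (u' @ i # w) (v' @ j # w)"
        unfolding g_def uv prod.case using *(2,3) by (intro mult_mono) (auto simp del: of_nat_Suc)
      have "w \<in> W" "u' \<in> W" "v' \<in> W" using uv *(2,3) by (auto simp: W_def words_def)
      then show "\<exists>x\<in>(W \<times> UNIV \<times> UNIV) \<times> W \<times> W. (case x of ((w, i, j), v, u) \<Rightarrow> (u @ i # w, v @ j # w)) = p
        \<and> g p \<le> (if fst (snd (fst x)) = snd (snd (fst x)) then 0 else of_nat (Suc (length (fst (fst x))))
            * F (snd (snd x) @ fst (snd (fst x)) # fst (fst x)) (fst (snd x) @ snd (snd (fst x)) # fst (fst x)))"
        using * uv le by (intro bexI[of _ "((w, i, j), v', u')"]) auto
    qed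
  qed (use fin in auto)
  also have "\<dots> = (\<Sum>(w, i, j)\<in>W \<times> UNIV \<times> UNIV. if i = j then 0 else
          of_nat (Suc (length w)) * (\<Sum>v\<in>W. \<Sum>u\<in>W. F (u @ i # w) (v @ j # w)))"
    unfolding sum_distrib_left sum.cartesian_product[symmetric] by (auto intro!: sum.cong)
  also have "(\<Sum>p\<in>P1. g p) \<le> (\<Sum>(v, u)\<in>Sigma W (\<lambda>v. set (suffixes v)). of_nat (Suc (length v)) * (F u v + F v u))"
  proof -
    have card_le: "card (common_ancestors u v) \<le> length v" "card (common_ancestors v u) \<le> length v" for u v :: "'b list"
      by (rule card_common_ancestors_le; auto simp: common_ancestors_def suffix_length_le)+
    have "(\<Sum>p\<in>P1. g p) \<le> (\<Sum>p\<in>(\<lambda>(v, u). (u, v)) ` Sigma W (\<lambda>v. set (suffixes v)) \<union> Sigma W (\<lambda>v. set (suffixes v)). g p)"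
      by (intro sum_mono2) (auto simp: P1_def)
    also have "\<dots> \<le> (\<Sum>p\<in>(\<lambda>(v, u). (u, v)) ` Sigma W (\<lambda>v. set (suffixes v)). g p) + (\<Sum>p\<in>Sigma W (\<lambda>v. set (suffixes v)). g p)"
      by (subst sum.union_inter[symmetric]) (auto intro: add_increasing2)
    also have "(\<Sum>p\<in>(\<lambda>(v, u). (u, v)) ` Sigma W (\<lambda>v. set (suffixes v)). g p) = (\<Sum>(v, u)\<in>Sigma W (\<lambda>v. set (suffixes v)). g (u, v))"
      by (subst sum.reindex) (auto simp: inj_on_def split_beta)
    also have "\<dots> + (\<Sum>p\<in>Sigma W (\<lambda>v. set (suffixes v)). g p) = (\<Sum>(v, u)\<in>Sigma W (\<lambda>v. set (suffixes v)). g (u, v) + g (v, u))"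
      by (simp add: sum.distrib split_beta)
    also have "\<dots> \<le> (\<Sum>(v, u)\<in>Sigma W (\<lambda>v. set (suffixes v)). of_nat (Suc (length v)) * (F u v + F v u))"
      unfolding g_def distrib_left using card_le
      by (intro sum_mono) (auto intro!: add_mono mult_mono simp del: of_nat_Suc)
    finally show ?thesis .
  qed
  also have "\<dots> = (\<Sum>v\<in>W. \<Sum>u\<in>set (suffixes v). of_nat (Suc (length v)) * (F u v + F v u))"
    by (subst sum.Sigma) auto
  finally show ?thesis unfolding W_def by (simp add: add_mono)
qed

section \<open>Expected numbers of pairs\<close>

context dislocation begin

lemma nn_integral_generation_moment:
  assumes "s > 0"
  shows "(\<integral>\<^sup>+d. (\<Sum>u\<in>generation k. ennreal (mass 1 d u powr s)) \<partial>splits) = ennreal (moment s ^ k)"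
  using assms by (subst nn_integral_generation_root) (auto simp: offspring_funpow_powr)

lemma nn_integral_words_moment:
  fixes c :: "nat \<Rightarrow> real"
  assumes "s > 0" "\<And>k. c k \<ge> 0"
  shows "(\<integral>\<^sup>+d. (\<Sum>u\<in>words L. ennreal (c (length u) * mass 1 d u powr s)) \<partial>splits)
    = ennreal (\<Sum>k<L. c k * moment s ^ k)"
proof -
  have "(\<integral>\<^sup>+d. (\<Sum>u\<in>words L. ennreal (c (length u) * mass 1 d u powr s)) \<partial>splits)
      = (\<Sum>k<L. \<integral>\<^sup>+d. (\<Sum>u\<in>generation k. ennreal (c (length u) * mass 1 d u powr s)) \<partial>splits)"
    unfolding sum_words by (rule nn_integral_sum) measurable
  also have "\<dots> = (\<Sum>k<L. ennreal (c k) * ennreal (moment s ^ k))"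
  proof (rule sum.cong[OF refl])
    fix k
    have "(\<integral>\<^sup>+d. (\<Sum>u\<in>generation k. ennreal (c (length u) * mass 1 d u powr s)) \<partial>splits)
        = (\<integral>\<^sup>+d. ennreal (c k) * (\<Sum>u\<in>generation k. ennreal (mass 1 d u powr s)) \<partial>splits)"
      unfolding sum_distrib_left
      by (intro nn_integral_cong sum.cong refl) (auto simp: generation_def ennreal_mult'' assms)
    also have "\<dots> = ennreal (c k) * (\<integral>\<^sup>+d. (\<Sum>u\<in>generation k. ennreal (mass 1 d u powr s)) \<partial>splits)"
      by (rule nn_integral_cmult) measurable
    finally show "(\<integral>\<^sup>+d. (\<Sum>u\<in>generation k. ennreal (c (length u) * mass 1 d u powr s)) \<partial>splits)
        = ennreal (c k) * ennreal (moment s ^ k)"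
      unfolding nn_integral_generation_moment[OF assms(1)] .
  qed
  also have "\<dots> = ennreal (\<Sum>k<L. c k * moment s ^ k)"
    using assms by (simp add: ennreal_mult[symmetric] moment_nonneg)
  finally show ?thesis .
qed

text \<open>Polynomial weights are harmless as \<open>moment s\<close> is below 1. The square is
  needed for comparable pairs: one factor is the weight, the other counts the suffixes.\<close>

lemma sum_moment_bounded:
  assumes "s > 1"
  obtains S where "\<And>L. (\<Sum>k<L. real (Suc k) ^ 2 * moment s ^ k) \<le> S" "S \<ge> 0"
proof -
  define q where "q = moment s"
  have q: "0 \<le> q" "q < 1" using moment_nonneg moment_less_one[OF assms] by (auto simp: q_def)
  have "(\<lambda>n. (1 + 1 / real (Suc n)) ^ 2 * q) \<longlonglongrightarrow> (1 + 0) ^ 2 * q"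
    by (intro tendsto_intros LIMSEQ_Suc[OF lim_inverse_n'])
  then have "\<forall>\<^sub>F n in sequentially. (1 + 1 / real (Suc n)) ^ 2 * q < (1 + q) / 2"
    using q by (intro order_tendstoD) auto
  then obtain N where N: "(1 + 1 / real (Suc n)) ^ 2 * q < (1 + q) / 2" if "n \<ge> N" for n
    by (auto simp: eventually_sequentially)
  have "summable (\<lambda>k. real (Suc k) ^ 2 * q ^ k)"
  proof (rule summable_ratio_test)
    show "(1 + q) / 2 < 1" using q by simp
    fix n assume "N \<le> n"
    have "real (Suc (Suc n)) = (1 + 1 / real (Suc n)) * real (Suc n)" by (simp add: field_simps)
    then have "real (Suc (Suc n)) ^ 2 * q ^ Suc n = ((1 + 1 / real (Suc n)) ^ 2 * q) * (real (Suc n) ^ 2 * q ^ n)"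
      by (simp only: power_mult_distrib power_Suc mult_ac)
    also have "\<dots> \<le> (1 + q) / 2 * (real (Suc n) ^ 2 * q ^ n)"
      using N[OF \<open>N \<le> n\<close>] q by (intro mult_right_mono) auto
    finally show "norm (real (Suc (Suc n)) ^ 2 * q ^ Suc n) \<le> (1 + q) / 2 * norm (real (Suc n) ^ 2 * q ^ n)"
      using q by simp
  qed
  then show ?thesis
    using q by (intro that[of "\<Sum>k. real (Suc k) ^ 2 * q ^ k"]) (auto intro!: sum_le_suminf suminf_nonneg simp: q_def)
qed

lemma offspring_funpow_cmult:
  assumes [measurable]: "f \<in> borel_measurable borel"
  shows "(offspring ^^ k) (\<lambda>x. c * f x) z = c * (offspring ^^ k) f z"
proof (induction k arbitrary: z)
  case (Suc k)
  have "(offspring ^^ Suc k) (\<lambda>x. c * f x) z = offspring (\<lambda>x. c * (offspring ^^ k) f x) z"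
    unfolding funpow.simps o_apply by (intro arg_cong[where f = "\<lambda>g. offspring g z"] ext Suc)
  also have "\<dots> = c * (offspring ^^ Suc k) f z" by (subst offspring_cmult) auto
  finally show ?case .
qed simp

lemma progeny_cmult:
  assumes [measurable]: "f \<in> borel_measurable borel"
  shows "progeny L (\<lambda>x. c * f x) z = c * progeny L f z"
  unfolding progeny_def sum_distrib_left by (simp add: offspring_funpow_cmult)

lemma measurable_progeny2:
  assumes [measurable]: "case_prod f \<in> borel_measurable (borel \<Otimes>\<^sub>M borel)"
  shows "(\<lambda>(y, z). progeny L (f y) z) \<in> borel_measurable (borel \<Otimes>\<^sub>M borel)"
proof -
  have "(\<lambda>x. \<Sum>k<L. (\<lambda>(y, z). (offspring ^^ k) (f y) z) x) \<in> borel_measurable (borel \<Otimes>\<^sub>M borel)"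
    by (intro borel_measurable_sum measurable_offspring_funpow2 assms)
  then show ?thesis by (simp add: progeny_def split_beta)
qed

text \<open>
  Two vertices that branch at \<open>w\<close> have conditionally independent subtrees below the children of
  \<open>w\<close>; summing over one of them first gives the factor \<open>\<kappa>\<close>, over the other one a factor
  linear in the mass of \<open>w\<close>.
\<close>

lemma branching_pairs_le:
  obtains K where "K \<ge> 0" "\<And>L y C1 C2 F. y > 0 \<Longrightarrow> C1 \<ge> 0 \<Longrightarrow> C2 \<ge> 0 \<Longrightarrow>
    case_prod F \<in> borel_measurable (borel \<Otimes>\<^sub>M borel) \<Longrightarrow>
    (\<And>a z. z \<ge> 0 \<Longrightarrow> progeny L (F a) z \<le> ennreal (indicator {y..} a * (C1 * z + C2 * z powr (1/2)))) \<Longrightarrow>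
    (\<integral>\<^sup>+d. branching_pairs L F d \<partial>splits)
    \<le> ennreal (K * (C1 + C2) / y)"
proof -
  obtain B where B: "B > 0"
    "\<And>L y z. y > 0 \<Longrightarrow> z \<ge> 0 \<Longrightarrow> progeny L (indicator {y..}) z \<le> ennreal (B * z / y)"
    using progeny_count_le by metis
  obtain S where S: "\<And>L. (\<Sum>k<L. real (Suc k) ^ 2 * moment (3/2) ^ k) \<le> S" "S \<ge> 0"
    using sum_moment_bounded[of "3/2"] by auto
  define K where "K = real CARD('b) ^ 2 * B * S"
  have K: "K \<ge> 0" using B S by (simp add: K_def)
  show ?thesis
  proof (rule that[OF K])
    fix L and y C1 C2 :: real and F :: "real \<Rightarrow> real \<Rightarrow> ennreal"
    assume y: "y > 0" and C: "C1 \<ge> 0" "C2 \<ge> 0"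
      and F [measurable]: "case_prod F \<in> borel_measurable (borel \<Otimes>\<^sub>M borel)"
      and bound: "\<And>a z. z \<ge> 0 \<Longrightarrow> progeny L (F a) z \<le> ennreal (indicator {y..} a * (C1 * z + C2 * z powr (1/2)))"
    define c where "c k = real CARD('b) ^ 2 * B / y * (C1 + C2) * real (Suc k)" for k
    have c: "c k \<ge> 0" for k using B y C by (simp add: c_def)
    define \<kappa> where "\<kappa> z = C1 * z + C2 * z powr (1/2)" for z :: real
    have \<kappa>: "0 \<le> \<kappa> z" if "z \<ge> 0" for z using that C by (simp add: \<kappa>_def)
    have \<kappa>_mono: "\<kappa> z \<le> \<kappa> z'" if "0 \<le> z" "z \<le> z'" for z z'
      using that C by (auto simp: \<kappa>_def intro!: add_mono mult_left_mono powr_mono2)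
    note [measurable] = measurable_Pair_compose_split[OF measurable_progeny2[OF F]]
    have branch: "(\<integral>\<^sup>+d. (\<Sum>v\<in>words L. \<Sum>u\<in>words L. F (mass 1 d (v @ j # w)) (mass 1 d (u @ i # w))) \<partial>splits)
      \<le> (\<integral>\<^sup>+d. ennreal (B / y * (C1 + C2) * mass 1 d w powr (3/2)) \<partial>splits)"
      if "i \<noteq> j" for i j w
    proof -
      have m [measurable]: "(\<lambda>d. F (mass 1 d v) (mass 1 d u)) \<in> borel_measurable splits" for u v
        by measurable
      have G: "case_prod (\<lambda>a x. ennreal (\<kappa> a) * indicator {y..} x) \<in> borel_measurable (borel \<Otimes>\<^sub>M borel)"
        unfolding \<kappa>_def by measurable
      \<comment> \<open>No vertex below \<open>j # w\<close> lies below \<open>i # w\<close>, so it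
        is a legitimate spectator while the subtree of \<open>i # w\<close> is averaged.\<close>
      have ns: "\<not> strict_suffix (i # w) (v @ j # w)" for v
      proof
        assume "strict_suffix (i # w) (v @ j # w)"
        then have "suffix (i # w) (v @ j # w)" by (simp add: strict_suffix_def)
        moreover have "suffix (j # w) (v @ j # w)" by (simp add: suffix_def)
        ultimately have "suffix (i # w) (j # w)" by (rule suffix_length_suffix) simp
        then show False using that by (auto simp: suffix_def)
      qed
      have "(\<integral>\<^sup>+d. (\<Sum>v\<in>words L. \<Sum>u\<in>words L. F (mass 1 d (v @ j # w)) (mass 1 d (u @ i # w))) \<partial>splits)
        = (\<Sum>v\<in>words L. \<integral>\<^sup>+d. (\<Sum>u\<in>words L. F (mass 1 d (v @ j # w)) (mass 1 d (u @ i # w))) \<partial>splits)"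
        by (intro nn_integral_sum borel_measurable_sum m)
      also have "\<dots> = (\<Sum>v\<in>words L. \<integral>\<^sup>+d. progeny L (F (mass 1 d (v @ j # w))) (mass 1 d (i # w)) \<partial>splits)"
        by (intro sum.cong refl nn_integral_words F ns)
      also have "\<dots> \<le> (\<Sum>v\<in>words L. \<integral>\<^sup>+d. ennreal (\<kappa> (mass 1 d w)) * indicator {y..} (mass 1 d (v @ j # w)) \<partial>splits)"
      proof (intro sum_mono nn_integral_mono_AE)
        fix v
        show "AE d in splits. progeny L (F (mass 1 d (v @ j # w))) (mass 1 d (i # w))
            \<le> ennreal (\<kappa> (mass 1 d w)) * indicator {y..} (mass 1 d (v @ j # w))"
          using AE_conservative
        proof eventually_elim
          case (elim d)
          have le: "0 \<le> mass 1 d (i # w)" "mass 1 d (i # w) \<le> mass 1 d w"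
            using mass_nonneg[OF elim, of "i # w"] mass_append_le[OF elim, of "[i]" w] by auto
          have "progeny L (F (mass 1 d (v @ j # w))) (mass 1 d (i # w))
              \<le> ennreal (indicator {y..} (mass 1 d (v @ j # w)) * \<kappa> (mass 1 d (i # w)))"
            unfolding \<kappa>_def by (rule bound[OF le(1)])
          also have "\<dots> \<le> ennreal (\<kappa> (mass 1 d w)) * indicator {y..} (mass 1 d (v @ j # w))"
            using \<kappa>_mono[OF le] by (auto split: split_indicator intro: ennreal_leI)
          finally show ?case .
        qed
      qed
      also have "\<dots> = (\<integral>\<^sup>+d. (\<Sum>v\<in>words L. ennreal (\<kappa> (mass 1 d w)) * indicator {y..} (mass 1 d (v @ j # w))) \<partial>splits)"
        unfolding \<kappa>_def by (rule nn_integral_sum[symmetric]) measurable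
      also have "\<dots> = (\<integral>\<^sup>+d. progeny L (\<lambda>x. ennreal (\<kappa> (mass 1 d w)) * indicator {y..} x) (mass 1 d (j # w)) \<partial>splits)"
        by (rule nn_integral_words[OF G]) (auto simp: strict_suffix_def suffix_def)
      also have "\<dots> \<le> (\<integral>\<^sup>+d. ennreal (B / y * (C1 + C2) * mass 1 d w powr (3/2)) \<partial>splits)"
      proof (rule nn_integral_mono_AE)
        show "AE d in splits. progeny L (\<lambda>x. ennreal (\<kappa> (mass 1 d w)) * indicator {y..} x) (mass 1 d (j # w))
            \<le> ennreal (B / y * (C1 + C2) * mass 1 d w powr (3/2))"
          using AE_conservative
        proof eventually_elim
          case (elim d)
          define m where "m = mass 1 d w"
          have m: "0 \<le> m" "m \<le> 1" unfolding m_def by (rule mass_nonneg[OF elim], rule mass_le_1[OF elim])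
          have le: "0 \<le> mass 1 d (j # w)" "mass 1 d (j # w) \<le> m"
            using mass_nonneg[OF elim, of "j # w"] mass_append_le[OF elim, of "[j]" w] by (auto simp: m_def)
          have "progeny L (\<lambda>x. ennreal (\<kappa> m) * indicator {y..} x) (mass 1 d (j # w))
              = ennreal (\<kappa> m) * progeny L (indicator {y..}) (mass 1 d (j # w))"
            by (rule progeny_cmult) measurable
          also have "\<dots> \<le> ennreal (\<kappa> m) * ennreal (B * m / y)"
          proof (rule mult_left_mono)
            have "B * mass 1 d (j # w) / y \<le> B * m / y"
              using le B y by (intro divide_right_mono mult_left_mono) auto
            then show "progeny L (indicator {y..}) (mass 1 d (j # w)) \<le> ennreal (B * m / y)"
              using B(2)[OF y le(1), of L] by (meson ennreal_leI order_trans)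
          qed simp
          also have "\<dots> = ennreal (B / y * (\<kappa> m * m))"
            using \<kappa>[OF m(1)] B y m by (subst ennreal_mult[symmetric]) (auto simp: mult_ac)
          \<comment> \<open>Masses are at most 1, so the terms with exponents 2 and 3/2 both fit
            under exponent 3/2, which is above 1 and therefore has a moment below 1.\<close>
          also have "\<dots> \<le> ennreal (B / y * ((C1 + C2) * m powr (3/2)))"
          proof (intro ennreal_leI mult_left_mono)
            have "m powr (3/2) = m powr (1/2) * m"
              using m by (cases "m = 0") (simp_all add: powr_add[of m "1/2" 1, simplified])
            moreover have "m powr 1 \<le> m powr (1/2)" using m by (intro powr_mono') auto
            then have "C1 * m \<le> C1 * m powr (1/2)" using m C by (intro mult_left_mono) auto
            then have "\<kappa> m * m \<le> ((C1 + C2) * m powr (1/2)) * m"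
              using m unfolding \<kappa>_def by (intro mult_right_mono) (auto simp: distrib_right)
            ultimately show "\<kappa> m * m \<le> (C1 + C2) * m powr (3/2)" by simp
          qed (use B y in simp)
          finally show ?case by (simp add: m_def mult.assoc)
        qed
      qed
      finally show ?thesis .
    qed
    have mF [measurable]: "(\<lambda>d. F (mass 1 d v) (mass 1 d u)) \<in> borel_measurable splits" for u v
      by measurable
    have "(\<integral>\<^sup>+d. branching_pairs L F d \<partial>splits)
      = (\<Sum>(w, i, j)\<in>words L \<times> UNIV \<times> UNIV. \<integral>\<^sup>+d. (if i = j then 0 else of_nat (Suc (length w)) *
        (\<Sum>v\<in>words L. \<Sum>u\<in>words L. F (mass 1 d (v @ j # w)) (mass 1 d (u @ i # w)))) \<partial>splits)"
      unfolding split_beta by (rule nn_integral_sum) measurable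
    also have "\<dots> \<le> (\<Sum>(w, i, j)\<in>words L \<times> (UNIV :: 'b set) \<times> (UNIV :: 'b set). \<integral>\<^sup>+d. of_nat (Suc (length w)) *
        ennreal (B / y * (C1 + C2) * mass 1 d w powr (3/2)) \<partial>splits)"
    proof (rule sum_mono, clarify)
      fix w :: "'b list" and i j :: 'b
      show "(\<integral>\<^sup>+d. (if i = j then 0 else of_nat (Suc (length w)) *
          (\<Sum>v\<in>words L. \<Sum>u\<in>words L. F (mass 1 d (v @ j # w)) (mass 1 d (u @ i # w)))) \<partial>splits)
        \<le> (\<integral>\<^sup>+d. of_nat (Suc (length w)) *
          ennreal (B / y * (C1 + C2) * mass 1 d w powr (3/2)) \<partial>splits)"
      proof (cases "i = j")
        case False
        have 1: "(\<integral>\<^sup>+d. of_nat (Suc (length w)) *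
            (\<Sum>v\<in>words L. \<Sum>u\<in>words L. F (mass 1 d (v @ j # w)) (mass 1 d (u @ i # w))) \<partial>splits)
          = of_nat (Suc (length w)) * (\<integral>\<^sup>+d. (\<Sum>v\<in>words L. \<Sum>u\<in>words L. F (mass 1 d (v @ j # w)) (mass 1 d (u @ i # w))) \<partial>splits)"
          by (rule nn_integral_cmult) (intro borel_measurable_sum mF)
        have 2: "(\<integral>\<^sup>+d. of_nat (Suc (length w)) *
          ennreal (B / y * (C1 + C2) * mass 1 d w powr (3/2)) \<partial>splits)
          = of_nat (Suc (length w)) * (\<integral>\<^sup>+d. ennreal (B / y * (C1 + C2) * mass 1 d w powr (3/2)) \<partial>splits)"
          by (rule nn_integral_cmult) measurable
        show ?thesis
          unfolding if_not_P[OF False] 1 2 by (intro mult_left_mono branch[OF False]) simp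
      qed simp
    qed
    also have "\<dots> = (\<Sum>w\<in>words L. \<Sum>i\<in>(UNIV :: 'b set). \<Sum>j\<in>(UNIV :: 'b set). \<integral>\<^sup>+d. of_nat (Suc (length w)) *
        ennreal (B / y * (C1 + C2) * mass 1 d w powr (3/2)) \<partial>splits)"
      by (simp only: sum.cartesian_product)
    also have "\<dots> = (\<Sum>w\<in>words L. \<integral>\<^sup>+d. ennreal (c (length w) * mass 1 d w powr (3/2)) \<partial>splits)"
    proof (rule sum.cong[OF refl])
      fix w :: "'b list"
      have "(\<Sum>i\<in>(UNIV :: 'b set). \<Sum>j\<in>(UNIV :: 'b set). \<integral>\<^sup>+d. of_nat (Suc (length w)) *
          ennreal (B / y * (C1 + C2) * mass 1 d w powr (3/2)) \<partial>splits)
        = ennreal ((real CARD('b))\<^sup>2) * (\<integral>\<^sup>+d. ennreal (Suc (length w)) *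
          ennreal (B / y * (C1 + C2) * mass 1 d w powr (3/2)) \<partial>splits)"
        by (simp add: ennreal_of_nat_eq_real_of_nat power2_eq_square ennreal_mult mult.assoc del: of_nat_Suc)
      also have "\<dots> = (\<integral>\<^sup>+d. ennreal ((real CARD('b))\<^sup>2) * (ennreal (Suc (length w)) *
          ennreal (B / y * (C1 + C2) * mass 1 d w powr (3/2))) \<partial>splits)"
        by (rule nn_integral_cmult[symmetric]) measurable
      also have "\<dots> = (\<integral>\<^sup>+d. ennreal (c (length w) * mass 1 d w powr (3/2)) \<partial>splits)"
        using B y C by (simp add: c_def ennreal_mult[symmetric] mult_ac del: of_nat_Suc)
      finally show "(\<Sum>i\<in>(UNIV :: 'b set). \<Sum>j\<in>(UNIV :: 'b set). \<integral>\<^sup>+d. of_nat (Suc (length w)) *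
          ennreal (B / y * (C1 + C2) * mass 1 d w powr (3/2)) \<partial>splits)
        = (\<integral>\<^sup>+d. ennreal (c (length w) * mass 1 d w powr (3/2)) \<partial>splits)" .
    qed
    also have "\<dots> = (\<integral>\<^sup>+d. (\<Sum>w\<in>words L. ennreal (c (length w) * mass 1 d w powr (3/2))) \<partial>splits)"
      by (rule nn_integral_sum[symmetric]) measurable
    also have "\<dots> = ennreal (\<Sum>k<L. c k * moment (3/2) ^ k)"
      using c by (intro nn_integral_words_moment) auto
    also have "\<dots> \<le> ennreal (K * (C1 + C2) / y)"
    proof (rule ennreal_leI)
      have "(\<Sum>k<L. c k * moment (3/2) ^ k)
          = real CARD('b) ^ 2 * B / y * (C1 + C2) * (\<Sum>k<L. real (Suc k) * moment (3/2) ^ k)"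
        by (simp only: c_def sum_distrib_left mult.assoc)
      also have "\<dots> \<le> real CARD('b) ^ 2 * B / y * (C1 + C2) * (\<Sum>k<L. real (Suc k) ^ 2 * moment (3/2) ^ k)"
        using B y C moment_nonneg[of "3/2"]
        by (intro mult_left_mono sum_mono mult_right_mono self_le_power) auto
      also have "\<dots> \<le> real CARD('b) ^ 2 * B / y * (C1 + C2) * S"
        using B y C S(1) by (intro mult_left_mono) auto
      also have "\<dots> = K * (C1 + C2) / y" by (simp add: K_def mult_ac)
      finally show "(\<Sum>k<L. c k * moment (3/2) ^ k) \<le> K * (C1 + C2) / y" .
    qed
    finally show "(\<integral>\<^sup>+d. branching_pairs L F d \<partial>splits)
      \<le> ennreal (K * (C1 + C2) / y)" .
  qed
qed

text \<open>Comparable pairs add only the lower order term \<open>y powr (-3/2)\<close>. The kernel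
  \<open>F\<close> is left general: counting heavy pairs takes \<open>C1\<close> of order
  \<open>1 / y\<close> and \<open>C2 = 0\<close>, whereas ties take \<open>C1\<close> small compared
  with \<open>1 / y\<close>, at the expense of the square root term.\<close>

lemma pairs_le:
  obtains K where "K \<ge> 0" "\<And>L y C1 C2 F. y > 0 \<Longrightarrow> C1 \<ge> 0 \<Longrightarrow> C2 \<ge> 0 \<Longrightarrow>
    case_prod F \<in> borel_measurable (borel \<Otimes>\<^sub>M borel) \<Longrightarrow>
    (\<And>a x. F a x \<le> indicator {y..} a) \<Longrightarrow> (\<And>a x. F a x \<le> indicator {y..} x) \<Longrightarrow>
    (\<And>a z. z \<ge> 0 \<Longrightarrow> progeny L (F a) z \<le> ennreal (indicator {y..} a * (C1 * z + C2 * z powr (1/2)))) \<Longrightarrow>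
    (\<integral>\<^sup>+d. weighted_pairs L F d \<partial>splits)
    \<le> ennreal (K * (C1 + C2) / y + K * y powr (-3/2))"
proof -
  obtain K where K: "K \<ge> 0" and branching: "\<And>L y C1 C2 F. y > 0 \<Longrightarrow> C1 \<ge> 0 \<Longrightarrow> C2 \<ge> 0 \<Longrightarrow>
    case_prod F \<in> borel_measurable (borel \<Otimes>\<^sub>M borel) \<Longrightarrow>
    (\<And>a z. z \<ge> 0 \<Longrightarrow> progeny L (F a) z \<le> ennreal (indicator {y..} a * (C1 * z + C2 * z powr (1/2)))) \<Longrightarrow>
    (\<integral>\<^sup>+d. branching_pairs L F d \<partial>splits)
    \<le> ennreal (K * (C1 + C2) / y)"
    using branching_pairs_le by blast
  obtain S where S: "\<And>L. (\<Sum>k<L. real (Suc k) ^ 2 * moment (3/2) ^ k) \<le> S" "S \<ge> 0"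
    using sum_moment_bounded[of "3/2"] by auto
  show ?thesis
  proof (rule that[of "K + 2 * S"])
    fix L and y C1 C2 :: real and F :: "real \<Rightarrow> real \<Rightarrow> ennreal"
    assume y: "y > 0" and C: "C1 \<ge> 0" "C2 \<ge> 0"
      and F [measurable]: "case_prod F \<in> borel_measurable (borel \<Otimes>\<^sub>M borel)"
      and F1: "\<And>a x. F a x \<le> indicator {y..} a" and F2: "\<And>a x. F a x \<le> indicator {y..} x"
      and bound: "\<And>a z. z \<ge> 0 \<Longrightarrow> progeny L (F a) z \<le> ennreal (indicator {y..} a * (C1 * z + C2 * z powr (1/2)))"
    have mF [measurable]: "(\<lambda>d. F (mass 1 d v) (mass 1 d u)) \<in> borel_measurable splits" for u v
      by measurable
    have comparable: "(\<Sum>v\<in>words L. \<Sum>u\<in>set (suffixes v). of_nat (Suc (length v)) * (F (mass 1 d v) (mass 1 d u) + F (mass 1 d u) (mass 1 d v)))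
      \<le> (\<Sum>v\<in>words L. ennreal (2 * y powr (-3/2) * real (Suc (length v)) ^ 2 * mass 1 d v powr (3/2)))" for d :: "'b list \<Rightarrow> real ^ 'b"
    proof (rule sum_mono)
      fix v :: "'b list"
      define n where "n = Suc (length v)"
      have "card (set (suffixes v)) \<le> n" using card_length[of "suffixes v"] by (simp add: n_def)
      \<comment> \<open>Markov's inequality with exponent 3/2, the one whose moments were summed
        above.\<close>
      have ind: "indicator {y..} (mass 1 d v) \<le> ennreal (y powr (-3/2) * mass 1 d v powr (3/2))"
      proof (cases "y \<le> mass 1 d v")
        case True
        have "1 = y powr (-3/2) * y powr (3/2)" using y by (simp add: powr_add[symmetric])
        also have "\<dots> \<le> y powr (-3/2) * mass 1 d v powr (3/2)"
          using True y by (intro mult_left_mono powr_mono2) auto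
        finally show ?thesis using True by (simp add: ennreal_leI flip: ennreal_1)
      qed simp
      have "(\<Sum>u\<in>set (suffixes v). of_nat n * (F (mass 1 d v) (mass 1 d u) + F (mass 1 d u) (mass 1 d v)))
          \<le> (\<Sum>u\<in>set (suffixes v). of_nat n * (2 * indicator {y..} (mass 1 d v)))"
      proof (intro sum_mono mult_left_mono)
        fix u
        show "F (mass 1 d v) (mass 1 d u) + F (mass 1 d u) (mass 1 d v) \<le> 2 * indicator {y..} (mass 1 d v)"
          using add_mono[OF F1[of "mass 1 d v" "mass 1 d u"] F2[of "mass 1 d u" "mass 1 d v"]]
          by (simp add: mult_2)
      qed simp
      also have "\<dots> = of_nat (card (set (suffixes v))) * (of_nat n * (2 * indicator {y..} (mass 1 d v)))"
        by simp
      also have "\<dots> \<le> of_nat n * (of_nat n * (2 * ennreal (y powr (-3/2) * mass 1 d v powr (3/2))))"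
        by (intro mult_mono of_nat_mono \<open>card (set (suffixes v)) \<le> n\<close> ind order_refl) auto
      also have "\<dots> = ennreal (2 * y powr (-3/2) * real n ^ 2 * mass 1 d v powr (3/2))"
      proof -
        have "of_nat n * (of_nat n * (2 * ennreal (y powr (-3/2) * mass 1 d v powr (3/2))))
            = ennreal (real n) * (ennreal (real n) * (ennreal 2 * ennreal (y powr (-3/2) * mass 1 d v powr (3/2))))"
          by (simp only: ennreal_of_nat_eq_real_of_nat ennreal_numeral)
        also have "\<dots> = ennreal (real n * (real n * (2 * (y powr (-3/2) * mass 1 d v powr (3/2)))))"
          by (simp add: ennreal_mult)
        finally show ?thesis by (simp add: power2_eq_square mult_ac)
      qed
      finally show "(\<Sum>u\<in>set (suffixes v). of_nat (Suc (length v)) * (F (mass 1 d v) (mass 1 d u) + F (mass 1 d u) (mass 1 d v)))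
        \<le> ennreal (2 * y powr (-3/2) * real (Suc (length v)) ^ 2 * mass 1 d v powr (3/2))"
        unfolding n_def .
    qed
    have "(\<integral>\<^sup>+d. weighted_pairs L F d \<partial>splits)
      \<le> (\<integral>\<^sup>+d. branching_pairs L F d
          + (\<Sum>v\<in>words L. ennreal (2 * y powr (-3/2) * real (Suc (length v)) ^ 2 * mass 1 d v powr (3/2))) \<partial>splits)"
    proof (rule nn_integral_mono)
      fix d :: "'b list \<Rightarrow> real ^ 'b"
      show "weighted_pairs L F d
        \<le> branching_pairs L F d
          + (\<Sum>v\<in>words L. ennreal (2 * y powr (-3/2) * real (Suc (length v)) ^ 2 * mass 1 d v powr (3/2)))"
        by (rule order_trans[OF sum_pairs_le[where F = "\<lambda>u v. F (mass 1 d v) (mass 1 d u)"]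
              add_left_mono[OF comparable]])
    qed
    also have "\<dots> = (\<integral>\<^sup>+d. branching_pairs L F d \<partial>splits)
          + (\<integral>\<^sup>+d. (\<Sum>v\<in>words L. ennreal (2 * y powr (-3/2) * real (Suc (length v)) ^ 2 * mass 1 d v powr (3/2))) \<partial>splits)"
      by (rule nn_integral_add) measurable
    also have "\<dots> \<le> ennreal (K * (C1 + C2) / y) + ennreal (2 * S * y powr (-3/2))"
    proof (rule add_mono)
      show "(\<integral>\<^sup>+d. branching_pairs L F d \<partial>splits)
        \<le> ennreal (K * (C1 + C2) / y)"
        using bound by (intro branching[OF y C F])
      have "(\<integral>\<^sup>+d. (\<Sum>v\<in>words L. ennreal (2 * y powr (-3/2) * real (Suc (length v)) ^ 2 * mass 1 d v powr (3/2))) \<partial>splits)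
        = ennreal (\<Sum>k<L. 2 * y powr (-3/2) * real (Suc k) ^ 2 * moment (3/2) ^ k)"
        by (rule nn_integral_words_moment) auto
      also have "(\<Sum>k<L. 2 * y powr (-3/2) * real (Suc k) ^ 2 * moment (3/2) ^ k)
          = 2 * y powr (-3/2) * (\<Sum>k<L. real (Suc k) ^ 2 * moment (3/2) ^ k)"
        by (simp only: sum_distrib_left mult.assoc)
      also have "ennreal \<dots> \<le> ennreal (2 * y powr (-3/2) * S)"
        using S by (intro ennreal_leI mult_left_mono) auto
      finally show "(\<integral>\<^sup>+d. (\<Sum>v\<in>words L. ennreal (2 * y powr (-3/2) * real (Suc (length v)) ^ 2 * mass 1 d v powr (3/2))) \<partial>splits)
        \<le> ennreal (2 * S * y powr (-3/2))" by (simp add: mult_ac)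
    qed
    also have "\<dots> = ennreal (K * (C1 + C2) / y + 2 * S * y powr (-3/2))"
      using K C y S by (intro ennreal_plus[symmetric]) auto
    also have "\<dots> \<le> ennreal ((K + 2 * S) * (C1 + C2) / y + (K + 2 * S) * y powr (-3/2))"
      using K C y S by (intro ennreal_leI add_mono divide_right_mono mult_right_mono) auto
    finally show "(\<integral>\<^sup>+d. weighted_pairs L F d \<partial>splits)
      \<le> ennreal ((K + 2 * S) * (C1 + C2) / y + (K + 2 * S) * y powr (-3/2))" .
  qed (use K S in auto)
qed

text \<open>For a fixed spectator the number of heavy vertices below mass \<open>z\<close> has mean
  at most \<open>B * z / y\<close>; so \<open>pairs_le\<close> applies with
  \<open>C1 = B / y\<close> and \<open>C2 = 0\<close>.\<close>

lemma common_ancestor_pairs_le: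
  obtains K where "K \<ge> 0" "\<And>L y. 0 < y \<Longrightarrow> y \<le> 1 \<Longrightarrow>
    (\<integral>\<^sup>+d. common_ancestor_pairs L y d \<partial>splits) \<le> ennreal (K / y ^ 2)"
proof -
  obtain K where K: "K \<ge> 0" and pairs: "\<And>L y C1 C2 F. y > 0 \<Longrightarrow> C1 \<ge> 0 \<Longrightarrow> C2 \<ge> 0 \<Longrightarrow>
    case_prod F \<in> borel_measurable (borel \<Otimes>\<^sub>M borel) \<Longrightarrow>
    (\<And>a x. F a x \<le> indicator {y..} a) \<Longrightarrow> (\<And>a x. F a x \<le> indicator {y..} x) \<Longrightarrow>
    (\<And>a z. z \<ge> 0 \<Longrightarrow> progeny L (F a) z \<le> ennreal (indicator {y..} a * (C1 * z + C2 * z powr (1/2)))) \<Longrightarrow>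
    (\<integral>\<^sup>+d. weighted_pairs L F d \<partial>splits)
    \<le> ennreal (K * (C1 + C2) / y + K * y powr (-3/2))"
    using pairs_le by blast
  obtain B where B: "B > 0"
    "\<And>L y z. y > 0 \<Longrightarrow> z \<ge> 0 \<Longrightarrow> progeny L (indicator {y..}) z \<le> ennreal (B * z / y)"
    using progeny_count_le by metis
  show ?thesis
  proof (rule that[of "K * (B + 1)"])
    fix L and y :: real assume y: "0 < y" "y \<le> 1"
    define F where "F a x = (indicator {y..} a * indicator {y..} x :: ennreal)" for a x :: real
    have "(\<integral>\<^sup>+d. common_ancestor_pairs L y d \<partial>splits)
      \<le> (\<integral>\<^sup>+d. weighted_pairs L F d \<partial>splits)"
      unfolding F_def
      by (intro nn_integral_mono sum_mono) (auto intro!: mult_mono simp: mult.commute simp del: of_nat_Suc split: split_indicator)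
    also have "\<dots> \<le> ennreal (K * (B / y + 0) / y + K * y powr (-3/2))"
    proof (rule pairs)
      show "case_prod F \<in> borel_measurable (borel \<Otimes>\<^sub>M borel)" unfolding F_def by measurable
      show "F a x \<le> indicator {y..} a" "F a x \<le> indicator {y..} x" for a x
        by (auto simp: F_def split: split_indicator)
      fix a z :: real assume z: "z \<ge> 0"
      have "progeny L (F a) z = indicator {y..} a * progeny L (indicator {y..}) z"
        unfolding F_def by (rule progeny_cmult) measurable
      also have "\<dots> \<le> indicator {y..} a * ennreal (B * z / y)"
        using B(2)[OF y(1) z] by (intro mult_left_mono) auto
      also have "\<dots> = ennreal (indicator {y..} a * (B / y * z + 0 * z powr (1/2)))"
        by (simp split: split_indicator)
      finally show "progeny L (F a) z \<le> ennreal (indicator {y..} a * (B / y * z + 0 * z powr (1/2)))" .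
    qed (use y B in auto)
    also have "\<dots> \<le> ennreal (K * (B + 1) / y ^ 2)"
    proof (rule ennreal_leI)
      \<comment> \<open>Here \<open>y \<le> 1\<close> lets the contribution of comparable pairs be
        absorbed.\<close>
      have "y powr (-3/2) \<le> y powr (-2)" using y by (intro powr_mono') auto
      also have "\<dots> = 1 / y ^ 2" using y by (simp add: powr_minus divide_inverse)
      finally have "K * y powr (-3/2) \<le> K * (1 / y ^ 2)" using K by (intro mult_left_mono) auto
      then show "K * (B / y + 0) / y + K * y powr (-3/2) \<le> K * (B + 1) / y ^ 2"
        using y by (simp add: power2_eq_square distrib_left add_divide_distrib)
    qed
    finally show "(\<integral>\<^sup>+d. common_ancestor_pairs L y d \<partial>splits) \<le> ennreal (K * (B + 1) / y ^ 2)" .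
  qed (use K B in auto)
qed

text \<open>Below mass \<open>z\<close>, vertices of the same mass \<open>a\<close> as the spectator
  have mean number at most \<open>atom_mean (z / a)\<close>. Sublinearity makes the coefficient of
  \<open>z / a\<close> arbitrarily small; what remains for small ratios is a multiple of the square
  root and ends up in the lower order term.\<close>

lemma tied_pairs_le:
  assumes nonlattice: "\<And>h. h > 0 \<Longrightarrow> \<not> (AE d in \<nu>. \<forall>i. d $ i > 0 \<longrightarrow> - ln (d $ i) \<in> (\<lambda>x. h * x) ` \<int>)"
    and \<epsilon>: "\<epsilon> > 0"
  obtains K where "K \<ge> 0" "\<And>L y. 0 < y \<Longrightarrow>
    (\<integral>\<^sup>+d. tied_pairs L y d \<partial>splits)
    \<le> ennreal (\<epsilon> / y ^ 2 + K * y powr (-3/2))"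
proof -
  obtain K where K: "K \<ge> 0" and pairs: "\<And>L y C1 C2 F. y > 0 \<Longrightarrow> C1 \<ge> 0 \<Longrightarrow> C2 \<ge> 0 \<Longrightarrow>
    case_prod F \<in> borel_measurable (borel \<Otimes>\<^sub>M borel) \<Longrightarrow>
    (\<And>a x. F a x \<le> indicator {y..} a) \<Longrightarrow> (\<And>a x. F a x \<le> indicator {y..} x) \<Longrightarrow>
    (\<And>a z. z \<ge> 0 \<Longrightarrow> progeny L (F a) z \<le> ennreal (indicator {y..} a * (C1 * z + C2 * z powr (1/2)))) \<Longrightarrow>
    (\<integral>\<^sup>+d. weighted_pairs L F d \<partial>splits)
    \<le> ennreal (K * (C1 + C2) / y + K * y powr (-3/2))"
    using pairs_le by blast
  obtain B where B: "B > 0"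
    "\<And>z. 0 \<le> z \<Longrightarrow> (\<Sum>k. (offspring ^^ k) (indicator {1}) z) = ennreal (atom_mean z)"
    "\<And>z. 0 \<le> z \<Longrightarrow> atom_mean z \<le> B * z"
    using sum_atom_mean_le by metis
  \<comment> \<open>The product with \<open>K\<close> stays below \<epsilon>; the 1 added to
    \<open>K\<close> covers \<open>K = 0\<close>.\<close>
  define e where "e = \<epsilon> / (K + 1)"
  have e: "e > 0" "K * e \<le> \<epsilon>" using K \<epsilon> by (auto simp: e_def field_simps)
  obtain L0 where L0: "L0 > 0" "\<And>z. z \<ge> L0 \<Longrightarrow> atom_mean z \<le> e * z"
    using atom_mean_sublinear[OF nonlattice e(1)] by blast
  \<comment> \<open>For \<open>x\<close> below \<open>L0\<close>, one of the two square roots in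
    \<open>B * x\<close> is replaced by that of \<open>L0\<close>.\<close>
  define C where "C = B * L0 powr (1/2)"
  have C: "C \<ge> 0" using B by (simp add: C_def)
  have atom: "atom_mean x \<le> e * x + C * x powr (1/2)" if x: "x \<ge> 0" for x
  proof (cases "x \<ge> L0")
    case True
    then show ?thesis using L0(2)[OF True] C by (simp add: add_increasing2)
  next
    case False
    have "atom_mean x \<le> B * x" by (rule B(3)[OF x])
    also have "B * x = B * (x powr (1/2) * x powr (1/2))" using x by (simp add: powr_add[symmetric])
    also have "\<dots> \<le> B * (L0 powr (1/2) * x powr (1/2))"
      using False x B by (intro mult_left_mono mult_right_mono powr_mono2) auto
    finally show ?thesis using e x by (simp add: C_def add_increasing mult.assoc)
  qed
  show ?thesis
  proof (rule that[of "K * C + K"])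
    fix L and y :: real assume y: "0 < y"
    define F where "F a x = (indicator {(a, x). a = x \<and> y \<le> a} (a, x) :: ennreal)" for a x :: real
    have "(\<integral>\<^sup>+d. tied_pairs L y d \<partial>splits)
      \<le> (\<integral>\<^sup>+d. weighted_pairs L F d \<partial>splits)"
      unfolding F_def by (intro nn_integral_mono sum_mono) (auto split: split_indicator)
    also have "\<dots> \<le> ennreal (K * (e / y + C * y powr (-1/2)) / y + K * y powr (-3/2))"
    proof (rule pairs)
      show "case_prod F \<in> borel_measurable (borel \<Otimes>\<^sub>M borel)"
        unfolding F_def split_beta indicator_def by measurable
      show "F a x \<le> indicator {y..} a" "F a x \<le> indicator {y..} x" for a x
        by (auto simp: F_def split: split_indicator)
      fix a z :: real assume z: "z \<ge> 0"
      show "progeny L (F a) z \<le> ennreal (indicator {y..} a * (e / y * z + C * y powr (-1/2) * z powr (1/2)))"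
      proof (cases "y \<le> a")
        case True
        have "F a = (\<lambda>x. indicator {1} (1 / a * x))"
          using True y by (auto simp: F_def fun_eq_iff field_simps split: split_indicator)
        then have "progeny L (F a) z = progeny L (indicator {1}) (1 / a * z)"
          by (simp only: progeny_def offspring_funpow_scale)
        also have "\<dots> \<le> (\<Sum>k. (offspring ^^ k) (indicator {1}) (1 / a * z))"
          unfolding progeny_def by (rule sum_le_suminf) (auto intro: summableI)
        also have "\<dots> = ennreal (atom_mean (1 / a * z))" using True y z by (intro B) auto
        also have "\<dots> \<le> ennreal (e / y * z + C * y powr (-1/2) * z powr (1/2))"
        proof (rule ennreal_leI)
          have le: "0 \<le> 1 / a * z" "1 / a * z \<le> 1 / y * z"
            using True y z by (auto intro!: mult_right_mono divide_left_mono)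
          have "atom_mean (1 / a * z) \<le> e * (1 / a * z) + C * (1 / a * z) powr (1/2)"
            by (rule atom[OF le(1)])
          also have "\<dots> \<le> e * (1 / y * z) + C * (1 / y * z) powr (1/2)"
            using le e C by (intro add_mono mult_left_mono powr_mono2) auto
          also have "(1 / y * z) powr (1/2) = y powr (-1/2) * z powr (1/2)"
          proof -
            have "y powr (-1/2) = 1 / y powr (1/2)" using powr_minus_divide[of y "1/2"] by simp
            moreover have "(1 / y * z) powr (1/2) = (1 / y) powr (1/2) * z powr (1/2)"
              by (rule powr_mult)
            moreover have "(1 / y) powr (1/2) = 1 / y powr (1/2)"
              using y powr_divide[of 1 y "1/2"] by simp
            ultimately show ?thesis by simp
          qed
          finally show "atom_mean (1 / a * z) \<le> e / y * z + C * y powr (-1/2) * z powr (1/2)"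
            by (simp add: mult.assoc)
        qed
        finally show ?thesis using True by simp
      next
        case False
        then have "F a = (\<lambda>x. 0 * indicator {1} x)" by (auto simp: F_def fun_eq_iff)
        moreover have "progeny L (\<lambda>x. 0 * indicator {1} x) z = 0 * progeny L (indicator {1}) z"
          by (rule progeny_cmult) measurable
        ultimately have "progeny L (F a) z = 0 * progeny L (indicator {1}) z" by simp
        then show ?thesis by simp
      qed
    qed (use y e C in auto)
    also have "\<dots> \<le> ennreal (\<epsilon> / y ^ 2 + (K * C + K) * y powr (-3/2))"
    proof (rule ennreal_leI)
      have "y powr (-1/2) / y = y powr (-1/2) * y powr (-1)" using y by (simp add: powr_neg_one)
      also have "\<dots> = y powr (-3/2)" by (subst powr_add[symmetric]) simp
      finally have 1: "y powr (-1/2) / y = y powr (-3/2)" .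
      have "K * (e / y + C * y powr (-1/2)) / y = K * e / y ^ 2 + K * C * (y powr (-1/2) / y)"
        by (simp add: power2_eq_square distrib_left add_divide_distrib mult.assoc)
      also have "\<dots> \<le> \<epsilon> / y ^ 2 + K * C * y powr (-3/2)"
        unfolding 1 using e y by (intro add_mono divide_right_mono) auto
      finally show "K * (e / y + C * y powr (-1/2)) / y + K * y powr (-3/2) \<le> \<epsilon> / y ^ 2 + (K * C + K) * y powr (-3/2)"
        by (simp add: distrib_right)
    qed
    finally show "(\<integral>\<^sup>+d. tied_pairs L y d \<partial>splits)
      \<le> ennreal (\<epsilon> / y ^ 2 + (K * C + K) * y powr (-3/2))" .
  qed (use K C in auto)
qed

end

section \<open>Heights\<close>

context dislocation begin

lemma nn_integral_generation_count_le:
  assumes s: "s > 0" and y: "y > 0"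
  shows "(\<integral>\<^sup>+d. (\<Sum>v\<in>generation k. indicator {y..} (mass 1 d v)) \<partial>splits) \<le> ennreal (y powr (- s) * moment s ^ k)"
proof -
  have "(\<integral>\<^sup>+d. (\<Sum>v\<in>generation k. indicator {y..} (mass 1 d v)) \<partial>splits)
    \<le> (\<integral>\<^sup>+d. ennreal (y powr (- s)) * (\<Sum>v\<in>generation k. ennreal (mass 1 d v powr s)) \<partial>splits)"
    unfolding sum_distrib_left
  proof (intro nn_integral_mono sum_mono)
    fix d and v :: "'b list"
    show "indicator {y..} (mass 1 d v) \<le> ennreal (y powr (- s)) * ennreal (mass 1 d v powr s)"
    proof (cases "y \<le> mass 1 d v")
      case True
      have "1 = y powr (- s) * y powr s" using y by (simp add: powr_add[symmetric])
      also have "\<dots> \<le> y powr (- s) * mass 1 d v powr s"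
        using True y s by (intro mult_left_mono powr_mono2) auto
      finally have "ennreal 1 \<le> ennreal (y powr (- s) * mass 1 d v powr s)" by (rule ennreal_leI)
      then show ?thesis using True by (simp add: ennreal_mult)
    qed simp
  qed
  also have "\<dots> = ennreal (y powr (- s)) * (\<integral>\<^sup>+d. (\<Sum>v\<in>generation k. ennreal (mass 1 d v powr s)) \<partial>splits)"
    by (rule nn_integral_cmult) measurable
  also have "\<dots> = ennreal (y powr (- s) * moment s ^ k)"
    unfolding nn_integral_generation_moment[OF s] by (simp add: ennreal_mult moment_nonneg)
  finally show ?thesis .
qed

text \<open>Chernoff bounds, with exponents slightly above and slightly below 1.\<close>

lemma generation_count_deviation:
  assumes \<delta>: "\<delta> > 0"
  obtains a \<gamma> where "a > 0" "\<gamma> > 0" "\<And>(n :: nat) k. n \<ge> 1 \<Longrightarrow> \<bar>real k - ln n / mean_log\<bar> > \<delta> * ln n \<Longrightarrow>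
    (\<integral>\<^sup>+d. (\<Sum>v\<in>generation k. indicator {1 / (CARD('b) * real n)..} (mass 1 d v)) \<partial>splits)
    \<le> ennreal (real CARD('b) ^ 2 * n powr (1 - \<gamma>) * exp (- a * k))"
proof -
  define \<beta> where "\<beta> = mean_log"
  have \<beta>: "\<beta> > 0" using mean_log_pos by (simp add: \<beta>_def)
  define c where "c = real CARD('b)"
  have c: "c \<ge> 1" by (simp add: c_def Suc_le_eq)
  \<comment> \<open>Chosen so that in generation \<open>(1 / \<beta> + \<delta>) * ln n\<close> the
    loss of \<open>2 * \<eta>\<close> per generation uses up just half of the gain
    \<open>\<delta> * \<beta> * ln n\<close>. One \<eta> covers the second-order term of the moment,
    the other provides geometric decay in \<open>k\<close>.\<close>
  define \<eta> where "\<eta> = \<delta> * \<beta> / (4 * (1 / \<beta> + \<delta>))"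
  have \<eta>: "\<eta> > 0" using \<delta> \<beta> by (simp add: \<eta>_def add_pos_pos)
  have \<eta>_eq: "2 * \<eta> * (1 / \<beta> + \<delta>) = \<delta> * \<beta> / 2"
  proof -
    define e where "e = 1 / \<beta> + \<delta>"
    have "e > 0" using \<delta> \<beta> by (simp add: e_def add_pos_pos)
    then show ?thesis unfolding \<eta>_def e_def[symmetric] by simp
  qed
  \<comment> \<open>Small enough for \<open>moment_le_exp\<close> to apply and for its quadratic
    error to be at most \<open>h * \<eta>\<close>.\<close>
  define h where "h = min (1/2) (\<eta> / (8 * c))"
  have h: "h > 0" "h \<le> 1/2" "8 * c * h \<le> \<eta>"
    using \<eta> c by (auto simp: h_def min_def field_simps)
  define \<gamma> where "\<gamma> = h * \<delta> * \<beta> / 2"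
  have \<gamma>: "\<gamma> > 0" using h \<delta> \<beta> by (simp add: \<gamma>_def)
  have main: "(\<integral>\<^sup>+d. (\<Sum>v\<in>generation k. indicator {1 / (c * real n)..} (mass 1 d v)) \<partial>splits)
    \<le> ennreal (c ^ 2 * n powr (1 - \<gamma>) * exp (- (h * \<eta>) * k))"
    if n: "n \<ge> 1" and dev: "\<bar>real k - ln n / \<beta>\<bar> > \<delta> * ln n" for n k :: nat
  proof -
    define l where "l = ln (real n)"
    have l: "l \<ge> 0" using n by (simp add: l_def)
    have n_powr: "real n powr s = exp (l * s)" for s
      using n by (simp add: powr_def l_def mult.commute)
    \<comment> \<open>An exponent above 1 controls generations that are too deep, one below 1 those
      that are too early.\<close>
    define \<sigma> :: real where "\<sigma> = (if real k > l / \<beta> then 1 else - 1)"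
    have \<sigma>: "\<sigma> = 1 \<or> \<sigma> = - 1" by (auto simp: \<sigma>_def)
    have expo: "\<sigma> * l + k * (- \<sigma> * \<beta> + 2 * \<eta>) \<le> - l * \<delta> * \<beta> / 2"
    proof (cases "real k > l / \<beta>")
      case True
      then have k: "real k \<ge> (1 / \<beta> + \<delta>) * l" using dev by (simp add: l_def[symmetric] algebra_simps)
      have "2 * \<eta> * (1 / \<beta> + \<delta>) \<ge> 2 * \<eta> * \<delta>" using \<beta> \<eta> by (intro mult_left_mono) auto
      then have "\<delta> * (2 * \<eta>) \<le> \<delta> * (\<beta> / 2)" unfolding \<eta>_eq by (simp add: mult_ac)
      then have "2 * \<eta> < \<beta>" using \<delta> \<beta> by simp
      then have "(1 / \<beta> + \<delta>) * l * (\<beta> - 2 * \<eta>) \<le> k * (\<beta> - 2 * \<eta>)"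
        using k by (intro mult_right_mono) auto
      moreover have "(1 / \<beta> + \<delta>) * l * (\<beta> - 2 * \<eta>) = l + l * (\<delta> * \<beta>) - l * (2 * \<eta> * (1 / \<beta> + \<delta>))"
        using \<beta> by (simp add: algebra_simps)
      ultimately show ?thesis using True unfolding \<eta>_eq by (simp add: \<sigma>_def algebra_simps)
    next
      case False
      then have k: "real k \<le> (1 / \<beta> - \<delta>) * l" using dev by (simp add: l_def[symmetric] algebra_simps)
      then have "k * (\<beta> + 2 * \<eta>) \<le> (1 / \<beta> - \<delta>) * l * (\<beta> + 2 * \<eta>)"
        using \<beta> \<eta> by (intro mult_right_mono) auto
      also have "\<dots> \<le> l - l * (\<delta> * \<beta>) + l * (2 * \<eta> * (1 / \<beta> + \<delta>))"
        using \<beta> \<delta> \<eta> l by (simp add: algebra_simps)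
      finally show ?thesis using False unfolding \<eta>_eq by (simp add: \<sigma>_def algebra_simps)
    qed
    have mom: "moment (1 + \<sigma> * h) ^ k \<le> exp (- \<sigma> * h * \<beta> + h * \<eta>) ^ k"
    proof (rule power_mono[OF _ moment_nonneg])
      have "moment (1 + \<sigma> * h) \<le> exp (- (\<sigma> * h) * mean_log + 8 * CARD('b) * (\<sigma> * h)\<^sup>2)"
        using h \<sigma> by (intro moment_le_exp) auto
      also have "\<dots> \<le> exp (- \<sigma> * h * \<beta> + h * \<eta>)"
      proof -
        have "8 * c * h * h \<le> \<eta> * h" using h by (intro mult_right_mono) auto
        moreover have "(\<sigma> * h)\<^sup>2 = h * h" using \<sigma> by (auto simp: power2_eq_square)
        ultimately show ?thesis by (simp add: \<beta>_def[symmetric] c_def mult_ac)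
      qed
      finally show "moment (1 + \<sigma> * h) \<le> exp (- \<sigma> * h * \<beta> + h * \<eta>)" .
    qed
    have "1 / (c * real n) > 0" using c n by simp
    moreover have "1 + \<sigma> * h > 0" using \<sigma> h by auto
    ultimately have "(\<integral>\<^sup>+d. (\<Sum>v\<in>generation k. indicator {1 / (c * real n)..} (mass 1 d v)) \<partial>splits)
      \<le> ennreal ((1 / (c * real n)) powr (- (1 + \<sigma> * h)) * moment (1 + \<sigma> * h) ^ k)"
      by (intro nn_integral_generation_count_le)
    also have "\<dots> \<le> ennreal (c ^ 2 * n powr (1 - \<gamma>) * exp (- (h * \<eta>) * k))"
    proof (rule ennreal_leI)
      have "(1 / (c * real n)) powr (- (1 + \<sigma> * h)) = (c * real n) powr (1 + \<sigma> * h)"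
      proof -
        have inv: "(1 / x) powr (- s) = x powr s" if "x > 0" for x s :: real
          using that powr_divide[of 1 x "- s"] powr_minus_divide[of x s] by simp
        show ?thesis by (rule inv) (use c n in simp)
      qed
      also have "\<dots> = c powr (1 + \<sigma> * h) * exp (l * (1 + \<sigma> * h))"
        by (simp only: powr_mult n_powr)
      also have "\<dots> \<le> c powr 2 * exp (l * (1 + \<sigma> * h))"
        using c \<sigma> h by (intro mult_right_mono powr_mono) auto
      finally have 1: "(1 / (c * real n)) powr (- (1 + \<sigma> * h)) \<le> c ^ 2 * exp (l * (1 + \<sigma> * h))"
        using c by simp
      have "(1 / (c * real n)) powr (- (1 + \<sigma> * h)) * moment (1 + \<sigma> * h) ^ k
          \<le> (c ^ 2 * exp (l * (1 + \<sigma> * h))) * exp (- \<sigma> * h * \<beta> + h * \<eta>) ^ k"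
        by (intro mult_mono 1 mom) (auto simp: moment_nonneg)
      also have "\<dots> = c ^ 2 * exp (l + h * (\<sigma> * l + k * (- \<sigma> * \<beta> + 2 * \<eta>)) - h * \<eta> * k)"
      proof -
        have "exp (l * (1 + \<sigma> * h)) * exp (- \<sigma> * h * \<beta> + h * \<eta>) ^ k
            = exp (l * (1 + \<sigma> * h) + real k * (- \<sigma> * h * \<beta> + h * \<eta>))"
          by (simp only: exp_of_nat_mult exp_add)
        also have "l * (1 + \<sigma> * h) + real k * (- \<sigma> * h * \<beta> + h * \<eta>)
            = l + h * (\<sigma> * l + k * (- \<sigma> * \<beta> + 2 * \<eta>)) - h * \<eta> * k"
          by (simp add: algebra_simps)
        finally show ?thesis by (simp only: mult.assoc)
      qed
      also have "\<dots> \<le> c ^ 2 * exp (l + h * (- l * \<delta> * \<beta> / 2) - h * \<eta> * k)"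
        using expo h by (intro mult_left_mono iffD2[OF exp_le_cancel_iff] diff_right_mono add_left_mono) auto
      also have "\<dots> = c ^ 2 * n powr (1 - \<gamma>) * exp (- (h * \<eta>) * k)"
      proof -
        have "exp (l + h * (- l * \<delta> * \<beta> / 2) - h * \<eta> * k) = exp ((1 - \<gamma>) * l + - (h * \<eta>) * k)"
          by (rule arg_cong[where f = exp]) (simp add: \<gamma>_def algebra_simps)
        also have "\<dots> = n powr (1 - \<gamma>) * exp (- (h * \<eta>) * k)"
          by (simp only: exp_add n_powr mult.commute)
        finally show ?thesis by (simp only: mult.assoc)
      qed
      finally show "(1 / (c * real n)) powr (- (1 + \<sigma> * h)) * moment (1 + \<sigma> * h) ^ k
        \<le> c ^ 2 * n powr (1 - \<gamma>) * exp (- (h * \<eta>) * k)" .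
    qed
    finally show ?thesis .
  qed
  show ?thesis
  proof (rule that[of "h * \<eta>" \<gamma>])
    show "(\<integral>\<^sup>+d. (\<Sum>v\<in>generation k. indicator {1 / (CARD('b) * real n)..} (mass 1 d v)) \<partial>splits)
      \<le> ennreal (real CARD('b) ^ 2 * n powr (1 - \<gamma>) * exp (- (h * \<eta>) * k))"
      if "n \<ge> 1" "\<bar>real k - ln n / mean_log\<bar> > \<delta> * ln n" for n k :: nat
      using main[OF that(1), of k] that(2) by (simp add: c_def \<beta>_def)
  qed (use h \<eta> \<gamma> in auto)
qed

text \<open>The predicate \<open>P\<close> selects heights. With \<open>P\<close> constantly true
  this counts all vertices of mass at least \<open>y\<close> and is infinite if there are infinitely
  many.\<close>

definition outliers :: "real \<Rightarrow> (nat \<Rightarrow> bool) \<Rightarrow> ('b list \<Rightarrow> real ^ 'b) \<Rightarrow> ennreal" where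
  "outliers y P d = (\<Sum>k. if P k then \<Sum>v\<in>generation k. indicator {y..} (mass 1 d v) else 0)"

lemma measurable_outliers [measurable]: "outliers y P \<in> borel_measurable splits"
  unfolding outliers_def by measurable

text \<open>The decay in \<open>k\<close> of the deviation bound makes it summable over all
  generations, so that no cut-off in height is required.\<close>

lemma outliers_negligible:
  assumes \<delta>: "\<delta> > 0"
  obtains C \<gamma> where "C \<ge> 0" "\<gamma> > 0" "\<And>n :: nat. n \<ge> 1 \<Longrightarrow>
    (\<integral>\<^sup>+d. outliers (1 / (CARD('b) * real n)) (\<lambda>k. \<bar>real k - ln n / mean_log\<bar> > \<delta> * ln n) d \<partial>splits)
    \<le> ennreal (C * n powr (1 - \<gamma>))"
proof -
  obtain a \<gamma> where a: "a > 0" "\<gamma> > 0" and le: "\<And>(n :: nat) k. n \<ge> 1 \<Longrightarrow> \<bar>real k - ln n / mean_log\<bar> > \<delta> * ln n \<Longrightarrow>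
    (\<integral>\<^sup>+d. (\<Sum>v\<in>generation k. indicator {1 / (CARD('b) * real n)..} (mass 1 d v)) \<partial>splits)
    \<le> ennreal (real CARD('b) ^ 2 * n powr (1 - \<gamma>) * exp (- a * k))"
    using generation_count_deviation[OF \<delta>] by blast
  define q where "q = exp (- a)"
  have q: "0 < q" "q < 1" using a by (auto simp: q_def)
  show ?thesis
  proof (rule that[of "real CARD('b) ^ 2 / (1 - q)" \<gamma>])
    fix n :: nat assume n: "n \<ge> 1"
    define P where "P k \<longleftrightarrow> \<bar>real k - ln n / mean_log\<bar> > \<delta> * ln n" for k :: nat
    have "(\<integral>\<^sup>+d. outliers (1 / (CARD('b) * real n)) P d \<partial>splits)
      = (\<Sum>k. \<integral>\<^sup>+d. (if P k then \<Sum>v\<in>generation k. indicator {1 / (CARD('b) * real n)..} (mass 1 d v) else 0) \<partial>splits)"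
      unfolding outliers_def by (rule nn_integral_suminf) measurable
    also have "\<dots> \<le> (\<Sum>k. ennreal (real CARD('b) ^ 2 * n powr (1 - \<gamma>) * q ^ k))"
    proof (intro suminf_le summableI)
      fix k
      show "(\<integral>\<^sup>+d. (if P k then \<Sum>v\<in>generation k. indicator {1 / (CARD('b) * real n)..} (mass 1 d v) else 0) \<partial>splits)
        \<le> ennreal (real CARD('b) ^ 2 * n powr (1 - \<gamma>) * q ^ k)"
      proof (cases "P k")
        case True
        have "q ^ k = exp (- a * k)" by (simp add: q_def exp_of_nat_mult[symmetric] mult.commute)
        then show ?thesis using le[OF n, of k] True by (simp only: P_def if_True)
      qed simp
    qed
    also have "\<dots> = ennreal (\<Sum>k. real CARD('b) ^ 2 * n powr (1 - \<gamma>) * q ^ k)"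
      using q by (intro suminf_ennreal2 summable_mult summable_geometric) auto
    also have "(\<Sum>k. real CARD('b) ^ 2 * n powr (1 - \<gamma>) * q ^ k) = real CARD('b) ^ 2 / (1 - q) * n powr (1 - \<gamma>)"
      using q by (simp add: suminf_mult summable_geometric suminf_geometric)
    finally show "(\<integral>\<^sup>+d. outliers (1 / (CARD('b) * real n)) (\<lambda>k. \<bar>real k - ln n / mean_log\<bar> > \<delta> * ln n) d \<partial>splits)
      \<le> ennreal (real CARD('b) ^ 2 / (1 - q) * n powr (1 - \<gamma>))" unfolding P_def .
  qed (use a q in auto)
qed

text \<open>The expected number is dominated by a geometric series with ratio
  \<open>moment 2\<close>, which is below 1.\<close>

lemma AE_finite_heavy:
  assumes "y > 0"
  shows "AE d in splits. finite {v. y \<le> mass 1 d v}"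
proof -
  have "(\<integral>\<^sup>+d. outliers y (\<lambda>_. True) d \<partial>splits)
      = (\<Sum>k. \<integral>\<^sup>+d. (\<Sum>v\<in>generation k. indicator {y..} (mass 1 d v)) \<partial>splits)"
    unfolding outliers_def if_True by (rule nn_integral_suminf) measurable
  also have "\<dots> \<le> (\<Sum>k. ennreal (y powr (- 2) * moment 2 ^ k))"
    using assms by (intro suminf_le summableI nn_integral_generation_count_le) auto
  also have "\<dots> = ennreal (\<Sum>k. y powr (- 2) * moment 2 ^ k)"
    using moment_nonneg[of 2] moment_less_one[of 2]
    by (intro suminf_ennreal2 summable_mult summable_geometric) auto
  also have "\<dots> < \<infinity>" by simp
  finally have "AE d in splits. outliers y (\<lambda>_. True) d \<noteq> \<infinity>"
    by (intro nn_integral_noteq_infinite) auto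
  then show ?thesis
  proof eventually_elim
    case (elim d)
    define S where "S = {v. y \<le> mass 1 d v}"
    obtain N where N: "outliers y (\<lambda>_. True) d \<le> of_nat N"
      using elim by (metis ennreal_Ex_less_of_nat infinity_ennreal_def less_imp_le top.not_eq_extremum)
    have "card F \<le> N" if F: "F \<subseteq> S" "finite F" for F
    proof -
      obtain L where L: "\<And>v. v \<in> F \<Longrightarrow> length v < L"
        using F(2) by (meson finite_imageI finite_nat_set_iff_bounded imageI)
      have "of_nat (card F) = (\<Sum>v\<in>F. indicator {y..} (mass 1 d v) :: ennreal)"
        using F by (subst sum.cong[of _ _ _ "\<lambda>_. 1"]) (auto simp: S_def)
      also have "\<dots> \<le> (\<Sum>v\<in>words L. indicator {y..} (mass 1 d v))"
        using L by (intro sum_mono2) (auto simp: words_def finite_words[unfolded words_def])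
      also have "\<dots> \<le> outliers y (\<lambda>_. True) d"
        unfolding sum_words outliers_def if_True by (intro sum_le_suminf summableI) auto
      finally show ?thesis using N by (metis of_nat_le_iff order_trans)
    qed
    then show ?case unfolding S_def[symmetric] using finite_if_finite_subsets_card_bdd by blast
  qed
qed

end

section \<open>Trees of a single realization\<close>

definition heavy :: "real \<Rightarrow> ('b list \<Rightarrow> real ^ 'b) \<Rightarrow> 'b list set" where
  "heavy y d = {v. y \<le> mass 1 d v}"

text \<open>The root mass cancels in birth times, and vertices of mass 0 are excluded on the right
  because \<open>exp (- t)\<close> is positive.\<close>

lemma tree_at_eq_heavy:
  assumes "x\<^sub>0 > 0"
  shows "tree_at x\<^sub>0 d t = heavy (exp (- t)) d"
proof -
  have "mass x\<^sub>0 d v > 0 \<and> birth_time x\<^sub>0 d v \<le> t \<longleftrightarrow> exp (- t) \<le> mass 1 d v" for v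
  proof -
    have m: "mass x\<^sub>0 d v = x\<^sub>0 * mass 1 d v" by (rule mass_scale)
    show ?thesis
    proof (cases "mass 1 d v > 0")
      case True
      then have "birth_time x\<^sub>0 d v = - ln (mass 1 d v)"
        using assms by (simp add: birth_time_def m ln_div)
      moreover have "exp (- t) \<le> mass 1 d v \<longleftrightarrow> - t \<le> ln (mass 1 d v)"
        using True by (rule ln_ge_iff[symmetric])
      ultimately show ?thesis using True assms by (auto simp: m)
    next
      case False
      have "exp (- t) > 0" by simp
      then show ?thesis using False assms by (auto simp: m zero_less_mult_iff simp del: exp_gt_zero)
    qed
  qed
  then show ?thesis by (simp add: tree_at_def heavy_def)
qed

lemma heavy_suffix:
  assumes "conservative d" "suffix u v" "v \<in> heavy y d"
  shows "u \<in> heavy y d"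
proof -
  obtain w where "v = w @ u" using assms(2) by (auto simp: suffix_def)
  then show ?thesis using mass_append_le[OF assms(1), of w u] assms(3) by (simp add: heavy_def)
qed

text \<open>The vertices just outside the tree carry the total mass 1, each of them less than \<open>y\<close>.\<close>

lemma card_heavy_ge:
  fixes d :: "'b::finite list \<Rightarrow> real ^ 'b" and y :: real
  assumes d: "conservative d" and y: "0 < y" "y \<le> 1" and fin: "finite (heavy y d)"
  shows "1 / (CARD('b) * y) \<le> card (heavy y d)"
proof -
  define S where "S = heavy y d"
  define C where "C = (\<lambda>(v, i). i # v) ` (S \<times> (UNIV :: 'b set))"
  have S: "finite S" "[] \<in> S" using fin y by (auto simp: S_def heavy_def)
  have C: "finite C" using S by (simp add: C_def)
  have inj: "inj_on (\<lambda>(v, i). i # v) (S \<times> (UNIV :: 'b set))" by (auto simp: inj_on_def)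
  have sub: "S - {[]} \<subseteq> C"
  proof
    fix u assume u: "u \<in> S - {[]}"
    then obtain i v where iv: "u = i # v" by (cases u) auto
    then have "v \<in> S" using heavy_suffix[OF d, of v u y] u by (auto simp: S_def suffix_def)
    then show "u \<in> C" using iv by (auto simp: C_def image_iff)
  qed
  \<comment> \<open>The vertices of \<open>S\<close> have the same total mass as their children. All
    of \<open>S\<close> but the root is among these children; cancelling it leaves the boundary
    \<open>C - S\<close> with total mass 1.\<close>
  have "(\<Sum>v\<in>S. mass 1 d v) = (\<Sum>v\<in>S. \<Sum>i\<in>UNIV. mass 1 d (i # v))"
    using d by (simp add: sum_distrib_left[symmetric] conservative_def)
  also have "\<dots> = (\<Sum>u\<in>C. mass 1 d u)"
    unfolding C_def sum.cartesian_product by (subst sum.reindex[OF inj]) (simp add: split_beta)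
  also have "\<dots> = (\<Sum>u\<in>S - {[]}. mass 1 d u) + (\<Sum>u\<in>C - (S - {[]}). mass 1 d u)"
    using sum.subset_diff[OF sub C, of "mass 1 d"] by (simp add: add.commute)
  also have "C - (S - {[]}) = C - S" by (auto simp: C_def)
  also have "(\<Sum>v\<in>S. mass 1 d v) = mass 1 d [] + (\<Sum>u\<in>S - {[]}. mass 1 d u)"
    using S by (rule sum.remove)
  finally have "1 = (\<Sum>u\<in>C - S. mass 1 d u)" by simp
  also have "\<dots> \<le> (\<Sum>u\<in>C - S. y)" by (intro sum_mono) (auto simp: S_def heavy_def)
  also have "\<dots> = card (C - S) * y" by simp
  also have "\<dots> \<le> (CARD('b) * card S) * y"
  proof -
    have "card (C - S) \<le> card C" using C by (intro card_mono) auto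
    also have "\<dots> = CARD('b) * card S" unfolding C_def by (simp add: card_image[OF inj] card_cartesian_product mult.commute)
    finally show ?thesis using y by (intro mult_right_mono) (auto simp flip: of_nat_mult)
  qed
  finally show ?thesis using y by (simp add: S_def divide_le_eq mult_ac)
qed

text \<open>Here \<open>y\<close> is \<open>exp\<close> of minus the hitting time. The infimum is
  attained because only finitely many masses lie above the deterministic level; and fewer than
  \<open>n\<close> vertices are strictly heavier than \<open>y\<close>, for otherwise
  \<open>n\<close> vertices would have been reached earlier. So the excess over \<open>n\<close> is
  due to vertices of mass exactly \<open>y\<close>.\<close>

lemma frag_tree_bounds:
  fixes d :: "'b::finite list \<Rightarrow> real ^ 'b"
  assumes d: "conservative d" and n: "n \<ge> 1" and x0: "x\<^sub>0 > 0"
    and fin: "finite (heavy (1 / (CARD('b) * real n)) d)"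
  obtains y where "1 / (CARD('b) * real n) \<le> y" "frag_tree x\<^sub>0 d n = heavy y d"
    "n \<le> card (heavy y d)" "card {v \<in> heavy y d. mass 1 d v \<noteq> y} < n"
proof -
  define y0 where "y0 = 1 / (CARD('b) * real n)"
  define A where "A = {t. 0 \<le> t \<and> (infinite (heavy (exp (- t)) d) \<or> n \<le> card (heavy (exp (- t)) d))}"
  define \<tau> where "\<tau> = Inf A"
  have \<tau>_eq: "hitting_time x\<^sub>0 d n = \<tau>"
    by (simp add: hitting_time_def \<tau>_def A_def tree_at_eq_heavy[OF x0])
  have "1 * 1 \<le> CARD('b) * n" by (rule mult_mono) (use n in \<open>auto simp: Suc_le_eq\<close>)
  then have bn: "real CARD('b) * real n \<ge> 1" by (simp flip: of_nat_mult)
  then have y0: "0 < y0" "y0 \<le> 1" by (auto simp: y0_def)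
  define t0 where "t0 = - ln y0"
  have t0: "t0 \<ge> 0" "exp (- t0) = y0" using y0 by (auto simp: t0_def)
  have fin': "finite (heavy z d)" if "y0 \<le> z" for z
    by (rule finite_subset[OF _ fin]) (use that in \<open>auto simp: heavy_def y0_def\<close>)
  have card_y0: "n \<le> card (heavy y0 d)"
  proof -
    have "1 / (CARD('b) * y0) \<le> card (heavy y0 d)" using card_heavy_ge[OF d y0] fin' by simp
    then show ?thesis by (simp add: y0_def)
  qed
  then have t0A: "t0 \<in> A" using t0 by (simp add: A_def)
  have bdd: "bdd_below A" by (intro bdd_belowI[of _ 0]) (auto simp: A_def)
  have \<tau>: "0 \<le> \<tau>" "\<tau> \<le> t0"
    using t0A bdd unfolding \<tau>_def by (auto intro!: cInf_greatest cInf_lower simp: A_def)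
  define y where "y = exp (- \<tau>)"
  have y: "y0 \<le> y" using \<tau> t0 by (simp add: y_def flip: t0(2))
  have card_ge: "n \<le> card (heavy y d)"
  proof (rule ccontr)
    assume "\<not> ?thesis"
    then have less: "card (heavy y d) < n" by simp
    \<comment> \<open>Between \<tau> and the birth of the heaviest vertex of \<open>D\<close> the
      tree does not grow, so a size below \<open>n\<close> at time \<tau> would push the infimum up
      to that birth.\<close>
    define D where "D = heavy y0 d - heavy y d"
    have "D \<noteq> {}"
    proof
      assume "D = {}"
      then have "heavy y0 d \<subseteq> heavy y d" by (auto simp: D_def)
      then have "card (heavy y0 d) \<le> card (heavy y d)" using fin' y by (intro card_mono) auto
      then show False using card_y0 less by simp
    qed
    moreover have finD: "finite D" using fin' by (simp add: D_def)
    ultimately have "Max (mass 1 d ` D) \<in> mass 1 d ` D" by (intro Max_in) auto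
    then obtain v where v: "v \<in> D" "Max (mass 1 d ` D) = mass 1 d v" by blast
    have v_max: "mass 1 d u \<le> mass 1 d v" if "u \<in> D" for u
      unfolding v(2)[symmetric] using that finD by (intro Max_ge) auto
    define m where "m = mass 1 d v"
    have m: "y0 \<le> m" "m < y" using v(1) by (auto simp: D_def heavy_def m_def)
    have "- ln m \<le> t" if t: "t \<in> A" for t
    proof (rule ccontr)
      assume "\<not> ?thesis"
      then have "exp (- t) > exp (ln m)" by simp
      then have gt: "exp (- t) > m" using m y0 by simp
      have "heavy (exp (- t)) d \<subseteq> heavy y d"
      proof
        fix u assume "u \<in> heavy (exp (- t)) d"
        then have u: "m < mass 1 d u" using gt by (simp add: heavy_def)
        then have "u \<notin> D" using v_max[of u] by (auto simp: m_def)
        moreover have "u \<in> heavy y0 d" using u m by (simp add: heavy_def)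
        ultimately show "u \<in> heavy y d" by (simp add: D_def)
      qed
      then have "finite (heavy (exp (- t)) d)" "card (heavy (exp (- t)) d) \<le> card (heavy y d)"
        using fin'[OF y] by (auto intro: finite_subset card_mono)
      then show False using t less by (auto simp: A_def)
    qed
    then have "- ln m \<le> \<tau>" unfolding \<tau>_def using t0A by (intro cInf_greatest) auto
    then have "exp (- \<tau>) \<le> exp (ln m)" by simp
    then show False using m y0 by (simp add: y_def)
  qed
  have card_less: "card {v \<in> heavy y d. mass 1 d v \<noteq> y} < n"
  proof (rule ccontr)
    assume neg: "\<not> ?thesis"
    \<comment> \<open>Let \<open>m\<close> be the least mass in \<open>D\<close>. The tree at time
      \<open>- ln m\<close> already contains \<open>D\<close>, and this time is nonnegative, as the
      set in the infimum demands, since \<open>m \<le> 1\<close>.\<close>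
    define D where "D = {v \<in> heavy y d. mass 1 d v \<noteq> y}"
    have D: "n \<le> card D" using neg by (simp add: D_def)
    then have "D \<noteq> {}" using n by auto
    moreover have finD: "finite D" using fin'[OF y] by (simp add: D_def)
    ultimately have "Min (mass 1 d ` D) \<in> mass 1 d ` D" by (intro Min_in) auto
    then obtain v where v: "v \<in> D" "Min (mass 1 d ` D) = mass 1 d v" by blast
    have v_min: "mass 1 d v \<le> mass 1 d u" if "u \<in> D" for u
      unfolding v(2)[symmetric] using that finD by (intro Min_le) auto
    define m where "m = mass 1 d v"
    have m: "y < m" "m \<le> 1" using v(1) mass_le_1[OF d] by (auto simp: D_def heavy_def m_def)
    then have m0: "m > 0" using y y0 by simp
    have "D \<subseteq> heavy m d" using v_min by (auto simp: heavy_def m_def)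
    then have "n \<le> card (heavy m d)"
      using D card_mono[of "heavy m d" D] fin'[of m] y m by simp
    then have "- ln m \<in> A" using m m0 by (simp add: A_def)
    then have "\<tau> \<le> - ln m" unfolding \<tau>_def using bdd by (rule cInf_lower)
    then have "exp (ln m) \<le> exp (- \<tau>)" by simp
    then show False using m m0 by (simp add: y_def)
  qed
  show ?thesis
    by (rule that[OF _ _ card_ge card_less])
      (use y in \<open>auto simp: y0_def y_def frag_tree_def \<tau>_eq tree_at_eq_heavy[OF x0]\<close>)
qed

text \<open>A walk along kept edges, in either direction, preserves the right-hand side because each
  word has a single path to the root. Connectivity becomes, for each \<open>v\<close>, a finite
  conjunction, which serves both measurability and independence.\<close>

lemma root_cluster_eq:
  "cluster S k [] = {v. (\<forall>s. suffix s v \<longrightarrow> s \<in> S) \<and> (\<forall>s. s \<noteq> [] \<and> suffix s v \<longrightarrow> k s)}"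
proof (intro set_eqI iffI)
  fix v assume v: "v \<in> cluster S k []"
  then have "([], v) \<in> (kept_edges S k \<union> (kept_edges S k)\<inverse>)\<^sup>*" by (simp add: cluster_def)
  then have "v = [] \<or> (\<forall>s. suffix s v \<longrightarrow> s \<in> S) \<and> (\<forall>s. s \<noteq> [] \<and> suffix s v \<longrightarrow> k s)"
    by (induction rule: rtrancl_induct) (auto simp: kept_edges_def suffix_Cons)
  then show "v \<in> {v. (\<forall>s. suffix s v \<longrightarrow> s \<in> S) \<and> (\<forall>s. s \<noteq> [] \<and> suffix s v \<longrightarrow> k s)}"
    using v by (auto simp: cluster_def)
next
  fix v assume "v \<in> {v. (\<forall>s. suffix s v \<longrightarrow> s \<in> S) \<and> (\<forall>s. s \<noteq> [] \<and> suffix s v \<longrightarrow> k s)}"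
  then show "v \<in> cluster S k []"
  proof (induction v)
    case (Cons i v)
    then have "v \<in> cluster S k []" by (auto simp: suffix_Cons)
    moreover have "(v, i # v) \<in> kept_edges S k"
      using Cons.prems by (auto simp: kept_edges_def suffix_Cons)
    ultimately show ?case using Cons.prems
      by (auto simp: cluster_def suffix_Cons intro: rtrancl_into_rtrancl)
  qed (auto simp: cluster_def)
qed

section \<open>Measurability of cardinalities and of the tree\<close>

lemma infinite_or_le_card_iff: "infinite S \<or> n \<le> card S \<longleftrightarrow> (\<exists>F. finite F \<and> card F = n \<and> F \<subseteq> S)"
  by (metis card_mono infinite_arbitrarily_large obtain_subset_with_card_n finite_subset)

lemma measurable_infinite_or_le_card:
  fixes S :: "'a \<Rightarrow> 'v::countable set"
  assumes "\<And>v. {\<omega>\<in>space N. v \<in> S \<omega>} \<in> sets N"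
  shows "{\<omega>\<in>space N. infinite (S \<omega>) \<or> n \<le> card (S \<omega>)} \<in> sets N"
proof -
  have "countable {F :: 'v set. finite F \<and> card F = n}"
    by (rule countable_subset[OF _ countable_Collect_finite]) auto
  then have "(\<Union>F\<in>{F. finite F \<and> card F = n}. {\<omega>\<in>space N. \<forall>v\<in>F. v \<in> S \<omega>}) \<in> sets N"
    using assms by (intro sets.countable_UN' sets.sets_Collect_finite_All') auto
  also have "(\<Union>F\<in>{F. finite F \<and> card F = n}. {\<omega>\<in>space N. \<forall>v\<in>F. v \<in> S \<omega>})
      = {\<omega>\<in>space N. infinite (S \<omega>) \<or> n \<le> card (S \<omega>)}"
    unfolding infinite_or_le_card_iff by blast
  finally show ?thesis .
qed

lemma measurable_card:
  fixes S :: "'a \<Rightarrow> 'v::countable set"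
  assumes "\<And>v. {\<omega>\<in>space N. v \<in> S \<omega>} \<in> sets N"
  shows "(\<lambda>\<omega>. card (S \<omega>)) \<in> measurable N (count_space UNIV)"
proof -
  note m = measurable_infinite_or_le_card[OF assms]
  have inf: "{\<omega>\<in>space N. infinite (S \<omega>)} \<in> sets N"
  proof -
    have "{\<omega>\<in>space N. \<forall>n. infinite (S \<omega>) \<or> n \<le> card (S \<omega>)} \<in> sets N"
      by (intro sets.sets_Collect_countable_All m)
    moreover have "(\<forall>n. infinite (S \<omega>) \<or> n \<le> card (S \<omega>)) \<longleftrightarrow> infinite (S \<omega>)" for \<omega>
      using not_less_eq_eq by blast
    ultimately show ?thesis by simp
  qed
  have "(\<lambda>\<omega>. card (S \<omega>)) -` {n} \<inter> space N \<in> sets N" for n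
  proof -
    \<comment> \<open>Infinite sets have cardinality 0 and must be added when
      \<open>n = 0\<close>.\<close>
    have "(\<lambda>\<omega>. card (S \<omega>)) -` {n} \<inter> space N =
        ({\<omega>\<in>space N. infinite (S \<omega>) \<or> n \<le> card (S \<omega>)} - {\<omega>\<in>space N. infinite (S \<omega>) \<or> Suc n \<le> card (S \<omega>)})
        \<union> (if n = 0 then {\<omega>\<in>space N. infinite (S \<omega>)} else {})"
      by (auto simp: not_less_eq_eq)
    then show ?thesis using m inf by auto
  qed
  then show ?thesis by (subst measurable_count_space_eq2_countable) auto
qed

text \<open>The size condition is monotone in time, so the event that the hitting time is below
  \<open>a\<close> is a countable union over rational times.\<close>

lemma measurable_frag_tree:
  fixes X :: "'b::finite list \<Rightarrow> 'a \<Rightarrow> real ^ 'b"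
  assumes X [measurable]: "\<And>v. X v \<in> borel_measurable N" and x0: "x\<^sub>0 > 0"
  shows "{\<omega>\<in>space N. v \<in> frag_tree x\<^sub>0 (\<lambda>v. X v \<omega>) n} \<in> sets N"
proof -
  have mass [measurable]: "(\<lambda>\<omega>. mass 1 (\<lambda>v. X v \<omega>) v) \<in> borel_measurable N" for v
  proof (induction v)
    case (Cons i v)
    note [measurable] = this measurable_compose[OF X borel_measurable_nth]
    show ?case unfolding mass.simps by measurable
  qed simp
  define Q where "Q t \<omega> \<longleftrightarrow> infinite (heavy (exp (- t)) (\<lambda>v. X v \<omega>)) \<or> n \<le> card (heavy (exp (- t)) (\<lambda>v. X v \<omega>))" for t \<omega>
  have Q: "{\<omega>\<in>space N. Q t \<omega>} \<in> sets N" for t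
    unfolding Q_def by (rule measurable_infinite_or_le_card) (simp add: heavy_def)
  have Q_mono: "Q t \<omega>" if "Q s \<omega>" "s \<le> t" for s t \<omega>
  proof -
    have "heavy (exp (- s)) (\<lambda>v. X v \<omega>) \<subseteq> heavy (exp (- t)) (\<lambda>v. X v \<omega>)"
      using that(2) by (auto simp: heavy_def intro: order_trans[rotated])
    then show ?thesis using that(1) unfolding Q_def infinite_or_le_card_iff by blast
  qed
  define \<tau> where "\<tau> \<omega> = hitting_time x\<^sub>0 (\<lambda>v. X v \<omega>) n" for \<omega>
  have \<tau>_eq: "\<tau> \<omega> = Inf {t. 0 \<le> t \<and> Q t \<omega>}" for \<omega>
    by (simp add: \<tau>_def hitting_time_def Q_def tree_at_eq_heavy[OF x0])
  have "\<tau> \<in> borel_measurable N"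
    unfolding borel_measurable_iff_less
  proof
    fix a
    \<comment> \<open>If no time qualifies, the infimum is the fixed value \<open>Inf {}\<close>; by
      monotonicity, integer times suffice to detect this case.\<close>
    have eq: "\<tau> \<omega> < a \<longleftrightarrow> (\<exists>q\<in>\<rat>. 0 \<le> q \<and> q < a \<and> Q q \<omega>) \<or> ((\<forall>m::nat. \<not> Q (real m) \<omega>) \<and> Inf {} < a)" for \<omega>
    proof (cases "{t. 0 \<le> t \<and> Q t \<omega>} = {}")
      case True
      then have "\<forall>x\<ge>0. \<not> Q x \<omega>" by auto
      then show ?thesis unfolding \<tau>_eq True by auto
    next
      case False
      then obtain t where t: "0 \<le> t" "Q t \<omega>" by auto
      then have "Q (real (nat \<lceil>t\<rceil>)) \<omega>" by (elim Q_mono) linarith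
      then have ex: "\<not> (\<forall>m::nat. \<not> Q (real m) \<omega>)" by blast
      have bdd: "bdd_below {t. 0 \<le> t \<and> Q t \<omega>}" by (intro bdd_belowI[of _ 0]) auto
      have "\<tau> \<omega> < a \<longleftrightarrow> (\<exists>t. 0 \<le> t \<and> Q t \<omega> \<and> t < a)"
        unfolding \<tau>_eq using False bdd by (subst cInf_less_iff) auto
      also have "\<dots> \<longleftrightarrow> (\<exists>q\<in>\<rat>. 0 \<le> q \<and> q < a \<and> Q q \<omega>)"
      proof
        assume "\<exists>t. 0 \<le> t \<and> Q t \<omega> \<and> t < a"
        then obtain t where t: "0 \<le> t" "Q t \<omega>" "t < a" by auto
        obtain q where "q \<in> \<rat>" "t < q" "q < a" using Rats_dense_in_real[OF t(3)] by auto
        then show "\<exists>q\<in>\<rat>. 0 \<le> q \<and> q < a \<and> Q q \<omega>" using t Q_mono by (intro bexI[of _ q]) auto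
      qed auto
      finally show ?thesis using ex by blast
    qed
    have "{\<omega>\<in>space N. \<exists>q\<in>\<rat>. 0 \<le> q \<and> q < a \<and> Q q \<omega>} \<in> sets N"
    proof -
      have "countable {q \<in> \<rat>. 0 \<le> q \<and> q < a}" by (rule countable_subset[OF _ countable_rat]) auto
      then have "(\<Union>q\<in>{q \<in> \<rat>. 0 \<le> q \<and> q < a}. {\<omega>\<in>space N. Q q \<omega>}) \<in> sets N"
        using Q by (intro sets.countable_UN') auto
      also have "(\<Union>q\<in>{q \<in> \<rat>. 0 \<le> q \<and> q < a}. {\<omega>\<in>space N. Q q \<omega>})
          = {\<omega>\<in>space N. \<exists>q\<in>\<rat>. 0 \<le> q \<and> q < a \<and> Q q \<omega>}" by blast
      finally show ?thesis .
    qed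
    moreover have "{\<omega>\<in>space N. (\<forall>m::nat. \<not> Q (real m) \<omega>) \<and> Inf {} < a} \<in> sets N"
      using Q by (intro sets.sets_Collect_countable_All sets.sets_Collect_conj sets.sets_Collect_neg sets.sets_Collect_const)
    ultimately show "{\<omega>\<in>space N. \<tau> \<omega> < a} \<in> sets N"
      unfolding eq conj_disj_distribL Collect_disj_eq by (rule sets.Un)
  qed
  note [measurable] = this
  have "v \<in> frag_tree x\<^sub>0 (\<lambda>v. X v \<omega>) n \<longleftrightarrow> exp (- \<tau> \<omega>) \<le> mass 1 (\<lambda>v. X v \<omega>) v" for \<omega>
    by (simp add: frag_tree_def \<tau>_def tree_at_eq_heavy[OF x0] heavy_def)
  then show ?thesis by simp
qed

section \<open>Percolation\<close>

text \<open>The edges on the path from the root to \<open>v\<close>, named by their lower ends;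
  \<open>v\<close> itself is included, so there are \<open>length v\<close> of them.\<close>

definition ancestors :: "'b list \<Rightarrow> 'b list set" where
  "ancestors v = {s. s \<noteq> [] \<and> suffix s v}"

lemma ancestors_simps: "ancestors [] = {}" "ancestors (i # v) = insert (i # v) (ancestors v)"
  by (auto simp: ancestors_def suffix_Cons)

lemma finite_ancestors [simp]: "finite (ancestors v)"
  by (induction v) (auto simp: ancestors_simps)

lemma card_ancestors: "card (ancestors v) = length v"
proof (induction v)
  case (Cons i v)
  have "i # v \<notin> ancestors v" by (auto simp: ancestors_def dest: suffix_length_le)
  then show ?case using Cons by (simp add: ancestors_simps)
qed (simp add: ancestors_simps)

lemma Nil_notin_ancestors [simp]: "[] \<notin> ancestors v"
  by (simp add: ancestors_def)

lemma common_ancestors_eq: "common_ancestors u v = ancestors u \<inter> ancestors v"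
  by (auto simp: common_ancestors_def ancestors_def)

text \<open>Given the tree, \<open>v\<close> is joined to the root with probability
  \<open>p ^ length v\<close>, so \<open>Z\<close> is the number of connected vertices in
  \<open>G\<close> minus its conditional mean. Two vertices with \<open>c\<close> shared edges have
  conditional covariance at most \<open>1 - p ^ c\<close>, hence at most
  \<open>(1 - p) * c\<close>.\<close>

lemma (in prob_space) percolation_second_moment:
  fixes A :: "'b list \<Rightarrow> 'a set" and \<kappa> :: "'b list \<Rightarrow> 'a \<Rightarrow> bool"
  assumes p: "0 \<le> p" "p \<le> 1" and G: "finite G"
    and A [measurable]: "\<And>v. A v \<in> events"
    and \<kappa>: "\<And>J. finite J \<Longrightarrow> [] \<notin> J \<Longrightarrow> {\<omega>\<in>space M. \<forall>s\<in>J. \<kappa> s \<omega>} \<in> events"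
    and indep: "\<And>u v J. finite J \<Longrightarrow> [] \<notin> J \<Longrightarrow>
      prob (A u \<inter> A v \<inter> {\<omega>\<in>space M. \<forall>s\<in>J. \<kappa> s \<omega>}) = prob (A u \<inter> A v) * p ^ card J"
  defines "Z \<equiv> \<lambda>\<omega>. \<Sum>v\<in>G. indicator (A v) \<omega> * (indicator {\<omega>\<in>space M. \<forall>s\<in>ancestors v. \<kappa> s \<omega>} \<omega> - p ^ length v)"
  shows "Z \<in> borel_measurable M"
    and "expectation (\<lambda>\<omega>. (Z \<omega>)\<^sup>2)
      \<le> (1 - p) * (\<Sum>u\<in>G. \<Sum>v\<in>G. real (card (common_ancestors u v)) * prob (A u \<inter> A v))"
proof -
  define H where "H J = {\<omega>\<in>space M. \<forall>s\<in>J. \<kappa> s \<omega>}" for J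
  have H [measurable]: "H (ancestors v) \<in> events" "H (ancestors u \<union> ancestors v) \<in> events" for u v
    unfolding H_def by (rule \<kappa>; simp)+
  have Z_eq: "Z = (\<lambda>\<omega>. \<Sum>v\<in>G. indicator (A v) \<omega> * (indicator (H (ancestors v)) \<omega> - p ^ length v))"
    by (simp add: Z_def H_def)
  show "Z \<in> borel_measurable M" unfolding Z_eq by measurable
  define Zs where "Zs v \<omega> = indicator (A v) \<omega> * (indicator (H (ancestors v)) \<omega> - p ^ length v)" for v \<omega>
  have int: "integrable M (indicator B :: 'a \<Rightarrow> real)" if "B \<in> events" for B
    using that by (intro integrable_real_indicator) (auto simp: less_top[symmetric])
  have summand: "expectation (\<lambda>\<omega>. Zs u \<omega> * Zs v \<omega>)
      \<le> (1 - p) * (real (card (common_ancestors u v)) * prob (A u \<inter> A v))"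
    and summand_int: "integrable M (\<lambda>\<omega>. Zs u \<omega> * Zs v \<omega>)" for u v
  proof -
    define E where "E = A u \<inter> A v"
    have E [measurable]: "E \<in> events" by (simp add: E_def)
    define a b c where "a = length u" and "b = length v" and "c = card (common_ancestors u v)"
    have HH: "H (ancestors u) \<inter> H (ancestors v) = H (ancestors u \<union> ancestors v)" by (auto simp: H_def)
    have eq: "Zs u \<omega> * Zs v \<omega>
      = indicator (E \<inter> H (ancestors u \<union> ancestors v)) \<omega> - p ^ a * indicator (E \<inter> H (ancestors v)) \<omega>
        - p ^ b * indicator (E \<inter> H (ancestors u)) \<omega> + p ^ (a + b) * (indicator E \<omega> :: real)" for \<omega>
      unfolding Zs_def E_def HH[symmetric] a_def b_def
      by (auto simp: indicator_inter_arith power_add algebra_simps split: split_indicator)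
    have PE: "prob (E \<inter> H J) = prob E * p ^ card J" if "finite J" "[] \<notin> J" for J
      using indep[OF that] by (simp add: E_def H_def)
    have un: "card (ancestors u \<union> ancestors v) + c = a + b"
      using card_Un_Int[OF finite_ancestors finite_ancestors, of u v]
      by (simp add: a_def b_def c_def card_ancestors common_ancestors_eq)
    show "integrable M (\<lambda>\<omega>. Zs u \<omega> * Zs v \<omega>)"
      unfolding eq by (intro Bochner_Integration.integrable_add Bochner_Integration.integrable_diff
        integrable_mult_right int) measurable
    have "expectation (\<lambda>\<omega>. Zs u \<omega> * Zs v \<omega>)
      = prob (E \<inter> H (ancestors u \<union> ancestors v)) - p ^ a * prob (E \<inter> H (ancestors v))
        - p ^ b * prob (E \<inter> H (ancestors u)) + p ^ (a + b) * prob E"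
    proof -
      have ev: "E \<inter> H (ancestors u \<union> ancestors v) \<in> events" "E \<inter> H (ancestors v) \<in> events"
        "E \<inter> H (ancestors u) \<in> events"
        by (intro sets.Int E H)+
      show ?thesis
        unfolding eq using ev[THEN int] int[OF E]
        by (simp add: sets.Int_space_eq2[OF ev(1)] sets.Int_space_eq2[OF ev(2)]
            sets.Int_space_eq2[OF ev(3)] sets.Int_space_eq2[OF E])
    qed
    also have "\<dots> = prob E * (p ^ card (ancestors u \<union> ancestors v) - p ^ (a + b))"
      by (simp add: PE card_ancestors a_def b_def power_add algebra_simps)
    also have "\<dots> \<le> prob E * ((1 - p) * c)"
    proof (intro mult_left_mono)
      have "p ^ (a + b) = p ^ card (ancestors u \<union> ancestors v) * p ^ c"
        unfolding un[symmetric] by (rule power_add)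
      then have "p ^ card (ancestors u \<union> ancestors v) - p ^ (a + b) = p ^ card (ancestors u \<union> ancestors v) * (1 - p ^ c)"
        by (simp add: algebra_simps)
      also have "\<dots> \<le> 1 * (1 - p ^ c)"
        using p by (intro mult_right_mono) (auto simp: power_le_one)
      \<comment> \<open>Bernoulli's inequality for \<open>1 + (p - 1)\<close>.\<close>
      also have "1 - p ^ c \<le> (1 - p) * c"
        using Bernoulli_inequality[of "p - 1" c] p by (simp add: algebra_simps)
      finally show "p ^ card (ancestors u \<union> ancestors v) - p ^ (a + b) \<le> (1 - p) * c" by simp
    qed simp
    finally show "expectation (\<lambda>\<omega>. Zs u \<omega> * Zs v \<omega>)
      \<le> (1 - p) * (real (card (common_ancestors u v)) * prob (A u \<inter> A v))"
      by (simp add: E_def c_def mult_ac)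
  qed
  have "expectation (\<lambda>\<omega>. (Z \<omega>)\<^sup>2) = (\<Sum>u\<in>G. \<Sum>v\<in>G. expectation (\<lambda>\<omega>. Zs u \<omega> * Zs v \<omega>))"
    unfolding Z_eq Zs_def[symmetric] power2_eq_square sum_product
    by (subst Bochner_Integration.integral_sum, intro Bochner_Integration.integrable_sum summand_int)
      (intro sum.cong refl Bochner_Integration.integral_sum summand_int)
  also have "\<dots> \<le> (\<Sum>u\<in>G. \<Sum>v\<in>G. (1 - p) * (real (card (common_ancestors u v)) * prob (A u \<inter> A v)))"
    by (intro sum_mono summand)
  finally show "expectation (\<lambda>\<omega>. (Z \<omega>)\<^sup>2)
      \<le> (1 - p) * (\<Sum>u\<in>G. \<Sum>v\<in>G. real (card (common_ancestors u v)) * prob (A u \<inter> A v))"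
    by (simp only: sum_distrib_left)
qed

lemma (in dislocation) card_outliers_le:
  assumes "finite (heavy y d)"
  shows "of_nat (card {v \<in> heavy y d. P (length v)}) \<le> outliers y P d"
proof -
  define F where "F = {v \<in> heavy y d. P (length v)}"
  have F: "finite F" using assms by (simp add: F_def)
  obtain L where L: "\<And>v. v \<in> F \<Longrightarrow> length v < L"
    using F by (meson finite_imageI finite_nat_set_iff_bounded imageI)
  have "of_nat (card F) = (\<Sum>v\<in>F. if P (length v) then indicator {y..} (mass 1 d v) else 0 :: ennreal)"
    by (subst sum.cong[of F F _ "\<lambda>_. 1"]) (auto simp: F_def heavy_def)
  also have "\<dots> \<le> (\<Sum>v\<in>words L. if P (length v) then indicator {y..} (mass 1 d v) else 0)"
    by (rule sum_mono2[OF finite_words]) (use L in \<open>auto simp: words_def\<close>)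
  also have "\<dots> = (\<Sum>k<L. if P k then \<Sum>v\<in>generation k. indicator {y..} (mass 1 d v) else 0)"
    unfolding sum_words by (intro sum.cong refl) (auto simp: generation_def)
  also have "\<dots> \<le> outliers y P d"
    unfolding outliers_def by (intro sum_le_suminf summableI) auto
  finally show ?thesis by (simp add: F_def)
qed

text \<open>A pathwise comparison, in which \<open>P\<close> marks the atypical heights.
  \<open>J\<close> is the number of vertices of typical height that have the smallest mass; together
  with the atypical vertices they bound the excess of the tree over \<open>n\<close>. On typical
  heights \<open>p ^ length v\<close> may be replaced by \<open>l\<close>.\<close>

lemma root_cluster_deviation:
  fixes d :: "'b::finite list \<Rightarrow> real ^ 'b" and P :: "nat \<Rightarrow> bool"
  assumes d: "conservative d" and n: "n \<ge> 1" and x0: "x\<^sub>0 > 0"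
    and fin: "finite (heavy y\<^sub>0 d)" and y0: "y\<^sub>0 = 1 / (CARD('b) * real n)"
    and L: "\<And>k. \<not> P k \<Longrightarrow> k < L" and l: "0 \<le> l" "l \<le> 1" and \<eta>: "0 \<le> \<eta>" "\<eta> \<le> 1"
    and p: "\<And>k. \<not> P k \<Longrightarrow> \<bar>p ^ k - l\<bar> \<le> \<eta>"
  obtains J :: nat where
    "of_nat J ^ 2 \<le> tied_pairs L y\<^sub>0 d"
    "\<bar>real (card (cluster (frag_tree x\<^sub>0 d n) \<kappa> [])) - l * n\<bar>
      \<le> \<bar>\<Sum>v\<in>{v. \<not> P (length v)}. indicator (frag_tree x\<^sub>0 d n) v * (indicator {v. \<forall>s\<in>ancestors v. \<kappa> s} v - p ^ length v)\<bar>
        + \<eta> * n + 2 * real J + 4 * real (card {v \<in> heavy y\<^sub>0 d. P (length v)})"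
proof -
  obtain y where y: "y\<^sub>0 \<le> y" "frag_tree x\<^sub>0 d n = heavy y d"
    "n \<le> card (heavy y d)" "card {v \<in> heavy y d. mass 1 d v \<noteq> y} < n"
    using frag_tree_bounds[OF d n x0 fin[unfolded y0]] unfolding y0 by blast
  define T where "T = heavy y d"
  define G where "G = {v :: 'b list. \<not> P (length v)}"
  have G_words: "G \<subseteq> words L" using L by (auto simp: G_def words_def)
  then have finG: "finite G" by (rule finite_subset) simp
  have T_sub: "T \<subseteq> heavy y\<^sub>0 d" using y(1) by (auto simp: T_def heavy_def)
  then have finT: "finite T" using fin by (rule finite_subset)
  define J where "J = card {v \<in> T \<inter> G. mass 1 d v = y}"
  define q where "q = card {v \<in> heavy y\<^sub>0 d. P (length v)}"
  have "T - G \<subseteq> {v \<in> heavy y\<^sub>0 d. P (length v)}" using T_sub by (auto simp: G_def)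
  then have q: "card (T - G) \<le> q" unfolding q_def using fin by (intro card_mono) auto
  have card_T: "card T = card (T \<inter> G) + card (T - G)"
    using card_Un_disjoint[of "T \<inter> G" "T - G"] finT by (auto simp: Int_Diff_Un)
  have card_T_le: "card T \<le> n + J + q"
  proof -
    have "T \<subseteq> {v \<in> T. mass 1 d v \<noteq> y} \<union> ({v \<in> T \<inter> G. mass 1 d v = y} \<union> (T - G))" by auto
    then have "card T \<le> card ({v \<in> T. mass 1 d v \<noteq> y} \<union> ({v \<in> T \<inter> G. mass 1 d v = y} \<union> (T - G)))"
      using finT by (intro card_mono) auto
    also have "\<dots> \<le> card {v \<in> T. mass 1 d v \<noteq> y} + (J + card (T - G))"
      unfolding J_def by (intro order_trans[OF card_Un_le] add_left_mono card_Un_le)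
    finally show ?thesis using y(4) q by (simp add: T_def)
  qed
  have n_le: "n \<le> card T" using y(3) by (simp add: T_def)
  define kept where "kept = {v. \<forall>s\<in>ancestors v. \<kappa> s}"
  have cluster: "cluster T \<kappa> [] = T \<inter> kept"
    unfolding root_cluster_eq kept_def
    using heavy_suffix[OF d] by (auto simp: T_def ancestors_def)
  define Y where "Y = (\<Sum>v\<in>G. indicator T v * (indicator kept v - p ^ length v))"
  have Y_eq: "Y = card (T \<inter> G \<inter> kept) - (\<Sum>v\<in>T \<inter> G. p ^ length v)"
  proof -
    have "Y = (\<Sum>v\<in>T \<inter> G. indicator kept v - p ^ length v)"
      unfolding Y_def using finG by (intro sum.mono_neutral_cong_right) (auto simp: indicator_def)
    also have "\<dots> = (\<Sum>v\<in>T \<inter> G. indicator kept v) - (\<Sum>v\<in>T \<inter> G. p ^ length v)" by (rule sum_subtractf)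
    also have "(\<Sum>v\<in>T \<inter> G. indicator kept v) = real (card (T \<inter> G \<inter> kept))"
      using finT by (simp add: indicator_def sum.If_cases)
    finally show ?thesis .
  qed
  have power_sum: "\<bar>(\<Sum>v\<in>T \<inter> G. p ^ length v) - l * card (T \<inter> G)\<bar> \<le> \<eta> * card (T \<inter> G)"
  proof -
    have "(\<Sum>v\<in>T \<inter> G. p ^ length v) - l * card (T \<inter> G) = (\<Sum>v\<in>T \<inter> G. p ^ length v - l)"
      by (simp add: sum_subtractf mult.commute)
    also have "\<bar>\<dots>\<bar> \<le> (\<Sum>v\<in>T \<inter> G. \<bar>p ^ length v - l\<bar>)" by (rule sum_abs)
    also have "\<dots> \<le> (\<Sum>v\<in>T \<inter> G. \<eta>)" by (intro sum_mono p) (auto simp: G_def)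
    finally show ?thesis by (simp add: mult.commute)
  qed
  have card_cluster: "real (card (T \<inter> kept)) = card (T \<inter> G \<inter> kept) + card ((T - G) \<inter> kept)"
  proof -
    have "T \<inter> kept = (T \<inter> G \<inter> kept) \<union> ((T - G) \<inter> kept)" by auto
    then have "card (T \<inter> kept) = card (T \<inter> G \<inter> kept) + card ((T - G) \<inter> kept)"
      using finT by (metis (no_types, lifting) Diff_disjoint Int_commute Int_left_commute card_Un_disjoint finite_Diff finite_Int inf_bot_right)
    then show ?thesis by simp
  qed
  have "card ((T - G) \<inter> kept) \<le> card (T - G)" using finT by (intro card_mono) auto
  then have out: "real (card ((T - G) \<inter> kept)) \<le> q" using q by simp
  have TG: "\<bar>real (card (T \<inter> G)) - n\<bar> \<le> J + 2 * real q"
    using n_le card_T_le card_T q by simp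
  then have "l * \<bar>real (card (T \<inter> G)) - n\<bar> \<le> 1 * (J + 2 * real q)"
    using l by (intro mult_mono) auto
  then have lTG: "\<bar>l * card (T \<inter> G) - l * n\<bar> \<le> J + 2 * real q"
    using l by (simp add: abs_mult flip: right_diff_distrib)
  have "\<eta> * card (T \<inter> G) \<le> \<eta> * (n + (J + q))"
    using \<eta> card_T_le card_T by (intro mult_left_mono) auto
  also have "\<dots> = \<eta> * n + \<eta> * (J + real q)" by (simp add: distrib_left)
  also have "\<eta> * (J + real q) \<le> 1 * (J + real q)" using \<eta> by (intro mult_right_mono) auto
  finally have \<eta>TG: "\<eta> * card (T \<inter> G) \<le> \<eta> * n + (J + real q)" by simp
  \<comment> \<open>With \<open>q\<close> atypical vertices, the errors are \<open>q\<close> for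
    their part of the cluster, \<open>J + 2 * q\<close> for replacing the size of
    \<open>T \<inter> G\<close> by \<open>n\<close>, and \<open>J + q\<close> beyond
    \<open>\<eta> * n\<close> for replacing powers by \<open>l\<close>.\<close>
  have dev: "\<bar>real (card (T \<inter> kept)) - l * n\<bar> \<le> \<bar>Y\<bar> + \<eta> * n + 2 * real J + 4 * real q"
    using Y_eq power_sum card_cluster out lTG \<eta>TG by linarith
  have ties: "of_nat J ^ 2 \<le> tied_pairs L y\<^sub>0 d"
  proof -
    define S where "S = {v \<in> T \<inter> G. mass 1 d v = y}"
    have S: "S \<subseteq> words L" using G_words by (auto simp: S_def)
    have "of_nat J ^ 2 = (\<Sum>u\<in>S. \<Sum>v\<in>S. (1 :: ennreal))" by (simp add: J_def S_def power2_eq_square)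
    also have "\<dots> = (\<Sum>u\<in>S. \<Sum>v\<in>S. indicator {(a, x). a = x \<and> y\<^sub>0 \<le> a} (mass 1 d v, mass 1 d u))"
      using y(1) by (intro sum.cong refl) (auto simp: S_def)
    also have "\<dots> \<le> tied_pairs L y\<^sub>0 d"
      using S by (intro order_trans[OF sum_mono sum_mono2] sum_mono2) auto
    finally show ?thesis .
  qed
  show ?thesis
    by (rule that[OF ties]) (use dev in \<open>simp add: y(2) T_def[symmetric] cluster Y_def kept_def q_def G_def\<close>)
qed

text \<open>The bounds \<open>1 - p \<le> - ln p \<le> (1 - p) / p\<close> transfer the asymptotics
  to \<open>- ln p\<close>, so \<open>p ^ k = exp (- (k * r))\<close> with \<open>r * ln n\<close>
  close to \<open>c\<close>. The estimate is uniform in \<open>k\<close> because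
  \<open>exp (- x)\<close> is Lipschitz with constant 1 for \<open>x \<ge> 0\<close>.\<close>

lemma power_concentration:
  fixes p :: "nat \<Rightarrow> real"
  assumes c: "c > 0" and \<beta>: "\<beta> > 0" and \<eta>: "\<eta> > 0" and p: "\<And>n. 0 < p n \<and> p n < 1"
    and asymp: "(\<lambda>n. 1 - p n) \<sim>[sequentially] (\<lambda>n. c / ln (real n))"
  obtains \<delta> where "\<delta> > 0"
    "\<forall>\<^sub>F n in sequentially. \<forall>k::nat. \<bar>real k - ln n / \<beta>\<bar> \<le> \<delta> * ln n \<longrightarrow> \<bar>p n ^ k - exp (- c / \<beta>)\<bar> \<le> \<eta>"
proof -
  have ln_top: "filterlim (\<lambda>n. ln (real n)) at_top sequentially"
    by (rule filterlim_compose[OF ln_at_top filterlim_real_sequentially])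
  have "(\<lambda>n. c / ln (real n)) \<longlonglongrightarrow> 0"
    by (rule real_tendsto_divide_at_top[OF tendsto_const ln_top])
  then have q0: "(\<lambda>n. 1 - p n) \<longlonglongrightarrow> 0"
    by (rule asymp_equiv_tendsto_transfer[OF asymp_equiv_symI[OF asymp]])
  then have p1: "p \<longlonglongrightarrow> 1" using tendsto_diff[OF tendsto_const q0, of 1] by simp
  have ev1: "\<forall>\<^sub>F n in sequentially. ln (real n) > 0"
    using ln_top by (simp add: filterlim_at_top_dense)
  have "(\<lambda>n. (1 - p n) / (c / ln (real n))) \<longlonglongrightarrow> 1"
    using ev1 c by (intro asymp_equivD_strong[OF asymp]) (auto elim: eventually_mono)
  then have "(\<lambda>n. c * ((1 - p n) / (c / ln (real n)))) \<longlonglongrightarrow> c * 1" by (intro tendsto_intros)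
  then have ql: "(\<lambda>n. (1 - p n) * ln (real n)) \<longlonglongrightarrow> c" using c by (simp add: mult.commute)
  have "(\<lambda>n. (1 - p n) * ln (real n) / p n) \<longlonglongrightarrow> c / 1" by (intro tendsto_intros ql p1) simp
  then have qlp: "(\<lambda>n. (1 - p n) * ln (real n) / p n) \<longlonglongrightarrow> c" by simp
  have lim: "(\<lambda>n. - ln (p n) * ln (real n)) \<longlonglongrightarrow> c"
  proof (rule tendsto_sandwich[OF _ _ ql qlp])
    show "\<forall>\<^sub>F n in sequentially. (1 - p n) * ln (real n) \<le> - ln (p n) * ln (real n)"
      using ev1
    proof eventually_elim
      case (elim n)
      have "ln (p n) \<le> p n - 1" using p by (intro ln_le_minus_one) auto
      then show ?case using elim by (intro mult_right_mono) auto
    qed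
    show "\<forall>\<^sub>F n in sequentially. - ln (p n) * ln (real n) \<le> (1 - p n) * ln (real n) / p n"
      using ev1
    proof eventually_elim
      case (elim n)
      have "- ln (p n) \<le> 1 / p n - 1"
        using p[of n] ln_le_minus_one[of "1 / p n"] by (simp add: ln_div)
      also have "\<dots> = (1 - p n) / p n" using p[of n] by (simp add: field_simps)
      finally show ?case using elim mult_right_mono[of _ _ "ln (real n)"] by fastforce
    qed
  qed
  \<comment> \<open>The width of the window then contributes
    \<open>\<delta> * c = \<eta> / 2\<close> in the limit, strictly less than \<eta>.\<close>
  define \<delta> where "\<delta> = \<eta> / (2 * c)"
  have \<delta>: "\<delta> > 0" using \<eta> c by (simp add: \<delta>_def)
  have "(\<lambda>n. \<delta> * (- ln (p n) * ln (real n)) + \<bar>- ln (p n) * ln (real n) - c\<bar> / \<beta>) \<longlonglongrightarrow> \<delta> * c + \<bar>c - c\<bar> / \<beta>"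
    by (intro tendsto_intros lim) (use \<beta> in auto)
  then have "\<forall>\<^sub>F n in sequentially. \<delta> * (- ln (p n) * ln (real n)) + \<bar>- ln (p n) * ln (real n) - c\<bar> / \<beta> < \<eta>"
    by (rule order_tendstoD) (use \<eta> c in \<open>simp add: \<delta>_def\<close>)
  then have ev: "\<forall>\<^sub>F n in sequentially. \<forall>k::nat. \<bar>real k - ln n / \<beta>\<bar> \<le> \<delta> * ln n \<longrightarrow> \<bar>p n ^ k - exp (- c / \<beta>)\<bar> \<le> \<eta>"
  proof eventually_elim
    case (elim n)
    define r where "r = - ln (p n)"
    have r: "r \<ge> 0" using p[of n] by (simp add: r_def)
    show ?case
    proof (intro allI impI)
      fix k :: nat assume k: "\<bar>real k - ln n / \<beta>\<bar> \<le> \<delta> * ln n"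
      have pk: "p n ^ k = exp (- (k * r))" using p[of n] by (simp add: r_def exp_of_nat_mult)
      have lip: "\<bar>exp (- a) - exp (- b)\<bar> \<le> \<bar>a - b\<bar>" if "a \<ge> 0" "b \<ge> 0" for a b :: real
      proof -
        have *: "exp (- a) - exp (- b) \<le> b - a" if "0 \<le> a" "a \<le> b" for a b :: real
        proof -
          have "exp (- a) - exp (- b) = exp (- a) * (1 - exp (a - b))" by (simp add: algebra_simps mult_exp_exp)
          also have "\<dots> \<le> 1 * (1 - exp (a - b))" using that by (intro mult_right_mono) auto
          also have "\<dots> = 1 - exp (a - b)" by simp
          also have "\<dots> \<le> 1 - (1 + (a - b))" by (intro diff_left_mono exp_ge_add_one_self)
          finally show ?thesis by simp
        qed
        show ?thesis using *[of a b] *[of b a] that by (cases "a \<le> b") (auto simp: abs_if)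
      qed
      have "\<bar>k * r - c / \<beta>\<bar> = \<bar>r * (k - ln n / \<beta>) + (r * ln n - c) / \<beta>\<bar>"
        by (rule arg_cong[where f = abs]) (simp add: algebra_simps diff_divide_distrib)
      also have "\<dots> \<le> \<bar>r * (k - ln n / \<beta>)\<bar> + \<bar>(r * ln n - c) / \<beta>\<bar>" by (rule abs_triangle_ineq)
      also have "\<dots> = r * \<bar>k - ln n / \<beta>\<bar> + \<bar>r * ln n - c\<bar> / \<beta>" using r \<beta> by (simp add: abs_mult)
      also have "\<dots> \<le> r * (\<delta> * ln n) + \<bar>r * ln n - c\<bar> / \<beta>" using k r by (intro add_mono mult_left_mono) auto
      also have "\<dots> \<le> \<eta>" using elim by (simp add: r_def mult_ac)
      finally have "\<bar>k * r - c / \<beta>\<bar> \<le> \<eta>" .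
      then show "\<bar>p n ^ k - exp (- c / \<beta>)\<bar> \<le> \<eta>"
        using lip[of "k * r" "c / \<beta>"] r c \<beta> unfolding pk by simp
    qed
  qed
  show ?thesis by (rule that[OF \<delta> ev])
qed

section \<open>From expectations to probabilities\<close>

context dislocation begin

lemma distr_splits:
  fixes M :: "'w measure"
  assumes M: "prob_space M" and indep: "prob_space.indep_vars M (\<lambda>_. borel) X UNIV"
    and X: "\<And>v. distr M borel (X v) = \<nu>"
  shows "(\<lambda>\<omega> v. X v \<omega>) \<in> measurable M splits" "distr M splits (\<lambda>\<omega> v. X v \<omega>) = splits"
proof -
  interpret M: prob_space M by fact
  have rv [measurable]: "X v \<in> borel_measurable M" for v
    using indep by (simp add: M.indep_vars_def)
  have "(\<lambda>\<omega> v. X v \<omega>) \<in> measurable M (\<Pi>\<^sub>M v\<in>UNIV. borel)"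
    using measurable_restrict[of UNIV X M "\<lambda>_. borel"] rv by (simp add: restrict_UNIV)
  then show "(\<lambda>\<omega> v. X v \<omega>) \<in> measurable M splits"
    by (simp add: measurable_cong_sets[OF refl sets_splits])
  have "distr M splits (\<lambda>\<omega> v. X v \<omega>) = distr M (\<Pi>\<^sub>M v\<in>UNIV. borel) (\<lambda>\<omega>. \<lambda>v\<in>UNIV. X v \<omega>)"
    by (rule distr_cong) (auto simp: sets_splits)
  also have "\<dots> = (\<Pi>\<^sub>M v\<in>UNIV. distr M borel (X v))"
    using indep by (subst (asm) M.indep_vars_iff_distr_eq_PiM) auto
  also have "\<dots> = splits" by (simp add: X splits_def)
  finally show "distr M splits (\<lambda>\<omega> v. X v \<omega>) = splits" .
qed

text \<open>The deviation \<open>\<epsilon> * n\<close> is split into quarters, one of which covers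
  \<open>\<eta> * n\<close>. The others are bounded by Chebyshev for the percolation fluctuation (16
  is the square of 4), by the second moment for \<open>2 * J\<close> (64 is the square of 8), and by
  Markov for four times the number of outliers.\<close>

lemma cluster_deviation_prob_le:
  fixes M :: "'w measure" and \<kappa> :: "'b list \<Rightarrow> 'w \<Rightarrow> bool"
  assumes M: "prob_space M" and indep: "prob_space.indep_vars M (\<lambda>_. borel) X UNIV"
    and X: "\<And>v. distr M borel (X v) = \<nu>"
    and \<kappa>: "\<And>J. finite J \<Longrightarrow> [] \<notin> J \<Longrightarrow> {\<omega>\<in>space M. \<forall>s\<in>J. \<kappa> s \<omega>} \<in> sets M"
    and \<kappa>X: "\<And>B J. B \<in> sets splits \<Longrightarrow> finite J \<Longrightarrow> [] \<notin> J \<Longrightarrow>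
      measure M ({\<omega>\<in>space M. (\<lambda>v. X v \<omega>) \<in> B} \<inter> {\<omega>\<in>space M. \<forall>s\<in>J. \<kappa> s \<omega>})
        = measure M {\<omega>\<in>space M. (\<lambda>v. X v \<omega>) \<in> B} * p ^ card J"
    and p: "0 \<le> p" "p \<le> 1" and n: "n \<ge> 1" and x0: "x\<^sub>0 > 0" and \<epsilon>: "\<epsilon> > 0"
    and l: "0 \<le> l" "l \<le> 1" and \<eta>: "0 \<le> \<eta>" "\<eta> \<le> 1" "4 * \<eta> \<le> \<epsilon>"
    and L: "\<And>k. \<not> P k \<Longrightarrow> k < L" and power: "\<And>k. \<not> P k \<Longrightarrow> \<bar>p ^ k - l\<bar> \<le> \<eta>"
    and y0: "y\<^sub>0 = 1 / (CARD('b) * real n)" and Kc: "Kc \<ge> 0"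
    and pairs: "(\<integral>\<^sup>+d. common_ancestor_pairs L y\<^sub>0 d \<partial>splits) \<le> ennreal Kc"
    and ties: "(\<integral>\<^sup>+d. tied_pairs L y\<^sub>0 d \<partial>splits)
      \<le> ennreal Kt" and Kt: "Kt \<ge> 0"
    and outl: "(\<integral>\<^sup>+d. outliers y\<^sub>0 P d \<partial>splits) \<le> ennreal Ko" and Ko: "Ko \<ge> 0"
  shows "measure M {\<omega>\<in>space M. \<bar>real (card (cluster (frag_tree x\<^sub>0 (\<lambda>v. X v \<omega>) n) (\<lambda>v. \<kappa> v \<omega>) [])) / n - l\<bar> > \<epsilon>}
    \<le> 16 / (\<epsilon> * n)\<^sup>2 * ((1 - p) * Kc) + 64 / (\<epsilon> * n)\<^sup>2 * Kt + 16 / (\<epsilon> * n) * Ko"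
proof -
  interpret M: prob_space M by fact
  note d_meas [measurable] = distr_splits(1)[OF M indep X]
  note distr = distr_splits(2)[OF M indep X]
  define d where "d \<omega> v = X v \<omega>" for \<omega> v
  have d_meas [measurable]: "d \<in> measurable M splits"
    using d_meas by (simp add: d_def[abs_def])
  have distr: "distr M splits d = splits" using distr by (simp add: d_def[abs_def])
  have rv [measurable]: "X v \<in> borel_measurable M" for v
    using indep by (simp add: M.indep_vars_def)
  have y0_pos: "y\<^sub>0 > 0" using n by (simp add: y0)
  define T where "T \<omega> = frag_tree x\<^sub>0 (d \<omega>) n" for \<omega>
  define G where "G = {v :: 'b list. \<not> P (length v)}"
  have G_words: "G \<subseteq> words L" using L by (auto simp: G_def words_def)
  then have finG: "finite G" by (rule finite_subset) simp
  have AE_good: "AE \<omega> in M. conservative (d \<omega>) \<and> finite (heavy y\<^sub>0 (d \<omega>))"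
  proof -
    have "AE x in splits. conservative x \<and> finite (heavy y\<^sub>0 x)"
      using AE_conservative AE_finite_heavy[OF y0_pos] by eventually_elim (auto simp: heavy_def)
    then have "AE x in distr M splits d. conservative x \<and> finite (heavy y\<^sub>0 x)" by (simp only: distr)
    then show ?thesis by (rule AE_distrD[OF d_meas])
  qed
  have T_sub: "AE \<omega> in M. \<forall>v\<in>T \<omega>. y\<^sub>0 \<le> mass 1 (d \<omega>) v"
    using AE_good
  proof eventually_elim
    case (elim \<omega>)
    then obtain y where "y\<^sub>0 \<le> y" "T \<omega> = heavy y (d \<omega>)"
      using frag_tree_bounds[of "d \<omega>" n x\<^sub>0] n x0 unfolding T_def y0 by metis
    then show ?case by (auto simp: heavy_def)
  qed
  define A where "A v = {\<omega>\<in>space M. v \<in> T \<omega>}" for v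
  \<comment> \<open>Membership in the tree is determined by the splitting vectors, so the
    independence hypothesis on edges can be applied to these events.\<close>
  have A_preimage: "\<exists>B\<in>sets splits. A u \<inter> A v = {\<omega>\<in>space M. d \<omega> \<in> B}" for u v
  proof -
    have m: "{x\<in>space splits. w \<in> frag_tree x\<^sub>0 x n} \<in> sets splits" for w
      by (rule measurable_frag_tree[where X = "\<lambda>v x. x v", OF measurable_split x0])
    show ?thesis
      using m[of u] m[of v]
      by (intro bexI[of _ "{x\<in>space splits. u \<in> frag_tree x\<^sub>0 x n} \<inter> {x\<in>space splits. v \<in> frag_tree x\<^sub>0 x n}"])
        (auto simp: A_def T_def space_splits)
  qed
  have A_sets [measurable]: "A v \<in> sets M" for v
  proof -
    obtain B where B: "B \<in> sets splits" "A v = {\<omega>\<in>space M. d \<omega> \<in> B}" using A_preimage[of v v] by auto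
    then have "A v = d -` B \<inter> space M" by auto
    then show ?thesis using measurable_sets[OF d_meas B(1)] by simp
  qed
  define Y where "Y \<omega> = (\<Sum>v\<in>G. indicator (A v) \<omega> * (indicator {\<omega>\<in>space M. \<forall>s\<in>ancestors v. \<kappa> s \<omega>} \<omega> - p ^ length v))" for \<omega>
  have A_indep: "M.prob (A u \<inter> A v \<inter> {\<omega>\<in>space M. \<forall>s\<in>J. \<kappa> s \<omega>}) = M.prob (A u \<inter> A v) * p ^ card J"
    if "finite J" "[] \<notin> J" for u v J
  proof -
    obtain B where "B \<in> sets splits" "A u \<inter> A v = {\<omega>\<in>space M. d \<omega> \<in> B}" using A_preimage by blast
    then show ?thesis using \<kappa>X[OF _ that, of B] by (simp add: d_def[abs_def])
  qed
  have Y_meas [measurable]: "Y \<in> borel_measurable M"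
    unfolding Y_def by (rule M.percolation_second_moment(1)[OF p finG A_sets \<kappa> A_indep])
  have pair_sum: "(\<Sum>u\<in>G. \<Sum>v\<in>G. real (card (common_ancestors u v)) * M.prob (A u \<inter> A v)) \<le> Kc"
  proof -
    have "ennreal (\<Sum>u\<in>G. \<Sum>v\<in>G. real (card (common_ancestors u v)) * M.prob (A u \<inter> A v))
      = (\<Sum>u\<in>G. \<Sum>v\<in>G. of_nat (card (common_ancestors u v)) * (\<integral>\<^sup>+\<omega>. indicator (A u \<inter> A v) \<omega> \<partial>M))"
    proof -
      have "ennreal (\<Sum>u\<in>G. \<Sum>v\<in>G. real (card (common_ancestors u v)) * M.prob (A u \<inter> A v))
        = (\<Sum>u\<in>G. \<Sum>v\<in>G. ennreal (real (card (common_ancestors u v)) * M.prob (A u \<inter> A v)))"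
        by (simp add: sum_nonneg)
      also have "\<dots> = (\<Sum>u\<in>G. \<Sum>v\<in>G. of_nat (card (common_ancestors u v)) * (\<integral>\<^sup>+\<omega>. indicator (A u \<inter> A v) \<omega> \<partial>M))"
        by (intro sum.cong refl) (simp add: ennreal_mult M.emeasure_eq_measure ennreal_of_nat_eq_real_of_nat)
      finally show ?thesis .
    qed
    also have "\<dots> = (\<integral>\<^sup>+\<omega>. (\<Sum>u\<in>G. \<Sum>v\<in>G. of_nat (card (common_ancestors u v)) * indicator (A u \<inter> A v) \<omega>) \<partial>M)"
      by (simp add: nn_integral_sum nn_integral_cmult)
    also have "\<dots> \<le> (\<integral>\<^sup>+\<omega>. common_ancestor_pairs L y\<^sub>0 (d \<omega>) \<partial>M)"
    proof (rule nn_integral_mono_AE)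
      show "AE \<omega> in M. (\<Sum>u\<in>G. \<Sum>v\<in>G. of_nat (card (common_ancestors u v)) * indicator (A u \<inter> A v) \<omega>)
        \<le> (\<Sum>u\<in>words L. \<Sum>v\<in>words L. of_nat (card (common_ancestors u v)) *
          (indicator {y\<^sub>0..} (mass 1 (d \<omega>) u) * indicator {y\<^sub>0..} (mass 1 (d \<omega>) v)) :: ennreal)"
        using T_sub
      proof eventually_elim
        case (elim \<omega>)
        have "(\<Sum>u\<in>G. \<Sum>v\<in>G. of_nat (card (common_ancestors u v)) * indicator (A u \<inter> A v) \<omega> :: ennreal)
          \<le> (\<Sum>u\<in>G. \<Sum>v\<in>G. of_nat (card (common_ancestors u v)) *
              (indicator {y\<^sub>0..} (mass 1 (d \<omega>) u) * indicator {y\<^sub>0..} (mass 1 (d \<omega>) v)))"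
          using elim by (intro sum_mono mult_left_mono) (auto simp: A_def split: split_indicator)
        also have "\<dots> \<le> (\<Sum>u\<in>G. \<Sum>v\<in>words L. of_nat (card (common_ancestors u v)) *
              (indicator {y\<^sub>0..} (mass 1 (d \<omega>) u) * indicator {y\<^sub>0..} (mass 1 (d \<omega>) v)))"
          by (intro sum_mono sum_mono2 G_words) auto
        also have "\<dots> \<le> common_ancestor_pairs L y\<^sub>0 (d \<omega>)"
          by (intro sum_mono2 G_words) auto
        finally show ?case .
      qed
    qed
    also have "\<dots> = (\<integral>\<^sup>+x. common_ancestor_pairs L y\<^sub>0 x \<partial>distr M splits d)"
      by (rule nn_integral_distr[symmetric]) measurable
    also have "\<dots> \<le> ennreal Kc" unfolding distr by (rule pairs)
    finally show ?thesis using Kc by simp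
  qed
  have Y_moment: "(\<integral>\<^sup>+\<omega>. ennreal ((Y \<omega>)\<^sup>2) \<partial>M) \<le> ennreal ((1 - p) * Kc)"
  proof -
    have bound: "\<bar>Y \<omega>\<bar> \<le> real (card G)" for \<omega>
    proof -
      have "\<bar>Y \<omega>\<bar> \<le> (\<Sum>v\<in>G. 1)"
        unfolding Y_def
      proof (intro order_trans[OF sum_abs] sum_mono)
        fix v :: "'b list"
        have "0 \<le> p ^ length v" "p ^ length v \<le> 1" using p by (auto simp: power_le_one)
        then show "\<bar>indicator (A v) \<omega> * (indicator {\<omega>\<in>space M. \<forall>s\<in>ancestors v. \<kappa> s \<omega>} \<omega> - p ^ length v)\<bar> \<le> 1"
          by (auto split: split_indicator)
      qed
      then show ?thesis by simp
    qed
    have "(\<integral>\<^sup>+\<omega>. ennreal ((Y \<omega>)\<^sup>2) \<partial>M) = ennreal (M.expectation (\<lambda>\<omega>. (Y \<omega>)\<^sup>2))"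
    proof (rule nn_integral_eq_integral)
      show "integrable M (\<lambda>\<omega>. (Y \<omega>)\<^sup>2)"
      proof (rule M.integrable_const_bound[where B = "(real (card G))\<^sup>2"])
        show "AE \<omega> in M. norm ((Y \<omega>)\<^sup>2) \<le> (real (card G))\<^sup>2"
          using bound by (intro AE_I2) (simp add: abs_le_square_iff[symmetric])
      qed measurable
    qed simp
    also have "\<dots> \<le> ennreal ((1 - p) * Kc)"
    proof (rule ennreal_leI)
      have "M.expectation (\<lambda>\<omega>. (Y \<omega>)\<^sup>2)
          \<le> (1 - p) * (\<Sum>u\<in>G. \<Sum>v\<in>G. real (card (common_ancestors u v)) * M.prob (A u \<inter> A v))"
        unfolding Y_def by (rule M.percolation_second_moment(2)[OF p finG A_sets \<kappa> A_indep])
      also have "\<dots> \<le> (1 - p) * Kc" using p by (intro mult_left_mono[OF pair_sum]) simp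
      finally show "M.expectation (\<lambda>\<omega>. (Y \<omega>)\<^sup>2) \<le> (1 - p) * Kc" .
    qed
    finally show ?thesis .
  qed
  define N where "N x = tied_pairs L y\<^sub>0 x"
    for x :: "'b list \<Rightarrow> real ^ 'b"
  have N_meas [measurable]: "N \<in> borel_measurable splits"
    unfolding N_def indicator_def split_beta by measurable
  \<comment> \<open>A random variable that is almost surely at least 1 on the bad event; integrating
    it gives all three inequalities at once.\<close>
  define \<Phi> where "\<Phi> \<omega> = ennreal (16 / (\<epsilon> * n)\<^sup>2) * ennreal ((Y \<omega>)\<^sup>2) + ennreal (64 / (\<epsilon> * n)\<^sup>2) * N (d \<omega>)
    + ennreal (16 / (\<epsilon> * n)) * outliers y\<^sub>0 P (d \<omega>)" for \<omega>
  define D where "D = {\<omega>\<in>space M. \<bar>real (card (cluster (T \<omega>) (\<lambda>v. \<kappa> v \<omega>) [])) / n - l\<bar> > \<epsilon>}"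
  have "AE \<omega> in M. indicator D \<omega> \<le> \<Phi> \<omega>"
    using AE_good
  proof eventually_elim
    case (elim \<omega>)
    show ?case
    proof (cases "\<omega> \<in> D")
      case True
      then have sp: "\<omega> \<in> space M" by (simp add: D_def)
      obtain J :: nat where J: "of_nat J ^ 2 \<le> N (d \<omega>)"
        "\<bar>real (card (cluster (frag_tree x\<^sub>0 (d \<omega>) n) (\<lambda>v. \<kappa> v \<omega>) [])) - l * n\<bar>
          \<le> \<bar>\<Sum>v\<in>{v. \<not> P (length v)}. indicator (frag_tree x\<^sub>0 (d \<omega>) n) v *
              (indicator {v. \<forall>s\<in>ancestors v. \<kappa> s \<omega>} v - p ^ length v)\<bar>
            + \<eta> * n + 2 * real J + 4 * real (card {v \<in> heavy y\<^sub>0 (d \<omega>). P (length v)})"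
        unfolding N_def
        by (rule root_cluster_deviation[OF conjunct1[OF elim] n x0 conjunct2[OF elim] y0 L l \<eta>(1,2) power]) blast
      define q where "q = card {v \<in> heavy y\<^sub>0 (d \<omega>). P (length v)}"
      have q: "of_nat q \<le> outliers y\<^sub>0 P (d \<omega>)"
        unfolding q_def by (rule card_outliers_le) (use elim in simp)
      have Y_eq: "(\<Sum>v\<in>{v. \<not> P (length v)}. indicator (T \<omega>) v *
              (indicator {v. \<forall>s\<in>ancestors v. \<kappa> s \<omega>} v - p ^ length v)) = Y \<omega>"
        unfolding Y_def G_def A_def using sp by (intro sum.cong refl) (auto simp: indicator_def)
      define E where "E = \<epsilon> * n"
      have E: "E > 0" using \<epsilon> n by (simp add: E_def)
      have "E < \<bar>real (card (cluster (T \<omega>) (\<lambda>v. \<kappa> v \<omega>) [])) - l * n\<bar>"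
      proof -
        have "\<bar>real (card (cluster (T \<omega>) (\<lambda>v. \<kappa> v \<omega>) [])) - l * n\<bar>
            = \<bar>real (card (cluster (T \<omega>) (\<lambda>v. \<kappa> v \<omega>) [])) / n - l\<bar> * n"
        proof -
          have "x - l * n = (x / n - l) * n" for x :: real using n by (simp add: field_simps)
          then show ?thesis by (simp add: abs_mult)
        qed
        moreover have "\<epsilon> < \<bar>real (card (cluster (T \<omega>) (\<lambda>v. \<kappa> v \<omega>) [])) / n - l\<bar>" using True by (simp add: D_def)
        ultimately show ?thesis using n by (simp add: E_def)
      qed
      also have "\<dots> \<le> \<bar>Y \<omega>\<bar> + \<eta> * n + 2 * real J + 4 * real q"
        using J(2) unfolding T_def[symmetric] Y_eq q_def[symmetric] .
      finally have "E < \<bar>Y \<omega>\<bar> + \<eta> * n + 2 * real J + 4 * real q" .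
      moreover have "4 * (\<eta> * n) \<le> E" using mult_right_mono[OF \<eta>(3), of "real n"] by (simp add: E_def)
      ultimately have "E / 4 \<le> \<bar>Y \<omega>\<bar> \<or> E / 8 \<le> real J \<or> E / 16 \<le> real q" by linarith
      then have "1 \<le> 16 / E\<^sup>2 * (Y \<omega>)\<^sup>2 \<or> 1 \<le> 64 / E\<^sup>2 * (real J)\<^sup>2 \<or> 1 \<le> 16 / E * real q"
      proof (elim disjE)
        assume "E / 4 \<le> \<bar>Y \<omega>\<bar>"
        then have "(E / 4)\<^sup>2 \<le> \<bar>Y \<omega>\<bar>\<^sup>2" using E by (intro power_mono) auto
        then show ?thesis using E by (simp add: field_simps)
      next
        assume "E / 8 \<le> real J"
        then have "(E / 8)\<^sup>2 \<le> (real J)\<^sup>2" using E by (intro power_mono) auto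
        then show ?thesis using E by (simp add: field_simps)
      next
        assume "E / 16 \<le> real q"
        then show ?thesis using E by (simp add: field_simps)
      qed
      then have "ennreal 1 \<le> ennreal (16 / E\<^sup>2 * (Y \<omega>)\<^sup>2) + ennreal (64 / E\<^sup>2 * (real J)\<^sup>2) + ennreal (16 / E * real q)"
      proof (elim disjE)
        assume "1 \<le> 16 / E\<^sup>2 * (Y \<omega>)\<^sup>2"
        then show ?thesis by (intro add_increasing2 ennreal_leI) auto
      next
        assume "1 \<le> 64 / E\<^sup>2 * (real J)\<^sup>2"
        then show ?thesis by (intro add_increasing2[OF _ add_increasing] ennreal_leI) auto
      next
        assume "1 \<le> 16 / E * real q"
        then show ?thesis by (intro add_increasing ennreal_leI) auto
      qed
      also have "\<dots> = ennreal (16 / E\<^sup>2) * ennreal ((Y \<omega>)\<^sup>2) + ennreal (64 / E\<^sup>2) * of_nat J ^ 2 + ennreal (16 / E) * of_nat q"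
        by (simp only: ennreal_mult'' zero_le_power2 of_nat_0_le_iff ennreal_of_nat_eq_real_of_nat ennreal_power)
      also have "\<dots> \<le> \<Phi> \<omega>"
        unfolding \<Phi>_def E_def[symmetric] using J(1) q by (intro add_mono mult_left_mono) auto
      finally show ?thesis using True by simp
    qed simp
  qed
  note D_le = this
  have T_sets: "{\<omega>\<in>space M. v \<in> T \<omega>} \<in> sets M" for v
    using A_sets[of v] by (simp add: A_def)
  have D_sets [measurable]: "D \<in> sets M"
  proof -
    have "{\<omega>\<in>space M. v \<in> cluster (T \<omega>) (\<lambda>v. \<kappa> v \<omega>) []} \<in> sets M" for v
    proof -
      have "{\<omega>\<in>space M. v \<in> cluster (T \<omega>) (\<lambda>v. \<kappa> v \<omega>) []}
          = {\<omega>\<in>space M. \<forall>s\<in>set (suffixes v). s \<in> T \<omega>} \<inter> {\<omega>\<in>space M. \<forall>s\<in>ancestors v. \<kappa> s \<omega>}"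
        by (auto simp: root_cluster_eq ancestors_def)
      also have "\<dots> \<in> sets M"
        by (intro sets.Int \<kappa> sets.sets_Collect_finite_All' T_sets) auto
      finally show ?thesis .
    qed
    from measurable_card[OF this] have [measurable]:
      "(\<lambda>\<omega>. real (card (cluster (T \<omega>) (\<lambda>v. \<kappa> v \<omega>) []))) \<in> borel_measurable M"
      by (rule measurable_compose) simp
    show ?thesis unfolding D_def by measurable
  qed
  have "ennreal (M.prob D) = (\<integral>\<^sup>+\<omega>. indicator D \<omega> \<partial>M)"
    by (simp add: M.emeasure_eq_measure)
  also have "\<dots> \<le> (\<integral>\<^sup>+\<omega>. \<Phi> \<omega> \<partial>M)" by (rule nn_integral_mono_AE[OF D_le])
  also have "\<dots> = ennreal (16 / (\<epsilon> * n)\<^sup>2) * (\<integral>\<^sup>+\<omega>. ennreal ((Y \<omega>)\<^sup>2) \<partial>M)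
    + ennreal (64 / (\<epsilon> * n)\<^sup>2) * (\<integral>\<^sup>+\<omega>. N (d \<omega>) \<partial>M) + ennreal (16 / (\<epsilon> * n)) * (\<integral>\<^sup>+\<omega>. outliers y\<^sub>0 P (d \<omega>) \<partial>M)"
    unfolding \<Phi>_def by (simp add: nn_integral_add nn_integral_cmult)
  also have "(\<integral>\<^sup>+\<omega>. N (d \<omega>) \<partial>M) = (\<integral>\<^sup>+x. N x \<partial>splits)"
    using nn_integral_distr[OF d_meas, of N] by (simp add: distr)
  also have "(\<integral>\<^sup>+\<omega>. outliers y\<^sub>0 P (d \<omega>) \<partial>M) = (\<integral>\<^sup>+x. outliers y\<^sub>0 P x \<partial>splits)"
    using nn_integral_distr[OF d_meas, of "outliers y\<^sub>0 P"] by (simp add: distr)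
  also have "ennreal (16 / (\<epsilon> * n)\<^sup>2) * (\<integral>\<^sup>+\<omega>. ennreal ((Y \<omega>)\<^sup>2) \<partial>M)
    + ennreal (64 / (\<epsilon> * n)\<^sup>2) * (\<integral>\<^sup>+x. N x \<partial>splits) + ennreal (16 / (\<epsilon> * n)) * (\<integral>\<^sup>+x. outliers y\<^sub>0 P x \<partial>splits)
    \<le> ennreal (16 / (\<epsilon> * n)\<^sup>2) * ennreal ((1 - p) * Kc)
    + ennreal (64 / (\<epsilon> * n)\<^sup>2) * ennreal Kt + ennreal (16 / (\<epsilon> * n)) * ennreal Ko"
    using Y_moment ties outl unfolding N_def by (intro add_mono mult_left_mono) auto
  also have "\<dots> = ennreal (16 / (\<epsilon> * n)\<^sup>2 * ((1 - p) * Kc) + 64 / (\<epsilon> * n)\<^sup>2 * Kt + 16 / (\<epsilon> * n) * Ko)"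
  proof -
    have "0 \<le> 16 / (\<epsilon> * n)\<^sup>2" "0 \<le> 64 / (\<epsilon> * n)\<^sup>2" "0 \<le> 16 / (\<epsilon> * n)" "0 \<le> (1 - p) * Kc"
      using \<epsilon> p Kc by auto
    then show ?thesis
      using Kt Ko by (simp only: ennreal_mult ennreal_plus mult_nonneg_nonneg add_nonneg_nonneg)
  qed
  finally have "M.prob D \<le> 16 / (\<epsilon> * n)\<^sup>2 * ((1 - p) * Kc) + 64 / (\<epsilon> * n)\<^sup>2 * Kt + 16 / (\<epsilon> * n) * Ko"
    using \<epsilon> p Kc Kt Ko by (subst (asm) ennreal_le_iff) auto
  then show ?thesis by (simp add: D_def T_def d_def[abs_def])
qed

text \<open>The three expectation bounds at level \<open>1 / (b * n)\<close>, with the heights in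
  the window of \<open>power_concentration\<close> as typical ones. After normalisation only the
  main term of the ties does not tend to 0, and it can be fixed in advance.\<close>

lemma eventually_bounds:
  fixes p :: "nat \<Rightarrow> real" and c \<epsilon> \<eta> e :: real
  assumes nonlattice: "\<forall>h>0. \<not> (AE d in \<nu>. \<forall>i. d $ i > 0 \<longrightarrow> - ln (d $ i) \<in> (\<lambda>x. h * x) ` \<int>)"
    and c: "c > 0" and p: "\<forall>n. 0 < p n \<and> p n < 1"
    and p_asymp: "(\<lambda>n. 1 - p n) \<sim>[sequentially] (\<lambda>n. c / ln (real n))"
    and \<epsilon>: "\<epsilon> > 0" and \<eta>: "\<eta> > 0" and e: "e > 0"
  shows "\<forall>\<^sub>F n in sequentially. \<exists>P L Kc Kt Ko.
      (\<forall>k. \<not> P k \<longrightarrow> k < L \<and> \<bar>p n ^ k - exp (- c / mean_log)\<bar> \<le> \<eta>) \<and>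
      Kc \<ge> 0 \<and> (\<integral>\<^sup>+d. common_ancestor_pairs L (1 / (CARD('b) * real n)) d \<partial>splits) \<le> ennreal Kc \<and>
      Kt \<ge> 0 \<and> (\<integral>\<^sup>+d. tied_pairs L (1 / (CARD('b) * real n)) d \<partial>splits) \<le> ennreal Kt \<and>
      Ko \<ge> 0 \<and> (\<integral>\<^sup>+d. outliers (1 / (CARD('b) * real n)) P d \<partial>splits) \<le> ennreal Ko \<and>
      16 / (\<epsilon> * n)\<^sup>2 * ((1 - p n) * Kc) + 64 / (\<epsilon> * n)\<^sup>2 * Kt + 16 / (\<epsilon> * n) * Ko < e"
proof -
  define b where "b = real CARD('b)"
  have b: "b > 0" by (simp add: b_def)
  obtain \<delta> where \<delta>: "\<delta> > 0"
    and power: "\<forall>\<^sub>F n in sequentially. \<forall>k::nat. \<bar>real k - ln n / mean_log\<bar> \<le> \<delta> * ln n \<longrightarrow> \<bar>p n ^ k - exp (- c / mean_log)\<bar> \<le> \<eta>"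
    using power_concentration[OF c mean_log_pos \<eta> p[rule_format] p_asymp] by blast
  obtain K where K: "K \<ge> 0" and pairs: "\<And>L y. 0 < y \<Longrightarrow> y \<le> 1 \<Longrightarrow>
    (\<integral>\<^sup>+d. common_ancestor_pairs L y d \<partial>splits) \<le> ennreal (K / y ^ 2)"
    using common_ancestor_pairs_le by blast
  \<comment> \<open>Solves \<open>64 * \<epsilon>' * b\<^sup>2 / \<epsilon>\<^sup>2 = e / 2\<close>,
    so the ties use up half of \<open>e\<close>.\<close>
  define \<epsilon>' where "\<epsilon>' = e * \<epsilon>\<^sup>2 / (128 * b\<^sup>2)"
  have \<epsilon>': "\<epsilon>' > 0" using e \<epsilon> b by (simp add: \<epsilon>'_def)
  obtain K' where K': "K' \<ge> 0" and ties: "\<And>L y. 0 < y \<Longrightarrow>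
    (\<integral>\<^sup>+d. tied_pairs L y d \<partial>splits)
    \<le> ennreal (\<epsilon>' / y ^ 2 + K' * y powr (-3/2))"
    using tied_pairs_le[OF nonlattice[rule_format] \<epsilon>'] by blast
  obtain C \<gamma> where C: "C \<ge> 0" "\<gamma> > 0" and outl: "\<And>n :: nat. n \<ge> 1 \<Longrightarrow>
    (\<integral>\<^sup>+d. outliers (1 / (CARD('b) * real n)) (\<lambda>k. \<bar>real k - ln n / mean_log\<bar> > \<delta> * ln n) d \<partial>splits)
    \<le> ennreal (C * n powr (1 - \<gamma>))"
    using outliers_negligible[OF \<delta>] by blast
  have ln_top: "filterlim (\<lambda>n. ln (real n)) at_top sequentially"
    by (rule filterlim_compose[OF ln_at_top filterlim_real_sequentially])
  have p0: "(\<lambda>n. 1 - p n) \<longlonglongrightarrow> 0"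
    by (rule asymp_equiv_tendsto_transfer[OF asymp_equiv_symI[OF p_asymp]
          real_tendsto_divide_at_top[OF tendsto_const ln_top]])
  have powr_0: "(\<lambda>n. real n powr - a) \<longlonglongrightarrow> 0" if "a > 0" for a
    by (rule tendsto_neg_powr[OF _ filterlim_real_sequentially]) (use that in simp)
  \<comment> \<open>The vanishing terms: percolation variance, lower order part of the ties, and
    outliers.\<close>
  define r where "r n = 16 * K * b\<^sup>2 / \<epsilon>\<^sup>2 * (1 - p n) + 64 * K' * b powr (3/2) / \<epsilon>\<^sup>2 * real n powr - (1/2)
    + 16 * C / \<epsilon> * real n powr - \<gamma>" for n
  have "r \<longlonglongrightarrow> 16 * K * b\<^sup>2 / \<epsilon>\<^sup>2 * 0 + 64 * K' * b powr (3/2) / \<epsilon>\<^sup>2 * 0 + 16 * C / \<epsilon> * 0"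
    unfolding r_def using C by (intro tendsto_intros p0 powr_0) auto
  then have "\<forall>\<^sub>F n in sequentially. r n < e / 2"
    using e by (intro order_tendstoD) auto
  then show ?thesis
    using power eventually_ge_at_top[of 1]
  proof eventually_elim
    case (elim n)
    have n: "n \<ge> 1" by fact
    define y where "y = 1 / (CARD('b) * real n)"
    have y: "0 < y" using n by (simp add: y_def)
    have "1 * 1 \<le> CARD('b) * n" by (rule mult_mono) (use n in \<open>auto simp: Suc_le_eq\<close>)
    then have "y \<le> 1" by (simp add: y_def flip: of_nat_mult)
    define P where "P k \<longleftrightarrow> \<bar>real k - ln n / mean_log\<bar> > \<delta> * ln n" for k :: nat
    \<comment> \<open>Strictly above every typical height, as required for their words to lie in
      \<open>words L\<close>.\<close>
    define L where "L = Suc (nat \<lceil>ln n / mean_log + \<delta> * ln n\<rceil>)"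
    have bounds: "k < L \<and> \<bar>p n ^ k - exp (- c / mean_log)\<bar> \<le> \<eta>" if "\<not> P k" for k
    proof
      have "real k \<le> ln n / mean_log + \<delta> * ln n" using that by (auto simp: P_def)
      then show "k < L" unfolding L_def by linarith
      show "\<bar>p n ^ k - exp (- c / mean_log)\<bar> \<le> \<eta>"
        using elim(2) that by (auto simp: P_def not_less)
    qed
    have outl_P: "(\<integral>\<^sup>+d. outliers y P d \<partial>splits) \<le> ennreal (C * n powr (1 - \<gamma>))"
      unfolding y_def P_def by (rule outl[OF n])
    have nonneg: "0 \<le> K / y ^ 2" "0 \<le> \<epsilon>' / y ^ 2 + K' * y powr (-3/2)" "0 \<le> C * n powr (1 - \<gamma>)"
      using K K' C \<epsilon>' by auto
    have "16 / (\<epsilon> * n)\<^sup>2 * ((1 - p n) * (K / y ^ 2)) + 64 / (\<epsilon> * n)\<^sup>2 * (\<epsilon>' / y ^ 2 + K' * y powr (-3/2))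
        + 16 / (\<epsilon> * n) * (C * n powr (1 - \<gamma>)) = r n + e / 2"
    proof -
      have n0: "real n > 0" using n by simp
      have 1: "16 / (\<epsilon> * n)\<^sup>2 * ((1 - p n) * (K / y ^ 2)) = 16 * K * b\<^sup>2 / \<epsilon>\<^sup>2 * (1 - p n)"
        using n0 by (simp add: y_def b_def[symmetric] power_mult_distrib power_divide)
      have "y powr (-3/2) = (b * n) powr (3/2)"
        using n0 b powr_divide[of 1 "b * n" "-3/2"] powr_minus_divide[of "b * n" "3/2"]
        by (simp add: y_def b_def[symmetric])
      also have "\<dots> = b powr (3/2) * (n powr - (1/2) * n powr 2)"
        using n0 by (subst powr_add[symmetric]) (simp add: powr_mult)
      also have "n powr 2 = (real n)\<^sup>2" using n0 by simp
      finally have "K' * y powr (-3/2) / (real n)\<^sup>2 = K' * b powr (3/2) * n powr - (1/2)"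
        using n0 by simp
      moreover have "64 / (\<epsilon> * n)\<^sup>2 * (\<epsilon>' / y ^ 2 + K' * y powr (-3/2))
          = 64 * \<epsilon>' * b\<^sup>2 / \<epsilon>\<^sup>2 + 64 / \<epsilon>\<^sup>2 * (K' * y powr (-3/2) / (real n)\<^sup>2)"
        using n0 by (simp add: y_def b_def[symmetric] power_mult_distrib power_divide distrib_left)
      moreover have "64 * \<epsilon>' * b\<^sup>2 / \<epsilon>\<^sup>2 = e / 2" using b \<epsilon> by (simp add: \<epsilon>'_def)
      ultimately have 2: "64 / (\<epsilon> * n)\<^sup>2 * (\<epsilon>' / y ^ 2 + K' * y powr (-3/2))
          = e / 2 + 64 * K' * b powr (3/2) / \<epsilon>\<^sup>2 * n powr - (1/2)" by simp
      have "n powr (1 - \<gamma>) = n * n powr - \<gamma>" using n0 powr_add[of "real n" 1 "- \<gamma>"] by simp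
      then have 3: "16 / (\<epsilon> * n) * (C * n powr (1 - \<gamma>)) = 16 * C / \<epsilon> * n powr - \<gamma>" using n0 by simp
      show ?thesis unfolding 1 2 3 r_def by simp
    qed
    also have "\<dots> < e" using elim(1) by simp
    finally show ?case
      unfolding y_def[symmetric] using bounds nonneg pairs[OF y \<open>y \<le> 1\<close>] ties[OF y] outl_P
      by (intro exI[of _ P] exI[of _ L] exI[of _ "K / y ^ 2"] exI[of _ "\<epsilon>' / y ^ 2 + K' * y powr (-3/2)"]
          exI[of _ "C * n powr (1 - \<gamma>)"]) blast
  qed
qed

end

theorem corollary4:
  fixes \<Omega> :: "'o measure" and V :: "'o \<Rightarrow> real ^ 'b"
    and M :: "'w measure"
    and X :: "'b list \<Rightarrow> 'w \<Rightarrow> real ^ 'b"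
    and K :: "nat \<Rightarrow> 'b list \<Rightarrow> 'w \<Rightarrow> bool"
    and x\<^sub>0 c :: real and p :: "nat \<Rightarrow> real"
  assumes b: "CARD('b) \<ge> 2"
    and \<Omega>: "prob_space \<Omega>" and V: "V \<in> borel_measurable \<Omega>"
    and V_range: "AE \<omega> in \<Omega>. \<forall>i. 0 \<le> V \<omega> $ i \<and> V \<omega> $ i < 1"
    and V_sum: "AE \<omega> in \<Omega>. (\<Sum>i\<in>UNIV. V \<omega> $ i) = 1"
    and nonlattice: "\<forall>h>0. \<not> concentrated_on_lattice (age_intensity \<Omega> V) h"
    and c: "c > 0" and p: "\<forall>n. 0 < p n \<and> p n < 1"
    and p_asymp: "(\<lambda>n. 1 - p n) \<sim>[sequentially] (\<lambda>n. c / ln (real n))"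
    and M: "prob_space M" and x0: "x\<^sub>0 > 0"
    and X_indep: "prob_space.indep_vars M (\<lambda>_. borel) X UNIV"
    and X_distr: "\<forall>v. distr M borel (X v) = distr \<Omega> borel V"
    and K_indep: "\<forall>n. prob_space.indep_vars M (\<lambda>_. count_space UNIV) (K n) {v. v \<noteq> []}"
    and K_prob: "\<forall>n v. v \<noteq> [] \<longrightarrow> measure M {\<omega> \<in> space M. K n v \<omega>} = p n"
    and KX_indep: "\<forall>n. indep_rvs M
          (PiM UNIV (\<lambda>_. borel)) (\<lambda>\<omega> v. X v \<omega>)
          (PiM {v. v \<noteq> []} (\<lambda>_. count_space UNIV)) (\<lambda>\<omega>. \<lambda>v\<in>{v. v \<noteq> []}. K n v \<omega>)"
  shows "tendsto_in_probability M
           (\<lambda>n \<omega>. real (card (cluster (frag_tree x\<^sub>0 (\<lambda>v. X v \<omega>) n) (\<lambda>v. K n v \<omega>) [])) / real n)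
           (exp (- c / mean_age \<Omega> V))"
proof -
  interpret \<Omega>: prob_space \<Omega> by (rule \<Omega>)
  interpret M: prob_space M by (rule M)
  note [measurable] = V
  define \<nu> where "\<nu> = distr \<Omega> borel V"
  interpret dislocation \<nu>
  proof -
    interpret D: prob_space \<nu> unfolding \<nu>_def by (rule \<Omega>.prob_space_distr) measurable
    show "dislocation \<nu>"
    proof
      show "sets \<nu> = sets borel" by (simp add: \<nu>_def)
      show "AE d in \<nu>. \<forall>i. 0 \<le> d $ i \<and> d $ i < 1"
        unfolding \<nu>_def by (subst AE_distr_iff) (use V_range in measurable)
      show "AE d in \<nu>. (\<Sum>i\<in>UNIV. d $ i) = 1"
        unfolding \<nu>_def by (subst AE_distr_iff) (use V_sum in measurable)
    qed
  qed
  have mean: "mean_age \<Omega> V = mean_log"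
  proof -
    have "mean_log = (\<Sum>i\<in>UNIV. \<integral>d. d $ i * ln (1 / d $ i) \<partial>\<nu>)"
      unfolding mean_log_def child_mean_def
    proof (rule Bochner_Integration.integral_sum)
      fix i :: 'b
      show "integrable \<nu> (\<lambda>d. d $ i * ln (1 / d $ i))"
      proof (rule integrable_const_bound[where B = 1])
        show "AE d in \<nu>. norm (d $ i * ln (1 / d $ i)) \<le> 1"
          using AE_range
        proof eventually_elim
          case (elim d)
          then show ?case using x_ln_inverse_bounded[of "d $ i"] by simp
        qed
      qed measurable
    qed
    also have "\<dots> = mean_age \<Omega> V"
      unfolding mean_age_def \<nu>_def by (intro sum.cong refl integral_distr) measurable
    finally show ?thesis by simp
  qed
  \<comment> \<open>If all ages of children of positive mass lay in the lattice almost surely, each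
    summand of the intensity of its complement would vanish.\<close>
  have nonlattice': "\<forall>h>0. \<not> (AE d in \<nu>. \<forall>i. d $ i > 0 \<longrightarrow> - ln (d $ i) \<in> (\<lambda>x. h * x) ` \<int>)"
  proof (intro allI impI notI)
    fix h :: real assume h: "h > 0"
    assume "AE d in \<nu>. \<forall>i. d $ i > 0 \<longrightarrow> - ln (d $ i) \<in> (\<lambda>x. h * x) ` \<int>"
    then have "AE \<omega> in \<Omega>. \<forall>i. V \<omega> $ i > 0 \<longrightarrow> - ln (V \<omega> $ i) \<in> (\<lambda>x. h * x) ` \<int>"
      unfolding \<nu>_def by (rule AE_distrD[OF V])
    then have "AE \<omega> in \<Omega>. \<not> (- ln (V \<omega> $ i) \<in> {0<..} - (\<lambda>x. h * x) ` \<int> \<and> V \<omega> $ i > 0)" for i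
      by eventually_elim auto
    then have "emeasure \<Omega> {\<omega> \<in> space \<Omega>. - ln (V \<omega> $ i) \<in> {0<..} - (\<lambda>x. h * x) ` \<int> \<and> V \<omega> $ i > 0} = 0" for i
      by (rule emeasure_eq_0_AE)
    then have "concentrated_on_lattice (age_intensity \<Omega> V) h"
      by (simp only: concentrated_on_lattice_def age_intensity_def measure_def enn2real_0 sum.neutral_const)
    then show False using nonlattice h by blast
  qed
  have rv [measurable]: "X v \<in> borel_measurable M" for v
    using X_indep by (simp add: M.indep_vars_def)
  have X_\<nu>: "distr M borel (X v) = \<nu>" for v
    using X_distr by (simp add: \<nu>_def)
  have Kv: "{\<omega>\<in>space M. K n v \<omega>} \<in> sets M" if "v \<noteq> []" for n v
  proof -
    have "K n v \<in> measurable M (count_space UNIV)"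
      using K_indep that by (auto simp: M.indep_vars_def)
    from measurable_sets[OF this, of "{True}"] show ?thesis
      by (simp add: vimage_def Int_def conj_commute)
  qed
  have K_sets: "{\<omega>\<in>space M. \<forall>s\<in>J. K n s \<omega>} \<in> sets M" if "finite J" "[] \<notin> J" for n J
    using that by (intro sets.sets_Collect_finite_All Kv) auto
  have K_meas: "measure M {\<omega>\<in>space M. \<forall>s\<in>J. K n s \<omega>} = p n ^ card J" if J: "finite J" "[] \<notin> J" for n J
  proof (cases "J = {}")
    case False
    have "measure M (\<Inter>s\<in>J. K n s -` {True} \<inter> space M) = (\<Prod>s\<in>J. measure M (K n s -` {True} \<inter> space M))"
      using K_indep J False by (intro M.indep_varsD[where I = "{v. v \<noteq> []}" and M' = "\<lambda>_. count_space UNIV"]) auto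
    also have "(\<Inter>s\<in>J. K n s -` {True} \<inter> space M) = {\<omega>\<in>space M. \<forall>s\<in>J. K n s \<omega>}"
      using False by auto
    also have "(\<Prod>s\<in>J. measure M (K n s -` {True} \<inter> space M)) = (\<Prod>s\<in>J. p n)"
    proof (rule prod.cong[OF refl])
      fix s assume "s \<in> J"
      then have "s \<noteq> []" using J by auto
      moreover have "K n s -` {True} \<inter> space M = {\<omega>\<in>space M. K n s \<omega>}" by auto
      ultimately show "measure M (K n s -` {True} \<inter> space M) = p n" using K_prob by simp
    qed
    finally show ?thesis by simp
  qed (simp add: M.prob_space)
  \<comment> \<open>The condition on finitely many edges is a cylinder event over the nonroot words,
    and the one on \<open>X\<close> an event of the product space; this is the form in which the two
    families are assumed independent.\<close>
  have KX: "measure M ({\<omega>\<in>space M. (\<lambda>v. X v \<omega>) \<in> B} \<inter> {\<omega>\<in>space M. \<forall>s\<in>J. K n s \<omega>})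
        = measure M {\<omega>\<in>space M. (\<lambda>v. X v \<omega>) \<in> B} * p n ^ card J"
    if B: "B \<in> sets splits" and J: "finite J" "[] \<notin> J" for n B J
  proof -
    define I where "I = {v :: 'b list. v \<noteq> []}"
    have "{f \<in> space (PiM I (\<lambda>_. count_space UNIV)). \<forall>s\<in>J. f s} \<in> sets (PiM I (\<lambda>_. count_space (UNIV :: bool set)))"
    proof (intro sets.sets_Collect_finite_All J)
      fix s assume "s \<in> J"
      then have "s \<in> I" using J by (auto simp: I_def)
      then have "(\<lambda>f. f s) \<in> measurable (PiM I (\<lambda>_. count_space (UNIV :: bool set))) (count_space UNIV)"
        by (rule measurable_component_singleton)
      from measurable_sets[OF this, of "{True}"]
      show "{f \<in> space (PiM I (\<lambda>_. count_space UNIV)). f s} \<in> sets (PiM I (\<lambda>_. count_space (UNIV :: bool set)))"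
        by (simp add: vimage_def Int_def conj_commute)
    qed
    moreover have "(\<lambda>\<omega>. \<lambda>v\<in>I. K n v \<omega>) -` {f \<in> space (PiM I (\<lambda>_. count_space UNIV)). \<forall>s\<in>J. f s} \<inter> space M
        = {\<omega>\<in>space M. \<forall>s\<in>J. K n s \<omega>}"
    proof -
      have "(\<lambda>v\<in>I. K n v \<omega>) s = K n s \<omega>" if "s \<in> J" for s \<omega>
        using that J by (auto simp: I_def)
      moreover have "(\<lambda>v\<in>I. K n v \<omega>) \<in> space (PiM I (\<lambda>_. count_space UNIV))" for \<omega>
        by (simp add: space_PiM)
      ultimately show ?thesis by auto
    qed
    ultimately have 1: "{\<omega>\<in>space M. \<forall>s\<in>J. K n s \<omega>}
        \<in> {(\<lambda>\<omega>. \<lambda>v\<in>I. K n v \<omega>) -` A \<inter> space M | A. A \<in> sets (PiM I (\<lambda>_. count_space UNIV))}" by blast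
    have 2: "{\<omega>\<in>space M. (\<lambda>v. X v \<omega>) \<in> B} \<in> {(\<lambda>\<omega> v. X v \<omega>) -` A \<inter> space M | A. A \<in> sets (PiM UNIV (\<lambda>_. borel))}"
      using B by (auto simp: sets_splits)
    have "M.indep_set {(\<lambda>\<omega> v. X v \<omega>) -` A \<inter> space M | A. A \<in> sets (PiM UNIV (\<lambda>_. borel))}
        {(\<lambda>\<omega>. \<lambda>v\<in>I. K n v \<omega>) -` A \<inter> space M | A. A \<in> sets (PiM I (\<lambda>_. count_space UNIV))}"
      using KX_indep by (simp add: indep_rvs_def I_def)
    from M.indep_setD[OF this 2 1] show ?thesis by (simp add: K_meas[OF J])
  qed
  have l: "0 \<le> exp (- c / mean_log)" "exp (- c / mean_log) \<le> 1"
    using c mean_log_pos by auto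
  show ?thesis
    unfolding tendsto_in_probability_def mean
  proof (intro conjI allI impI)
    fix n
    have "{\<omega>\<in>space M. v \<in> cluster (frag_tree x\<^sub>0 (\<lambda>v. X v \<omega>) n) (\<lambda>v. K n v \<omega>) []} \<in> sets M" for v
    proof -
      have "{\<omega>\<in>space M. v \<in> cluster (frag_tree x\<^sub>0 (\<lambda>v. X v \<omega>) n) (\<lambda>v. K n v \<omega>) []}
          = {\<omega>\<in>space M. \<forall>s\<in>set (suffixes v). s \<in> frag_tree x\<^sub>0 (\<lambda>v. X v \<omega>) n} \<inter> {\<omega>\<in>space M. \<forall>s\<in>ancestors v. K n s \<omega>}"
        by (auto simp: root_cluster_eq ancestors_def)
      also have "\<dots> \<in> sets M"
        by (intro sets.Int K_sets sets.sets_Collect_finite_All measurable_frag_tree rv x0) auto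
      finally show ?thesis .
    qed
    from measurable_card[OF this] have [measurable]:
      "(\<lambda>\<omega>. real (card (cluster (frag_tree x\<^sub>0 (\<lambda>v. X v \<omega>) n) (\<lambda>v. K n v \<omega>) []))) \<in> borel_measurable M"
      by (rule measurable_compose) simp
    show "(\<lambda>\<omega>. real (card (cluster (frag_tree x\<^sub>0 (\<lambda>v. X v \<omega>) n) (\<lambda>v. K n v \<omega>) [])) / real n) \<in> borel_measurable M"
      by measurable
  next
    fix \<epsilon> :: real assume \<epsilon>: "\<epsilon> > 0"
    show "(\<lambda>n. measure M {\<omega> \<in> space M. \<bar>real (card (cluster (frag_tree x\<^sub>0 (\<lambda>v. X v \<omega>) n) (\<lambda>v. K n v \<omega>) [])) / real n
        - exp (- c / mean_log)\<bar> > \<epsilon>}) \<longlonglongrightarrow> 0"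
    proof (rule tendstoI)
      fix e :: real assume e: "e > 0"
      \<comment> \<open>Keeps the error of the powers within a quarter of the tolerated deviation,
        and at most 1.\<close>
      define \<eta> where "\<eta> = min 1 (\<epsilon> / 4)"
      have \<eta>: "0 < \<eta>" "0 \<le> \<eta>" "\<eta> \<le> 1" "4 * \<eta> \<le> \<epsilon>" using \<epsilon> by (auto simp: \<eta>_def)
      have p01: "0 \<le> p n" "p n \<le> 1" for n using p by (auto simp: less_imp_le)
      from eventually_conj[OF eventually_bounds[OF nonlattice' c p p_asymp \<epsilon> \<eta>(1) e] eventually_ge_at_top[of 1]]
      show "\<forall>\<^sub>F n in sequentially. dist (measure M {\<omega> \<in> space M.
          \<bar>real (card (cluster (frag_tree x\<^sub>0 (\<lambda>v. X v \<omega>) n) (\<lambda>v. K n v \<omega>) [])) / real n - exp (- c / mean_log)\<bar> > \<epsilon>}) 0 < e"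
      proof eventually_elim
        case (elim n)
        then obtain P L Kc Kt Ko where n: "n \<ge> 1" and PL: "\<And>k. \<not> P k \<Longrightarrow> k < L"
            "\<And>k. \<not> P k \<Longrightarrow> \<bar>p n ^ k - exp (- c / mean_log)\<bar> \<le> \<eta>"
          and bounds: "Kc \<ge> 0" "(\<integral>\<^sup>+d. common_ancestor_pairs L (1 / (CARD('b) * real n)) d \<partial>splits) \<le> ennreal Kc"
            "(\<integral>\<^sup>+d. tied_pairs L (1 / (CARD('b) * real n)) d \<partial>splits) \<le> ennreal Kt" "Kt \<ge> 0"
            "(\<integral>\<^sup>+d. outliers (1 / (CARD('b) * real n)) P d \<partial>splits) \<le> ennreal Ko" "Ko \<ge> 0"
          and less: "16 / (\<epsilon> * n)\<^sup>2 * ((1 - p n) * Kc) + 64 / (\<epsilon> * n)\<^sup>2 * Kt + 16 / (\<epsilon> * n) * Ko < e"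
          by blast
        show ?case
          using le_less_trans[OF cluster_deviation_prob_le[OF M X_indep X_\<nu> K_sets KX p01 n x0 \<epsilon> l \<eta>(2-4) PL refl bounds] less]
          by simp
      qed
    qed
  qed
qed

end
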